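(* Let $R$ be a commutative Noetherian ring, let $C$ be a semidualizing $R$-module, and let $M\in\mathcal B_C(R)$. Then $$C\text{-}\mathrm{qid}_R\operatorname{Hom}_R(C,M)<\infty\iff\mathrm{qid}_R M<\infty.$$ Moreover: (1) $C\text{-}\mathrm{qid}_R\operatorname{Hom}_R(C,M)=\mathrm{qid}_R M$. (2) $I_\bullet$ is a quasi-injective resolution of $M$ if and only if it is a $C$-quasi-injective resolution of $\operatorname{Hom}_R(C,M)$.
   Context: A finitely generated $R$-module $C$ is semidualizing if the homothety map $R\to\operatorname{Hom}_R(C,C)$ is an isomorphism and $\operatorname{Ext}^i_R(C,C)=0$ for all $i>0$. The Bass class $\mathcal B_C(R)$ consists of the $R$-modules $M$ such that the evaluation map $C\otimes_R\operatorname{Hom}_R(C,M)\to M$ is an isomorphism and $\operatorname{Ext}^i_R(C,M)=0=\operatorname{Tor}^R_i(C,\operatorname{Hom}_R(C,M))$ for all $i>0$. For a complex $X_\bullet$ of $R$-modules (homological indexing, differential lowering degree), $\sup X_\bullet=\sup\{i: X_i\neq0\}$, $\inf X_\bullet=\inf\{i: X_i\neq0\}$ and $\operatorname{hinf}X_\bullet=\inf\{i:\mathrm H_i(X_\bullet)\neq0\}$. A quasi-injective resolution of an $R$-module $L$ is a bounded above complex $I_\bullet$ of injective $R$-modules such that for all $i\le\sup I_\bullet$ there are non-negative integers $b_i$, not all zero, with $\mathrm H_i(I_\bullet)\cong L^{\oplus b_i}$. The quasi-injective dimension $\mathrm{qid}_R L$ is the infimum of $\operatorname{hinf}I_\bullet-\inf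 I_\bullet$ over all bounded quasi-injective resolutions $I_\bullet$ of $L$ ($\infty$ if there are none), and it is $-\infty$ if $L=0$. A $C$-quasi-injective resolution of an $R$-module $L$ is a bounded complex $I_\bullet$ of injective $R$-modules such that $\operatorname{Hom}_R(C,I_\bullet)$ is not acyclic and each of its homology modules is zero or a finite direct sum of copies of $L$. The $C$-quasi-injective dimension $C\text{-}\mathrm{qid}_R L$ is the infimum of $\operatorname{hinf}\operatorname{Hom}_R(C,I_\bullet)-\inf\operatorname{Hom}_R(C,I_\bullet)$ over all $C$-quasi-injective resolutions $I_\bullet$ of $L$ ($\infty$ if there are none), and it is $-\infty$ if $L=0$.
   Formalization: Part (2) is proved for M ≠ 0 and with "bounded quasi-injective resolution of M" on the left; as worded it fails for unbounded injective resolutions (e.g. C = R = k[x]/(x²), M = k) and for M = 0 (the complex 0→E→E→0). *)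

theory Defs
  imports "HOL-Library.Extended_Real" "HOL-Library.FuncSet" "HOL-Algebra.Module" "HOL-Algebra.Ring_Divisibility"
begin

section \<open>Modules\<close>

text \<open>Modules are carrier-based: \<^term>\<open>module R M\<close> from HOL-Algebra. The record type of modules
  inherits the multiplication and unit fields from rings; they play no role for modules and are
  left undefined in the constructions below.\<close>

definition trivial_module :: "('r, 'm) module \<Rightarrow> bool" where
  "trivial_module M \<longleftrightarrow> carrier M = {\<zero>\<^bsub>M\<^esub>}"

definition module_hom :: "'r ring \<Rightarrow> ('r, 'a) module \<Rightarrow> ('r, 'b) module \<Rightarrow> ('a \<Rightarrow> 'b) set" where
  "module_hom R A B = {f \<in> carrier A \<rightarrow> carrier B.
     (\<forall>x\<in>carrier A. \<forall>y\<in>carrier A. f (x \<oplus>\<^bsub>A\<^esub> y) = f x \<oplus>\<^bsub>B\<^esub> f y) \<and>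
     (\<forall>r\<in>carrier R. \<forall>x\<in>carrier A. f (r \<odot>\<^bsub>A\<^esub> x) = r \<odot>\<^bsub>B\<^esub> f x)}"

definition module_iso :: "'r ring \<Rightarrow> ('r, 'a) module \<Rightarrow> ('r, 'b) module \<Rightarrow> ('a \<Rightarrow> 'b) set" where
  "module_iso R A B = {f \<in> module_hom R A B. bij_betw f (carrier A) (carrier B)}"

definition isomorphic_modules :: "'r ring \<Rightarrow> ('r, 'a) module \<Rightarrow> ('r, 'b) module \<Rightarrow> bool" where
  "isomorphic_modules R A B \<longleftrightarrow> module_iso R A B \<noteq> {}"

definition regular_module :: "'r ring \<Rightarrow> ('r, 'r) module" where
  "regular_module R = \<lparr>carrier = carrier R, monoid.mult = undefined, monoid.one = undefined,
     ring.zero = \<zero>\<^bsub>R\<^esub>, ring.add = (\<lambda>x y. x \<oplus>\<^bsub>R\<^esub> y), smult = (\<lambda>r x. r \<otimes>\<^bsub>R\<^esub> x)\<rparr>"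

definition quotient_module :: "('r, 'm) module \<Rightarrow> 'm set \<Rightarrow> ('r, 'm set) module" where
  "quotient_module M N = \<lparr>carrier = a_rcosets\<^bsub>M\<^esub> N, monoid.mult = undefined, monoid.one = undefined,
     ring.zero = N, ring.add = set_add M, smult = (\<lambda>r U. \<Union>x\<in>U. N +>\<^bsub>M\<^esub> (r \<odot>\<^bsub>M\<^esub> x))\<rparr>"

definition submodule_span :: "'r ring \<Rightarrow> ('r, 'm) module \<Rightarrow> 'm set \<Rightarrow> 'm set" where
  "submodule_span R M S = \<Inter>{N. submodule N R M \<and> S \<subseteq> N}"

definition finitely_generated_module :: "'r ring \<Rightarrow> ('r, 'm) module \<Rightarrow> bool" where
  "finitely_generated_module R M \<longleftrightarrow>
     (\<exists>S. finite S \<and> S \<subseteq> carrier M \<and> submodule_span R M S = carrier M)"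

text \<open>The direct sum of \<open>n\<close> copies of \<open>L\<close>.\<close>

definition power_module :: "('r, 'm) module \<Rightarrow> nat \<Rightarrow> ('r, nat \<Rightarrow> 'm) module" where
  "power_module L n = \<lparr>carrier = {..<n} \<rightarrow>\<^sub>E carrier L, monoid.mult = undefined, monoid.one = undefined,
     ring.zero = (\<lambda>k\<in>{..<n}. \<zero>\<^bsub>L\<^esub>), ring.add = (\<lambda>x y. \<lambda>k\<in>{..<n}. x k \<oplus>\<^bsub>L\<^esub> y k),
     smult = (\<lambda>r x. \<lambda>k\<in>{..<n}. r \<odot>\<^bsub>L\<^esub> x k)\<rparr>"

text \<open>Elements of \<open>Hom\<^sub>R(A, B)\<close> are made extensional, so that equality of homomorphisms is equality
  of HOL functions.\<close>

definition Hom_module ::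
    "'r ring \<Rightarrow> ('r, 'a) module \<Rightarrow> ('r, 'b) module \<Rightarrow> ('r, 'a \<Rightarrow> 'b) module" where
  "Hom_module R A B = \<lparr>carrier = module_hom R A B \<inter> extensional (carrier A),
     monoid.mult = undefined, monoid.one = undefined,
     ring.zero = (\<lambda>x\<in>carrier A. \<zero>\<^bsub>B\<^esub>), ring.add = (\<lambda>f g. \<lambda>x\<in>carrier A. f x \<oplus>\<^bsub>B\<^esub> g x),
     smult = (\<lambda>r f. \<lambda>x\<in>carrier A. r \<odot>\<^bsub>B\<^esub> f x)\<rparr>"

text \<open>The free module on a set \<open>X\<close>: finitely supported functions, zero outside \<open>X\<close>.\<close>

definition free_module :: "'r ring \<Rightarrow> 'x set \<Rightarrow> ('r, 'x \<Rightarrow> 'r) module" where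
  "free_module R X = \<lparr>carrier = {u. range u \<subseteq> carrier R \<and> finite {x. u x \<noteq> \<zero>\<^bsub>R\<^esub>} \<and>
       {x. u x \<noteq> \<zero>\<^bsub>R\<^esub>} \<subseteq> X},
     monoid.mult = undefined, monoid.one = undefined,
     ring.zero = (\<lambda>x. \<zero>\<^bsub>R\<^esub>), ring.add = (\<lambda>u v x. u x \<oplus>\<^bsub>R\<^esub> v x), smult = (\<lambda>r u x. r \<otimes>\<^bsub>R\<^esub> u x)\<rparr>"

definition basis_vec :: "'r ring \<Rightarrow> 'x \<Rightarrow> 'x \<Rightarrow> 'r" where
  "basis_vec R x = (\<lambda>y. if y = x then \<one>\<^bsub>R\<^esub> else \<zero>\<^bsub>R\<^esub>)"

text \<open>HOL cannot quantify over the element types of all modules inside a definition. The test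
  modules \<open>A\<close>, \<open>B\<close> therefore range over all modules whose elements lie in one fixed type, which is
  large enough to contain copies of \<open>J\<close>, of \<open>R\<close> and of every finitely generated \<open>R\<close>-module
  (a quotient of a module of \<open>n\<close>-tuples over \<open>R\<close>). Since this includes the inclusions of the ideals
  into \<open>R\<close>, by Baer's criterion enlarging the type does not change the notion.\<close>

definition injective_module :: "'r ring \<Rightarrow> ('r, 'i) module \<Rightarrow> bool" where
  "injective_module R J \<longleftrightarrow> module R J \<and>
     (\<forall>(A :: ('r, ((nat \<Rightarrow> 'r) + 'i) set) module) (B :: ('r, ((nat \<Rightarrow> 'r) + 'i) set) module) j f.
        module R A \<and> module R B \<and> j \<in> module_hom R A B \<and> inj_on j (carrier A) \<and>
        f \<in> module_hom R A J \<longrightarrow>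
        (\<exists>g\<in>module_hom R B J. \<forall>a\<in>carrier A. g (j a) = f a))"


section \<open>Tensor products\<close>

definition tensor_relations ::
    "'r ring \<Rightarrow> ('r, 'a) module \<Rightarrow> ('r, 'b) module \<Rightarrow> ('a \<times> 'b \<Rightarrow> 'r) set" where
  "tensor_relations R A B = (let F = free_module R (carrier A \<times> carrier B); e = basis_vec R in
     submodule_span R F
      ({e (a \<oplus>\<^bsub>A\<^esub> a', b) \<ominus>\<^bsub>F\<^esub> (e (a, b) \<oplus>\<^bsub>F\<^esub> e (a', b)) | a a' b.
          a \<in> carrier A \<and> a' \<in> carrier A \<and> b \<in> carrier B} \<union>
       {e (a, b \<oplus>\<^bsub>B\<^esub> b') \<ominus>\<^bsub>F\<^esub> (e (a, b) \<oplus>\<^bsub>F\<^esub> e (a, b')) | a b b'.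
          a \<in> carrier A \<and> b \<in> carrier B \<and> b' \<in> carrier B} \<union>
       {e (r \<odot>\<^bsub>A\<^esub> a, b) \<ominus>\<^bsub>F\<^esub> r \<odot>\<^bsub>F\<^esub> e (a, b) | r a b.
          r \<in> carrier R \<and> a \<in> carrier A \<and> b \<in> carrier B} \<union>
       {e (a, r \<odot>\<^bsub>B\<^esub> b) \<ominus>\<^bsub>F\<^esub> r \<odot>\<^bsub>F\<^esub> e (a, b) | r a b.
          r \<in> carrier R \<and> a \<in> carrier A \<and> b \<in> carrier B}))"

definition tensor_product ::
    "'r ring \<Rightarrow> ('r, 'a) module \<Rightarrow> ('r, 'b) module \<Rightarrow> ('r, ('a \<times> 'b \<Rightarrow> 'r) set) module" where
  "tensor_product R A B =
     quotient_module (free_module R (carrier A \<times> carrier B)) (tensor_relations R A B)"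

definition pure_tensor ::
    "'r ring \<Rightarrow> ('r, 'a) module \<Rightarrow> ('r, 'b) module \<Rightarrow> 'a \<Rightarrow> 'b \<Rightarrow> ('a \<times> 'b \<Rightarrow> 'r) set" where
  "pure_tensor R A B a b =
     tensor_relations R A B +>\<^bsub>free_module R (carrier A \<times> carrier B)\<^esub> basis_vec R (a, b)"

text \<open>The linear map \<open>A \<otimes>\<^sub>R B \<rightarrow> T\<close> induced by a bilinear map \<open>\<beta>\<close>: a class represented by a
  formal sum \<open>\<Sum> u(a,b) (a,b)\<close> is sent to \<open>\<Sum> u(a,b) \<beta>(a,b)\<close>, which for bilinear \<open>\<beta>\<close>
  does not depend on the representative.\<close>

definition tensor_lift :: "'r ring \<Rightarrow> ('r, 't) module \<Rightarrow> ('a \<Rightarrow> 'b \<Rightarrow> 't) \<Rightarrow>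
    ('a \<times> 'b \<Rightarrow> 'r) set \<Rightarrow> 't" where
  "tensor_lift R T \<beta> U = the_elem
     ((\<lambda>u. \<Oplus>\<^bsub>T\<^esub>x\<in>{x. u x \<noteq> \<zero>\<^bsub>R\<^esub>}. u x \<odot>\<^bsub>T\<^esub> \<beta> (fst x) (snd x)) ` U)"


section \<open>Complexes and homology\<close>

text \<open>Homological indexing: \<open>cdiff X i\<close> maps \<open>cobj X i\<close> to \<open>cobj X (i - 1)\<close>.\<close>

record ('r, 'm) cpx =
  cobj :: "int \<Rightarrow> ('r, 'm) module"
  cdiff :: "int \<Rightarrow> 'm \<Rightarrow> 'm"

definition chain_cpx :: "'r ring \<Rightarrow> ('r, 'm) cpx \<Rightarrow> bool" where
  "chain_cpx R X \<longleftrightarrow>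
     (\<forall>i. module R (cobj X i) \<and> cdiff X i \<in> module_hom R (cobj X i) (cobj X (i - 1)) \<and>
       (\<forall>x\<in>carrier (cobj X i). cdiff X (i - 1) (cdiff X i x) = \<zero>\<^bsub>cobj X (i - 2)\<^esub>))"

definition homology :: "('r, 'm) cpx \<Rightarrow> int \<Rightarrow> ('r, 'm set) module" where
  "homology X i = quotient_module
     (cobj X i\<lparr>carrier := a_kernel (cobj X i) (cobj X (i - 1)) (cdiff X i)\<rparr>)
     (cdiff X (i + 1) ` carrier (cobj X (i + 1)))"

definition acyclic_cpx :: "('r, 'm) cpx \<Rightarrow> bool" where
  "acyclic_cpx X \<longleftrightarrow> (\<forall>i. trivial_module (homology X i))"

definition bounded_above_cpx :: "('r, 'm) cpx \<Rightarrow> bool" where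
  "bounded_above_cpx X \<longleftrightarrow> (\<exists>n. \<forall>i>n. trivial_module (cobj X i))"

definition bounded_cpx :: "('r, 'm) cpx \<Rightarrow> bool" where
  "bounded_cpx X \<longleftrightarrow> (\<exists>m n. \<forall>i. i < m \<or> i > n \<longrightarrow> trivial_module (cobj X i))"

definition cpx_sup :: "('r, 'm) cpx \<Rightarrow> ereal" where
  "cpx_sup X = (SUP i\<in>{i. \<not> trivial_module (cobj X i)}. ereal (of_int i))"

definition cpx_inf :: "('r, 'm) cpx \<Rightarrow> ereal" where
  "cpx_inf X = (INF i\<in>{i. \<not> trivial_module (cobj X i)}. ereal (of_int i))"

definition cpx_hinf :: "('r, 'm) cpx \<Rightarrow> ereal" where
  "cpx_hinf X = (INF i\<in>{i. \<not> trivial_module (homology X i)}. ereal (of_int i))"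

text \<open>The complex \<open>Hom\<^sub>R(A, X)\<close>, for a module \<open>A\<close>.\<close>

definition Hom_cpx :: "'r ring \<Rightarrow> ('r, 'a) module \<Rightarrow> ('r, 'm) cpx \<Rightarrow> ('r, 'a \<Rightarrow> 'm) cpx" where
  "Hom_cpx R A X = \<lparr>cobj = (\<lambda>i. Hom_module R A (cobj X i)),
     cdiff = (\<lambda>i f. \<lambda>a\<in>carrier A. cdiff X i (f a))\<rparr>"

text \<open>The complex \<open>Hom\<^sub>R(X, B)\<close>, for a module \<open>B\<close>: \<open>Hom\<^sub>R(X\<^sub>i, B)\<close> sits in homological
  degree \<open>-i\<close>. No signs are introduced in the differential.\<close>

definition coHom_cpx :: "'r ring \<Rightarrow> ('r, 'm) cpx \<Rightarrow> ('r, 'b) module \<Rightarrow> ('r, 'm \<Rightarrow> 'b) cpx" where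
  "coHom_cpx R X B = \<lparr>cobj = (\<lambda>i. Hom_module R (cobj X (- i)) B),
     cdiff = (\<lambda>i f. \<lambda>x\<in>carrier (cobj X (1 - i)). f (cdiff X (1 - i) x))\<rparr>"

text \<open>The complex \<open>X \<otimes>\<^sub>R B\<close>, for a module \<open>B\<close>.\<close>

definition tensor_cpx ::
    "'r ring \<Rightarrow> ('r, 'm) cpx \<Rightarrow> ('r, 'b) module \<Rightarrow> ('r, ('m \<times> 'b \<Rightarrow> 'r) set) cpx" where
  "tensor_cpx R X B = \<lparr>cobj = (\<lambda>i. tensor_product R (cobj X i) B),
     cdiff = (\<lambda>i. tensor_lift R (tensor_product R (cobj X (i - 1)) B)
        (\<lambda>x b. pure_tensor R (cobj X (i - 1)) B (cdiff X i x) b))\<rparr>"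


section \<open>Ext and Tor\<close>

text \<open>Over a Noetherian ring every finitely generated module \<open>A\<close> has a resolution by finitely
  generated free modules. Ext and Tor are computed from an arbitrarily chosen one, so they are
  meaningful whenever \<open>R\<close> is Noetherian and the first argument \<open>A\<close> is finitely generated; the
  second argument is arbitrary.\<close>

definition fg_free_resolution ::
    "'r ring \<Rightarrow> ('r, 'a) module \<Rightarrow> ('r, nat \<Rightarrow> 'r) cpx \<Rightarrow> ((nat \<Rightarrow> 'r) \<Rightarrow> 'a) \<Rightarrow> bool" where
  "fg_free_resolution R A P e \<longleftrightarrow> chain_cpx R P \<and>
     (\<exists>n. (\<forall>i<0. n i = 0) \<and> (\<forall>i. cobj P i = free_module R {..<n i})) \<and>
     (\<forall>i>0. trivial_module (homology P i)) \<and>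
     e \<in> module_hom R (cobj P 0) A \<and> e ` carrier (cobj P 0) = carrier A \<and>
     a_kernel (cobj P 0) A e = cdiff P 1 ` carrier (cobj P 1)"

definition chosen_resolution :: "'r ring \<Rightarrow> ('r, 'a) module \<Rightarrow> ('r, nat \<Rightarrow> 'r) cpx" where
  "chosen_resolution R A = (SOME P. \<exists>e. fg_free_resolution R A P e)"

definition Ext :: "'r ring \<Rightarrow> nat \<Rightarrow> ('r, 'a) module \<Rightarrow> ('r, 'b) module \<Rightarrow>
    ('r, ((nat \<Rightarrow> 'r) \<Rightarrow> 'b) set) module" where
  "Ext R i A B = homology (coHom_cpx R (chosen_resolution R A) B) (- int i)"

definition Tor :: "'r ring \<Rightarrow> nat \<Rightarrow> ('r, 'a) module \<Rightarrow> ('r, 'b) module \<Rightarrow>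
    ('r, ((nat \<Rightarrow> 'r) \<times> 'b \<Rightarrow> 'r) set set) module" where
  "Tor R i A B = homology (tensor_cpx R (chosen_resolution R A) B) (int i)"


section \<open>Semidualizing modules and the Bass class\<close>

definition homothety :: "'r ring \<Rightarrow> ('r, 'c) module \<Rightarrow> 'r \<Rightarrow> 'c \<Rightarrow> 'c" where
  "homothety R C r = (\<lambda>c\<in>carrier C. r \<odot>\<^bsub>C\<^esub> c)"

definition semidualizing :: "'r ring \<Rightarrow> ('r, 'c) module \<Rightarrow> bool" where
  "semidualizing R C \<longleftrightarrow> module R C \<and> finitely_generated_module R C \<and>
     homothety R C \<in> module_iso R (regular_module R) (Hom_module R C C) \<and>
     (\<forall>i>0. trivial_module (Ext R i C C))"

text \<open>The evaluation map \<open>C \<otimes>\<^sub>R Hom\<^sub>R(C, M) \<rightarrow> M\<close>, \<open>c \<otimes> f \<mapsto> f(c)\<close>.\<close>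

definition evaluation_map ::
    "'r ring \<Rightarrow> ('r, 'm) module \<Rightarrow> ('c \<times> ('c \<Rightarrow> 'm) \<Rightarrow> 'r) set \<Rightarrow> 'm" where
  "evaluation_map R M = tensor_lift R M (\<lambda>c f. f c)"

definition Bass_class :: "'r ring \<Rightarrow> ('r, 'c) module \<Rightarrow> ('r, 'm) module set" where
  "Bass_class R C = {M. module R M \<and>
     evaluation_map R M \<in> module_iso R (tensor_product R C (Hom_module R C M)) M \<and>
     (\<forall>i>0. trivial_module (Ext R i C M) \<and> trivial_module (Tor R i C (Hom_module R C M)))}"


section \<open>Quasi-injective dimensions\<close>

definition injective_cpx :: "'r ring \<Rightarrow> ('r, 'i) cpx \<Rightarrow> bool" where
  "injective_cpx R I \<longleftrightarrow> chain_cpx R I \<and> (\<forall>i. injective_module R (cobj I i))"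

definition quasi_injective_resolution ::
    "'r ring \<Rightarrow> ('r, 'l) module \<Rightarrow> ('r, 'i) cpx \<Rightarrow> bool" where
  "quasi_injective_resolution R L I \<longleftrightarrow> injective_cpx R I \<and> bounded_above_cpx I \<and>
     (\<exists>b. (\<forall>i. ereal (of_int i) \<le> cpx_sup I \<longrightarrow>
             isomorphic_modules R (homology I i) (power_module L (b i))) \<and>
          (\<exists>i. ereal (of_int i) \<le> cpx_sup I \<and> b i \<noteq> 0))"

definition C_quasi_injective_resolution ::
    "'r ring \<Rightarrow> ('r, 'c) module \<Rightarrow> ('r, 'l) module \<Rightarrow> ('r, 'i) cpx \<Rightarrow> bool" where
  "C_quasi_injective_resolution R C L I \<longleftrightarrow> injective_cpx R I \<and> bounded_cpx I \<and>
     \<not> acyclic_cpx (Hom_cpx R C I) \<and>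
     (\<forall>i. trivial_module (homology (Hom_cpx R C I) i) \<or>
       (\<exists>b. isomorphic_modules R (homology (Hom_cpx R C I) i) (power_module L b)))"

text \<open>The type argument \<open>'i\<close> is the universe in which the complexes of injective modules live.\<close>

definition qid :: "'i itself \<Rightarrow> 'r ring \<Rightarrow> ('r, 'l) module \<Rightarrow> ereal" where
  "qid _ R L = (if trivial_module L then - \<infinity> else
     (INF I\<in>{I :: ('r, 'i) cpx. bounded_cpx I \<and> quasi_injective_resolution R L I}.
        cpx_hinf I - cpx_inf I))"

definition C_qid :: "'i itself \<Rightarrow> 'r ring \<Rightarrow> ('r, 'c) module \<Rightarrow> ('r, 'l) module \<Rightarrow> ereal" where
  "C_qid _ R C L = (if trivial_module L then - \<infinity> else
     (INF I\<in>{I :: ('r, 'i) cpx. C_quasi_injective_resolution R C L I}.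
        cpx_hinf (Hom_cpx R C I) - cpx_inf (Hom_cpx R C I)))"

end

(* Choose a resolution of C by finitely generated free modules. Then Hom(C, -) and C (x) -, together
   with Ext(C, -) and Tor(C, -), become the homology of complexes of powers N^n with matrix
   differentials. Membership of M in the Bass class says that N^{n 1} -> N^{n 0} -> M -> 0 is exact
   for N = Hom(C, M), and that the two complexes have no further homology; the same holds for every
   injective module E in place of M, since Hom(-, E) is exact on 0 -> R -> C^{n 0} -> C^{n 1} -> ...,
   which is exact because C is semidualizing.

   If the homology of a bounded complex I of injectives consists of powers of M, dimension shifting
   from the top degree shows that Ext(C, -) vanishes on its cycles and boundaries, so Hom(C, -)
   commutes with homology. Conversely, if the homology of Hom(C, I) consists of powers of
   Hom(C, M), dimension shifting from the bottom degree shows that Tor(C, -) vanishes on its cycles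
   and boundaries, so C (x) - commutes with homology, and C (x) Hom(C, I) = I,
   C (x) Hom(C, M) = M by evaluation. *)

theory Submission
  imports Defs
begin

text \<open>All differentials are matrices over \<open>R\<close>, so vanishing of Ext and Tor can be
  tested on tuples with entries in a subset \<open>K\<close> of an ambient module: cycles,
  boundaries and images need no element type of their own. The long exact sequence of 0 -> ker g ->
  K -> g(K) -> 0 becomes three chases with tuples, one for each term. The shift for Ext goes down
  and the shift for Tor goes up, because Ext of a quotient needs the next higher Ext of the kernel,
  while Tor of a kernel needs the next higher Tor of the quotient. Tensoring does not preserve
  inclusions, which makes the converse the harder half: an element of C (x) N is a tuple in N^{n 0}
  modulo the image of N^{n 1}, and vanishing of Tor_1 is used in the form that a relation between
  tuples of cycles or boundaries can be chosen with entries among the cycles or boundaries. A second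
  obstacle is the element type: injectivity only gives extensions for test modules in one fixed
  type, so the powers of \<open>C\<close> have to be coded in that type before maps out of them can
  be extended.\<close>

section \<open>Submodules and homomorphisms\<close>

lemma cring_of_module: "module R M \<Longrightarrow> cring R"
  by (rule module.axioms)

lemma module_restrict:
  assumes "module R N" "submodule K R N"
  shows "module R (N\<lparr>carrier := K\<rparr>)"
  using submodule.submodule_is_module[OF assms(2,1)] .

lemma submoduleD:
  assumes "module R N" "submodule K R N"
  shows "\<And>x. x \<in> K \<Longrightarrow> x \<in> carrier N"
    and "\<zero>\<^bsub>N\<^esub> \<in> K"
    and "\<And>x y. x \<in> K \<Longrightarrow> y \<in> K \<Longrightarrow> x \<oplus>\<^bsub>N\<^esub> y \<in> K"
    and "\<And>x. x \<in> K \<Longrightarrow> \<ominus>\<^bsub>N\<^esub> x \<in> K"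
    and "\<And>x y. x \<in> K \<Longrightarrow> y \<in> K \<Longrightarrow> x \<ominus>\<^bsub>N\<^esub> y \<in> K"
    and "\<And>r x. r \<in> carrier R \<Longrightarrow> x \<in> K \<Longrightarrow> r \<odot>\<^bsub>N\<^esub> x \<in> K"
proof -
  interpret N: module R N by fact
  note E = N.submoduleE[OF assms(2)]
  show "\<And>x. x \<in> K \<Longrightarrow> x \<in> carrier N" using E(1) by auto
  show "\<zero>\<^bsub>N\<^esub> \<in> K"
    using subgroup.one_closed[OF submodule.axioms(1)[OF assms(2)]] by simp
  show a: "\<And>x y. x \<in> K \<Longrightarrow> y \<in> K \<Longrightarrow> x \<oplus>\<^bsub>N\<^esub> y \<in> K" using E by auto
  show b: "\<And>x. x \<in> K \<Longrightarrow> \<ominus>\<^bsub>N\<^esub> x \<in> K" using E by auto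
  show "\<And>x y. x \<in> K \<Longrightarrow> y \<in> K \<Longrightarrow> x \<ominus>\<^bsub>N\<^esub> y \<in> K" using a b by (simp add: a_minus_def)
  show "\<And>r x. r \<in> carrier R \<Longrightarrow> x \<in> K \<Longrightarrow> r \<odot>\<^bsub>N\<^esub> x \<in> K" using E by auto
qed

text \<open>Closure under negatives comes for free, since the negative of an element is its multiple
  by -1.\<close>

lemma module_submoduleI:
  assumes "module R N" "K \<subseteq> carrier N" "\<zero>\<^bsub>N\<^esub> \<in> K"
    and "\<And>x y. x \<in> K \<Longrightarrow> y \<in> K \<Longrightarrow> x \<oplus>\<^bsub>N\<^esub> y \<in> K"
    and "\<And>r x. r \<in> carrier R \<Longrightarrow> x \<in> K \<Longrightarrow> r \<odot>\<^bsub>N\<^esub> x \<in> K"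
  shows "submodule K R N"
proof -
  interpret N: module R N by fact
  have "\<ominus>\<^bsub>N\<^esub> a \<in> K" if "a \<in> K" for a
  proof -
    have "\<ominus>\<^bsub>N\<^esub> a = (\<ominus>\<^bsub>R\<^esub> \<one>\<^bsub>R\<^esub>) \<odot>\<^bsub>N\<^esub> a"
      using that assms(2) by (subst N.smult_l_minus) auto
    then show ?thesis using assms(5) that by simp
  qed
  then show ?thesis using assms by (intro N.submoduleI) auto
qed

lemma zero_submodule: "module R N \<Longrightarrow> submodule {\<zero>\<^bsub>N\<^esub>} R N"
proof -
  assume "module R N"
  then interpret N: module R N .
  show ?thesis by (rule module_submoduleI) (auto intro: N.module_axioms)
qed

lemma carrier_submodule: "module R N \<Longrightarrow> submodule (carrier N) R N"
  by (rule module.carrier_is_submodule)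

lemma module_eqI:
  assumes "module R N" "x \<in> carrier N" "y \<in> carrier N" "x \<ominus>\<^bsub>N\<^esub> y = \<zero>\<^bsub>N\<^esub>"
  shows "x = y"
proof -
  interpret N: module R N by fact
  have "x = (x \<ominus>\<^bsub>N\<^esub> y) \<oplus>\<^bsub>N\<^esub> y"
    using assms(2,3) by (simp add: a_minus_def N.a_assoc N.l_neg)
  then show ?thesis using assms by simp
qed

lemma module_minus_self:
  assumes "module R N" "x \<in> carrier N"
  shows "x \<ominus>\<^bsub>N\<^esub> x = \<zero>\<^bsub>N\<^esub>"
proof -
  interpret N: module R N by fact
  show ?thesis using assms by (simp add: a_minus_def N.r_neg)
qed

lemma module_homD:
  assumes "f \<in> module_hom R A B"
  shows "\<And>x. x \<in> carrier A \<Longrightarrow> f x \<in> carrier B"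
    and "\<And>x y. x \<in> carrier A \<Longrightarrow> y \<in> carrier A \<Longrightarrow> f (x \<oplus>\<^bsub>A\<^esub> y) = f x \<oplus>\<^bsub>B\<^esub> f y"
    and "\<And>r x. r \<in> carrier R \<Longrightarrow> x \<in> carrier A \<Longrightarrow> f (r \<odot>\<^bsub>A\<^esub> x) = r \<odot>\<^bsub>B\<^esub> f x"
  using assms by (auto simp: module_hom_def)

lemma module_homI:
  assumes "\<And>x. x \<in> carrier A \<Longrightarrow> f x \<in> carrier B"
    and "\<And>x y. x \<in> carrier A \<Longrightarrow> y \<in> carrier A \<Longrightarrow> f (x \<oplus>\<^bsub>A\<^esub> y) = f x \<oplus>\<^bsub>B\<^esub> f y"
    and "\<And>r x. r \<in> carrier R \<Longrightarrow> x \<in> carrier A \<Longrightarrow> f (r \<odot>\<^bsub>A\<^esub> x) = r \<odot>\<^bsub>B\<^esub> f x"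
  shows "f \<in> module_hom R A B"
  using assms by (auto simp: module_hom_def)

lemma module_hom_cong:
  assumes "f \<in> module_hom R A B" "\<And>x. x \<in> carrier A \<Longrightarrow> g x = f x" "module R A"
  shows "g \<in> module_hom R A B"
proof -
  interpret A: module R A by fact
  show ?thesis using assms(1,2) by (auto simp: module_hom_def)
qed

lemma module_hom_zero:
  assumes "module R A" "module R B" "f \<in> module_hom R A B"
  shows "f \<zero>\<^bsub>A\<^esub> = \<zero>\<^bsub>B\<^esub>"
proof -
  interpret A: module R A by fact
  interpret B: module R B by fact
  have "f (\<zero>\<^bsub>R\<^esub> \<odot>\<^bsub>A\<^esub> \<zero>\<^bsub>A\<^esub>) = \<zero>\<^bsub>R\<^esub> \<odot>\<^bsub>B\<^esub> f \<zero>\<^bsub>A\<^esub>"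
    using assms by (intro module_homD(3)) auto
  then show ?thesis using module_homD(1)[OF assms(3), of "\<zero>\<^bsub>A\<^esub>"] by simp
qed

text \<open>Rewrites subtraction in terms of the two operations that \<open>module_hom\<close>
  speaks of, so that homomorphisms can be moved across it.\<close>

lemma minus_as_smult:
  assumes "module R A" "x \<in> carrier A" "y \<in> carrier A"
  shows "x \<ominus>\<^bsub>A\<^esub> y = x \<oplus>\<^bsub>A\<^esub> (\<ominus>\<^bsub>R\<^esub> \<one>\<^bsub>R\<^esub>) \<odot>\<^bsub>A\<^esub> y"
proof -
  interpret A: module R A by fact
  show ?thesis using assms by (subst A.smult_l_minus) (auto simp: a_minus_def)
qed

lemma module_minus_zero:
  assumes "module R A" "x \<in> carrier A"
  shows "x \<ominus>\<^bsub>A\<^esub> \<zero>\<^bsub>A\<^esub> = x"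
proof -
  interpret A: module R A by fact
  show ?thesis using assms by (simp add: minus_as_smult)
qed

lemma module_minus_eq_zero_iff:
  assumes "module R A" "x \<in> carrier A" "y \<in> carrier A"
  shows "x \<ominus>\<^bsub>A\<^esub> y = \<zero>\<^bsub>A\<^esub> \<longleftrightarrow> x = y"
  using module_eqI[OF assms] module_minus_self[OF assms(1,2)] by auto

text \<open>Maps given on cycles have a submodule \<open>K\<close> of a chain module as domain.
  Negatives are defined through the carrier, so subtraction in the restricted record is formally a
  different operation; the statement uses the subtraction of \<open>N\<close>.\<close>

lemma restricted_hom_diff:
  assumes "module R N" "module R L" "submodule K R N" "g \<in> module_hom R (N\<lparr>carrier := K\<rparr>) L"
    and "x \<in> K" "y \<in> K"
  shows "g (x \<ominus>\<^bsub>N\<^esub> y) = g x \<ominus>\<^bsub>L\<^esub> g y"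
proof -
  interpret L: module R L by fact
  interpret N: module R N by fact
  note K = submoduleD[OF assms(1,3)]
  note g = module_homD[OF assms(4), simplified]
  show ?thesis
    using assms(5,6) K g by (simp add: minus_as_smult[OF assms(1)] minus_as_smult[OF assms(2)])
qed

lemma module_hom_diff:
  assumes "module R N" "module R L" "g \<in> module_hom R N L" "x \<in> carrier N" "y \<in> carrier N"
  shows "g (x \<ominus>\<^bsub>N\<^esub> y) = g x \<ominus>\<^bsub>L\<^esub> g y"
  using restricted_hom_diff[OF assms(1,2) carrier_submodule[OF assms(1)]] assms(3-5) by simp

lemma restricted_hom_zero:
  assumes "module R N" "module R L" "submodule K R N" "g \<in> module_hom R (N\<lparr>carrier := K\<rparr>) L"
  shows "g \<zero>\<^bsub>N\<^esub> = \<zero>\<^bsub>L\<^esub>"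
  using module_hom_zero[OF module_restrict[OF assms(1,3)] assms(2,4)] by simp

lemma module_hom_comp:
  assumes "f \<in> module_hom R A B" "g \<in> module_hom R B D"
  shows "(\<lambda>x. g (f x)) \<in> module_hom R A D"
  using module_homD[OF assms(1)] module_homD[OF assms(2)] by (intro module_homI) simp_all

lemma module_hom_restrict:
  assumes "module R N" "submodule K R N" "g \<in> module_hom R N L"
  shows "g \<in> module_hom R (N\<lparr>carrier := K\<rparr>) L"
  using module_homD[OF assms(3)] submoduleD[OF assms(1,2)] by (intro module_homI) auto

lemma kernel_submodule:
  assumes "module R N" "module R L" "submodule K R N" "g \<in> module_hom R (N\<lparr>carrier := K\<rparr>) L"
  shows "submodule {x \<in> K. g x = \<zero>\<^bsub>L\<^esub>} R N"
proof -
  interpret L: module R L by fact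
  note K = submoduleD[OF assms(1,3)]
  note g = module_homD[OF assms(4), simplified]
  show ?thesis
    using K g restricted_hom_zero[OF assms] by (intro module_submoduleI) (auto simp: assms(1))
qed

lemma image_submodule:
  assumes "module R N" "module R L" "submodule K R N" "g \<in> module_hom R (N\<lparr>carrier := K\<rparr>) L"
  shows "submodule (g ` K) R L"
proof -
  interpret L: module R L by fact
  note K = submoduleD[OF assms(1,3)]
  note g = module_homD[OF assms(4), simplified]
  show ?thesis
  proof (rule module_submoduleI)
    show "module R L" by fact
    show "g ` K \<subseteq> carrier L" using g by auto
    show "\<zero>\<^bsub>L\<^esub> \<in> g ` K"
      using restricted_hom_zero[OF assms] K(2) by (metis imageI)
    fix x y assume "x \<in> g ` K" "y \<in> g ` K"
    then show "x \<oplus>\<^bsub>L\<^esub> y \<in> g ` K" using g(2) K(3) by (metis (no_types, lifting) imageE imageI)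
  next
    fix r x assume "r \<in> carrier R" "x \<in> g ` K"
    then show "r \<odot>\<^bsub>L\<^esub> x \<in> g ` K" using g(3) K(6) by (metis (no_types, lifting) imageE imageI)
  qed
qed

lemma submodule_span_minimal:
  "submodule N R M \<Longrightarrow> S \<subseteq> N \<Longrightarrow> submodule_span R M S \<subseteq> N"
  by (auto simp: submodule_span_def)

lemma submodule_span_superset: "S \<subseteq> submodule_span R M S"
  by (auto simp: submodule_span_def)

lemma submodule_submodule_span:
  assumes "module R M" "S \<subseteq> carrier M"
  shows "submodule (submodule_span R M S) R M"
proof -
  interpret M: module R M by fact
  have c: "submodule (carrier M) R M" by (rule carrier_submodule) fact
  show ?thesis
  proof (rule module_submoduleI)
    show "module R M" by fact
    show "submodule_span R M S \<subseteq> carrier M" by (rule submodule_span_minimal) (fact c assms)+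
  qed (auto simp: submodule_span_def intro: submoduleD[OF assms(1)])
qed

section \<open>Transport of structure and quotient modules\<close>

text \<open>A map that is onto and respects all operations forces the module axioms on its target,
  which need not be known to be a module beforehand. This serves quotients as well as copies of a
  module in another type.\<close>

lemma module_transport:
  assumes "module R N" "q ` carrier N = carrier Q"
    and add: "\<And>x y. x \<in> carrier N \<Longrightarrow> y \<in> carrier N \<Longrightarrow> q (x \<oplus>\<^bsub>N\<^esub> y) = q x \<oplus>\<^bsub>Q\<^esub> q y"
    and smult: "\<And>r x. r \<in> carrier R \<Longrightarrow> x \<in> carrier N \<Longrightarrow> q (r \<odot>\<^bsub>N\<^esub> x) = r \<odot>\<^bsub>Q\<^esub> q x"
    and zero: "q \<zero>\<^bsub>N\<^esub> = \<zero>\<^bsub>Q\<^esub>"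
  shows "module R Q"
proof -
  interpret N: module R N by fact
  have rep: "\<exists>x\<in>carrier N. u = q x" if "u \<in> carrier Q" for u using that assms(2) by auto
  have cl: "q x \<in> carrier Q" if "x \<in> carrier N" for x using that assms(2) by auto
  show ?thesis
  proof (rule moduleI)
    show "cring R" by (rule N.R.cring_axioms)
    show "abelian_group Q"
    proof (rule abelian_groupI)
      fix x y z assume "x \<in> carrier Q" "y \<in> carrier Q" "z \<in> carrier Q"
      then obtain a b c where "a \<in> carrier N" "b \<in> carrier N" "c \<in> carrier N"
        "x = q a" "y = q b" "z = q c" using rep by meson
      then show "(x \<oplus>\<^bsub>Q\<^esub> y) \<oplus>\<^bsub>Q\<^esub> z = x \<oplus>\<^bsub>Q\<^esub> (y \<oplus>\<^bsub>Q\<^esub> z)"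
        by (simp add: add[symmetric] N.a_assoc)
    next
      fix x y assume "x \<in> carrier Q" "y \<in> carrier Q"
      then obtain a b where "a \<in> carrier N" "b \<in> carrier N" "x = q a" "y = q b" using rep by meson
      then show "x \<oplus>\<^bsub>Q\<^esub> y = y \<oplus>\<^bsub>Q\<^esub> x" "x \<oplus>\<^bsub>Q\<^esub> y \<in> carrier Q"
        by (auto simp: add[symmetric] N.a_comm cl)
    next
      fix x assume "x \<in> carrier Q"
      then obtain a where a: "a \<in> carrier N" "x = q a" using rep by meson
      then show "\<zero>\<^bsub>Q\<^esub> \<oplus>\<^bsub>Q\<^esub> x = x" using zero add[of "\<zero>\<^bsub>N\<^esub>" a] by simp
      have "q (\<ominus>\<^bsub>N\<^esub> a) \<oplus>\<^bsub>Q\<^esub> x = \<zero>\<^bsub>Q\<^esub>"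
        using a by (simp add: add[symmetric] N.l_neg zero)
      then show "\<exists>y\<in>carrier Q. y \<oplus>\<^bsub>Q\<^esub> x = \<zero>\<^bsub>Q\<^esub>" using a cl by blast
    next
      show "\<zero>\<^bsub>Q\<^esub> \<in> carrier Q" using zero cl by (metis N.M.zero_closed)
    qed
  next
    fix a x assume "a \<in> carrier R" "x \<in> carrier Q"
    moreover from this obtain x' where "x' \<in> carrier N" "x = q x'" using rep by meson
    ultimately show "a \<odot>\<^bsub>Q\<^esub> x \<in> carrier Q" by (simp add: smult[symmetric] cl)
  next
    fix a b x assume "a \<in> carrier R" "b \<in> carrier R" "x \<in> carrier Q"
    moreover from this obtain x' where "x' \<in> carrier N" "x = q x'" using rep by meson
    ultimately show "(a \<oplus>\<^bsub>R\<^esub> b) \<odot>\<^bsub>Q\<^esub> x = a \<odot>\<^bsub>Q\<^esub> x \<oplus>\<^bsub>Q\<^esub> b \<odot>\<^bsub>Q\<^esub> x"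
      "(a \<otimes>\<^bsub>R\<^esub> b) \<odot>\<^bsub>Q\<^esub> x = a \<odot>\<^bsub>Q\<^esub> (b \<odot>\<^bsub>Q\<^esub> x)"
      by (simp_all add: smult[symmetric] add[symmetric] N.smult_l_distr N.smult_assoc1)
  next
    fix a x y assume "a \<in> carrier R" "x \<in> carrier Q" "y \<in> carrier Q"
    moreover from this obtain x' y' where "x' \<in> carrier N" "x = q x'" "y' \<in> carrier N" "y = q y'"
      using rep by meson
    ultimately show "a \<odot>\<^bsub>Q\<^esub> (x \<oplus>\<^bsub>Q\<^esub> y) = a \<odot>\<^bsub>Q\<^esub> x \<oplus>\<^bsub>Q\<^esub> a \<odot>\<^bsub>Q\<^esub> y"
      by (simp add: smult[symmetric] add[symmetric] N.smult_r_distr)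
  next
    fix x assume "x \<in> carrier Q"
    moreover from this obtain x' where "x' \<in> carrier N" "x = q x'" using rep by meson
    ultimately show "\<one>\<^bsub>R\<^esub> \<odot>\<^bsub>Q\<^esub> x = x" by (simp add: smult[symmetric])
  qed
qed

text \<open>The definition of \<open>quotient_module\<close> takes a union over all representatives.
  It is a single coset, because r(b + x) = rb + rx with rb in \<open>B\<close>.\<close>

lemma coset_smult:
  assumes "module R N" "submodule B R N" "x \<in> carrier N" "r \<in> carrier R"
  shows "(\<Union>u\<in>B +>\<^bsub>N\<^esub> x. B +>\<^bsub>N\<^esub> (r \<odot>\<^bsub>N\<^esub> u)) = B +>\<^bsub>N\<^esub> (r \<odot>\<^bsub>N\<^esub> x)"
proof -
  interpret N: module R N by fact
  note B = submoduleD[OF assms(1,2)]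
  interpret B: abelian_subgroup B N
    by (rule abelian_subgroupI3)
      (auto intro: additive_subgroupI submodule.axioms(1)[OF assms(2)] N.abelian_group_axioms)
  have eq: "B +>\<^bsub>N\<^esub> (r \<odot>\<^bsub>N\<^esub> u) = B +>\<^bsub>N\<^esub> (r \<odot>\<^bsub>N\<^esub> x)" if u: "u \<in> B +>\<^bsub>N\<^esub> x" for u
  proof -
    from u obtain b where b: "b \<in> B" "u = b \<oplus>\<^bsub>N\<^esub> x" by (auto simp: a_r_coset_def')
    have "r \<odot>\<^bsub>N\<^esub> u \<in> B +>\<^bsub>N\<^esub> (r \<odot>\<^bsub>N\<^esub> x)"
      unfolding a_r_coset_def' using b B(6)[OF assms(4) b(1)] assms B(1)
      by (auto simp: N.smult_r_distr)
    then show ?thesis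
      using assms by (intro B.a_repr_independence'[symmetric]) (auto intro: N.smult_closed)
  qed
  moreover have "x \<in> B +>\<^bsub>N\<^esub> x" using assms by (intro B.a_rcos_self)
  ultimately show ?thesis by blast
qed

lemma coset_eq_iff:
  assumes "module R N" "submodule B R N" "x \<in> carrier N" "y \<in> carrier N"
  shows "B +>\<^bsub>N\<^esub> x = B +>\<^bsub>N\<^esub> y \<longleftrightarrow> x \<ominus>\<^bsub>N\<^esub> y \<in> B"
proof -
  interpret N: module R N by fact
  note B = submoduleD[OF assms(1,2)]
  interpret B: abelian_subgroup B N
    by (rule abelian_subgroupI3)
      (auto intro: additive_subgroupI submodule.axioms(1)[OF assms(2)] N.abelian_group_axioms)
  have xy: "x = (x \<ominus>\<^bsub>N\<^esub> y) \<oplus>\<^bsub>N\<^esub> y"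
    using assms by (simp add: a_minus_def N.a_assoc N.l_neg)
  show ?thesis
  proof
    assume "B +>\<^bsub>N\<^esub> x = B +>\<^bsub>N\<^esub> y"
    then have "x \<in> B +>\<^bsub>N\<^esub> y" using B.a_rcos_self[OF assms(3)] by simp
    then obtain b where "b \<in> B" "x = b \<oplus>\<^bsub>N\<^esub> y" by (auto simp: a_r_coset_def')
    then show "x \<ominus>\<^bsub>N\<^esub> y \<in> B"
      using assms B(1) by (simp add: a_minus_def N.a_assoc N.r_neg)
  next
    assume "x \<ominus>\<^bsub>N\<^esub> y \<in> B"
    then have "x \<in> B +>\<^bsub>N\<^esub> y" using xy by (auto simp: a_r_coset_def')
    then show "B +>\<^bsub>N\<^esub> x = B +>\<^bsub>N\<^esub> y"
      using assms by (intro B.a_repr_independence'[symmetric])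
  qed
qed

lemma quotient_module_coset:
  assumes "module R N" "submodule B R N"
  shows "(\<lambda>x. B +>\<^bsub>N\<^esub> x) ` carrier N = carrier (quotient_module N B)"
    and "\<And>x y. x \<in> carrier N \<Longrightarrow> y \<in> carrier N \<Longrightarrow>
      B +>\<^bsub>N\<^esub> (x \<oplus>\<^bsub>N\<^esub> y) = (B +>\<^bsub>N\<^esub> x) \<oplus>\<^bsub>quotient_module N B\<^esub> (B +>\<^bsub>N\<^esub> y)"
    and "\<And>r x. r \<in> carrier R \<Longrightarrow> x \<in> carrier N \<Longrightarrow>
      B +>\<^bsub>N\<^esub> (r \<odot>\<^bsub>N\<^esub> x) = r \<odot>\<^bsub>quotient_module N B\<^esub> (B +>\<^bsub>N\<^esub> x)"
    and "B +>\<^bsub>N\<^esub> \<zero>\<^bsub>N\<^esub> = \<zero>\<^bsub>quotient_module N B\<^esub>"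
proof -
  interpret N: module R N by fact
  note B = submoduleD[OF assms(1,2)]
  interpret B: abelian_subgroup B N
    by (rule abelian_subgroupI3)
      (auto intro: additive_subgroupI submodule.axioms(1)[OF assms(2)] N.abelian_group_axioms)
  show "(\<lambda>x. B +>\<^bsub>N\<^esub> x) ` carrier N = carrier (quotient_module N B)"
    by (auto simp: quotient_module_def A_RCOSETS_def')
  show "\<And>x y. x \<in> carrier N \<Longrightarrow> y \<in> carrier N \<Longrightarrow>
      B +>\<^bsub>N\<^esub> (x \<oplus>\<^bsub>N\<^esub> y) = (B +>\<^bsub>N\<^esub> x) \<oplus>\<^bsub>quotient_module N B\<^esub> (B +>\<^bsub>N\<^esub> y)"
    by (simp add: quotient_module_def B.a_rcos_sum)
  show "\<And>r x. r \<in> carrier R \<Longrightarrow> x \<in> carrier N \<Longrightarrow>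
      B +>\<^bsub>N\<^esub> (r \<odot>\<^bsub>N\<^esub> x) = r \<odot>\<^bsub>quotient_module N B\<^esub> (B +>\<^bsub>N\<^esub> x)"
    by (simp add: quotient_module_def coset_smult[OF assms])
  show "B +>\<^bsub>N\<^esub> \<zero>\<^bsub>N\<^esub> = \<zero>\<^bsub>quotient_module N B\<^esub>"
    using B(1) by (auto simp: quotient_module_def a_r_coset_def')
qed

lemma module_quotient:
  assumes "module R N" "submodule B R N"
  shows "module R (quotient_module N B)"
  by (rule module_transport[OF assms(1) quotient_module_coset[OF assms]])

lemma coset_hom:
  assumes "module R N" "submodule B R N"
  shows "(\<lambda>x. B +>\<^bsub>N\<^esub> x) \<in> module_hom R N (quotient_module N B)"
  using quotient_module_coset[OF assms] by (intro module_homI) auto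

lemma coset_zero_iff:
  assumes "module R N" "submodule B R N" "x \<in> carrier N"
  shows "B +>\<^bsub>N\<^esub> x = \<zero>\<^bsub>quotient_module N B\<^esub> \<longleftrightarrow> x \<in> B"
proof -
  interpret N: module R N by fact
  show ?thesis
    using coset_eq_iff[OF assms(1,2,3), of "\<zero>\<^bsub>N\<^esub>"] quotient_module_coset(4)[OF assms(1,2)] assms
    by (simp add: module_minus_zero)
qed

text \<open>The first isomorphism theorem, used to get rid of quotients: what has to be produced or
  taken apart later is a map on representatives that is onto \<open>L\<close> and has kernel
  \<open>B\<close>.\<close>

lemma isomorphic_quotient_iff:
  assumes "module R N" "submodule B R N" "module R L"
  shows "isomorphic_modules R (quotient_module N B) L \<longleftrightarrow>
    (\<exists>\<pi>\<in>module_hom R N L. \<pi> ` carrier N = carrier L \<and> {x \<in> carrier N. \<pi> x = \<zero>\<^bsub>L\<^esub>} = B)"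
    (is "?iso \<longleftrightarrow> ?ex")
proof
  let ?Q = "quotient_module N B" and ?q = "\<lambda>x. B +>\<^bsub>N\<^esub> x"
  interpret N: module R N by fact
  interpret L: module R L by fact
  note Q = module_quotient[OF assms(1,2)]
  note q = quotient_module_coset[OF assms(1,2)]
  {
    assume ?iso
    then obtain \<phi> where \<phi>: "\<phi> \<in> module_hom R ?Q L" "bij_betw \<phi> (carrier ?Q) (carrier L)"
      by (auto simp: isomorphic_modules_def module_iso_def)
    have "(\<lambda>x. \<phi> (?q x)) \<in> module_hom R N L"
      by (rule module_hom_comp[OF coset_hom[OF assms(1,2)] \<phi>(1)])
    moreover have "(\<lambda>x. \<phi> (?q x)) ` carrier N = carrier L"
      using \<phi>(2) q(1) by (simp add: bij_betw_def flip: image_image)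
    moreover have "\<phi> (?q x) = \<zero>\<^bsub>L\<^esub> \<longleftrightarrow> x \<in> B" if x: "x \<in> carrier N" for x
    proof -
      have "\<phi> (?q x) = \<zero>\<^bsub>L\<^esub> \<longleftrightarrow> \<phi> (?q x) = \<phi> \<zero>\<^bsub>?Q\<^esub>"
        by (simp add: module_hom_zero[OF Q assms(3) \<phi>(1)])
      also have "\<dots> \<longleftrightarrow> ?q x = \<zero>\<^bsub>?Q\<^esub>"
        using \<phi>(2) q(1) x abelian_groupE(2)[OF module.axioms(2)[OF Q]]
        unfolding bij_betw_def by (intro inj_on_eq_iff) auto
      finally show ?thesis using coset_zero_iff[OF assms(1,2) x] by simp
    qed
    ultimately show ?ex
      using submoduleD(1)[OF assms(1,2)] by (intro bexI[of _ "\<lambda>x. \<phi> (?q x)"]) auto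
  }
  assume ?ex
  then obtain \<pi> where \<pi>: "\<pi> \<in> module_hom R N L" "\<pi> ` carrier N = carrier L"
    "{x \<in> carrier N. \<pi> x = \<zero>\<^bsub>L\<^esub>} = B" by blast
  define \<phi> where "\<phi> U = \<pi> (SOME x. x \<in> carrier N \<and> ?q x = U)" for U
  have eq: "\<pi> x = \<pi> y \<longleftrightarrow> ?q x = ?q y" if "x \<in> carrier N" "y \<in> carrier N" for x y
  proof -
    have "\<pi> x = \<pi> y \<longleftrightarrow> \<pi> x \<ominus>\<^bsub>L\<^esub> \<pi> y = \<zero>\<^bsub>L\<^esub>"
      using that module_homD(1)[OF \<pi>(1)] by (simp add: module_minus_eq_zero_iff[OF assms(3)])
    also have "\<dots> \<longleftrightarrow> x \<ominus>\<^bsub>N\<^esub> y \<in> B"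
      using that \<pi>(3) module_hom_diff[OF assms(1,3) \<pi>(1)] by auto
    finally show ?thesis using coset_eq_iff[OF assms(1,2) that] by simp
  qed
  have \<phi>: "\<phi> (?q x) = \<pi> x" if "x \<in> carrier N" for x
  proof -
    have "(SOME y. y \<in> carrier N \<and> ?q y = ?q x) \<in> carrier N \<and>
      ?q (SOME y. y \<in> carrier N \<and> ?q y = ?q x) = ?q x"
      by (rule someI[of _ x]) (simp add: that)
    then show ?thesis using eq[OF _ that] by (auto simp: \<phi>_def)
  qed
  have rep: "\<exists>x\<in>carrier N. U = ?q x" if "U \<in> carrier ?Q" for U using that q(1) by auto
  have "\<phi> \<in> module_hom R ?Q L"
  proof (rule module_homI)
    fix U assume "U \<in> carrier ?Q"
    then obtain x where "x \<in> carrier N" "U = ?q x" using rep by meson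
    then show "\<phi> U \<in> carrier L" using \<phi> module_homD(1)[OF \<pi>(1)] by simp
  next
    fix U V assume "U \<in> carrier ?Q" "V \<in> carrier ?Q"
    then obtain x y where "x \<in> carrier N" "U = ?q x" "y \<in> carrier N" "V = ?q y" using rep by meson
    then show "\<phi> (U \<oplus>\<^bsub>?Q\<^esub> V) = \<phi> U \<oplus>\<^bsub>L\<^esub> \<phi> V"
      using \<phi> module_homD(2)[OF \<pi>(1)] by (simp flip: q(2))
  next
    fix r U assume "r \<in> carrier R" "U \<in> carrier ?Q"
    moreover from this obtain x where "x \<in> carrier N" "U = ?q x" using rep by meson
    ultimately show "\<phi> (r \<odot>\<^bsub>?Q\<^esub> U) = r \<odot>\<^bsub>L\<^esub> \<phi> U"
      using \<phi> module_homD(3)[OF \<pi>(1)] by (simp flip: q(3))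
  qed
  moreover have "bij_betw \<phi> (carrier ?Q) (carrier L)"
    unfolding bij_betw_def
  proof
    show "inj_on \<phi> (carrier ?Q)"
      using eq \<phi> by (auto simp: inj_on_def simp flip: q(1))
    show "\<phi> ` carrier ?Q = carrier L"
      using \<phi> \<pi>(2) by (auto simp: image_image simp flip: q(1))
  qed
  ultimately show ?iso by (auto simp: isomorphic_modules_def module_iso_def)
qed

lemma trivial_quotient_iff:
  assumes "module R N" "submodule B R N"
  shows "trivial_module (quotient_module N B) \<longleftrightarrow> B = carrier N"
proof -
  interpret N: module R N by fact
  note B = submoduleD[OF assms]
  have "trivial_module (quotient_module N B) \<longleftrightarrow>
      (\<forall>x\<in>carrier N. B +>\<^bsub>N\<^esub> x = \<zero>\<^bsub>quotient_module N B\<^esub>)"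
    unfolding trivial_module_def quotient_module_coset(1)[OF assms, symmetric]
    using quotient_module_coset(4)[OF assms] by auto
  also have "\<dots> \<longleftrightarrow> B = carrier N"
    using coset_zero_iff[OF assms] B(1) by auto
  finally show ?thesis .
qed

declare funcset_mem [dest]

section \<open>Regular modules, powers, Hom modules and free modules\<close>

text \<open>Powers, Hom modules and free modules all consist of functions with pointwise operations
  into a module, so the axioms hold pointwise and only closure is left to check. Negatives are
  obtained as multiples by -1.\<close>

lemma module_pointwise:
  assumes L: "module R L"
    and sub: "carrier Q \<subseteq> D \<rightarrow>\<^sub>E carrier L"
    and zero: "\<zero>\<^bsub>Q\<^esub> = (\<lambda>k\<in>D. \<zero>\<^bsub>L\<^esub>)" "\<zero>\<^bsub>Q\<^esub> \<in> carrier Q"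
    and add: "\<And>x y. x \<in> carrier Q \<Longrightarrow> y \<in> carrier Q \<Longrightarrow> x \<oplus>\<^bsub>Q\<^esub> y = (\<lambda>k\<in>D. x k \<oplus>\<^bsub>L\<^esub> y k)"
      "\<And>x y. x \<in> carrier Q \<Longrightarrow> y \<in> carrier Q \<Longrightarrow> x \<oplus>\<^bsub>Q\<^esub> y \<in> carrier Q"
    and smult: "\<And>r x. r \<in> carrier R \<Longrightarrow> x \<in> carrier Q \<Longrightarrow> r \<odot>\<^bsub>Q\<^esub> x = (\<lambda>k\<in>D. r \<odot>\<^bsub>L\<^esub> x k)"
      "\<And>r x. r \<in> carrier R \<Longrightarrow> x \<in> carrier Q \<Longrightarrow> r \<odot>\<^bsub>Q\<^esub> x \<in> carrier Q"
  shows "module R Q"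
proof -
  interpret L: module R L by fact
  have val: "x k \<in> carrier L" if "x \<in> carrier Q" "k \<in> D" for x k using that sub by auto
  have addk: "(x \<oplus>\<^bsub>Q\<^esub> y) k = x k \<oplus>\<^bsub>L\<^esub> y k" if "x \<in> carrier Q" "y \<in> carrier Q" "k \<in> D" for x y k
    using that by (simp add: add(1))
  have smultk: "(r \<odot>\<^bsub>Q\<^esub> x) k = r \<odot>\<^bsub>L\<^esub> x k" if "x \<in> carrier Q" "r \<in> carrier R" "k \<in> D" for x r k
    using that by (simp add: smult(1))
  have zerok: "\<zero>\<^bsub>Q\<^esub> k = \<zero>\<^bsub>L\<^esub>" if "k \<in> D" for k
    using that by (simp add: zero(1))
  have eqI: "x = y" if "x \<in> carrier Q" "y \<in> carrier Q" "\<And>k. k \<in> D \<Longrightarrow> x k = y k" for x y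
    using that sub by (intro PiE_ext[of x D "\<lambda>_. carrier L" y]) auto
  show ?thesis
  proof (rule moduleI)
    show "cring R" by (rule L.R.cring_axioms)
    show "abelian_group Q"
    proof (rule abelian_groupI)
      fix x assume x: "x \<in> carrier Q"
      let ?y = "(\<ominus>\<^bsub>R\<^esub> \<one>\<^bsub>R\<^esub>) \<odot>\<^bsub>Q\<^esub> x"
      have y: "?y \<in> carrier Q" by (rule smult(2)) (auto simp: x)
      have "?y \<oplus>\<^bsub>Q\<^esub> x = \<zero>\<^bsub>Q\<^esub>"
      proof (rule eqI)
        fix k assume k: "k \<in> D"
        show "(?y \<oplus>\<^bsub>Q\<^esub> x) k = \<zero>\<^bsub>Q\<^esub> k"
          using k x y val[OF x k] by (simp add: zero(1) add(1) smult(1) L.smult_l_minus L.l_neg)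
      qed (auto simp: x y add(2) zero(2))
      then show "\<exists>y\<in>carrier Q. y \<oplus>\<^bsub>Q\<^esub> x = \<zero>\<^bsub>Q\<^esub>" using y by blast
    qed (auto simp: zero(2) add(2) val addk zerok L.a_ac intro!: eqI)
  qed (auto simp: smult(2) add(2) val addk smultk L.smult_l_distr L.smult_r_distr L.smult_assoc1
       intro!: eqI)
qed

lemma module_regular:
  assumes "cring R"
  shows "module R (regular_module R)"
proof -
  interpret R: cring R by fact
  show ?thesis
  proof (rule moduleI)
    show "abelian_group (regular_module R)"
      by (rule abelian_groupI)
        (auto simp: regular_module_def R.a_ac intro: bexI[of _ "\<ominus>\<^bsub>R\<^esub> x" for x] R.l_neg)
  qed (auto simp: regular_module_def R.l_distr R.r_distr R.m_assoc assms)
qed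

lemma power_module_simps:
  "carrier (power_module L n) = {..<n} \<rightarrow>\<^sub>E carrier L"
  "\<zero>\<^bsub>power_module L n\<^esub> = (\<lambda>k\<in>{..<n}. \<zero>\<^bsub>L\<^esub>)"
  "x \<oplus>\<^bsub>power_module L n\<^esub> y = (\<lambda>k\<in>{..<n}. x k \<oplus>\<^bsub>L\<^esub> y k)"
  "r \<odot>\<^bsub>power_module L n\<^esub> x = (\<lambda>k\<in>{..<n}. r \<odot>\<^bsub>L\<^esub> x k)"
  by (auto simp: power_module_def)

lemma module_power:
  assumes "module R L"
  shows "module R (power_module L n)"
proof -
  interpret L: module R L by fact
  show ?thesis
    by (rule module_pointwise[OF assms, where D = "{..<n}"])
      (auto simp: power_module_simps)
qed

lemma Hom_module_simps:
  "carrier (Hom_module R A B) = module_hom R A B \<inter> extensional (carrier A)"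
  "\<zero>\<^bsub>Hom_module R A B\<^esub> = (\<lambda>x\<in>carrier A. \<zero>\<^bsub>B\<^esub>)"
  "f \<oplus>\<^bsub>Hom_module R A B\<^esub> g = (\<lambda>x\<in>carrier A. f x \<oplus>\<^bsub>B\<^esub> g x)"
  "r \<odot>\<^bsub>Hom_module R A B\<^esub> f = (\<lambda>x\<in>carrier A. r \<odot>\<^bsub>B\<^esub> f x)"
  by (auto simp: Hom_module_def)

text \<open>The commutativity of \<open>R\<close> enters here; it makes a scalar multiple of a
  homomorphism linear again.\<close>

lemma smult_left_commute:
  assumes "module R B" "r \<in> carrier R" "s \<in> carrier R" "x \<in> carrier B"
  shows "r \<odot>\<^bsub>B\<^esub> (s \<odot>\<^bsub>B\<^esub> x) = s \<odot>\<^bsub>B\<^esub> (r \<odot>\<^bsub>B\<^esub> x)"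
proof -
  interpret B: module R B by fact
  show ?thesis using assms by (simp add: B.smult_assoc1[symmetric] B.R.m_comm)
qed

lemma module_Hom:
  assumes "module R A" "module R B"
  shows "module R (Hom_module R A B)"
proof -
  interpret A: module R A by fact
  interpret B: module R B by fact
  note D = module_homD[where R=R and A=A and B=B]
  show ?thesis
    apply (rule module_pointwise[OF assms(2), where D = "carrier A"])
    subgoal by (auto simp: Hom_module_simps PiE_def module_hom_def)
    subgoal by (simp add: Hom_module_simps)
    subgoal by (auto simp: Hom_module_simps intro!: module_homI)
    subgoal by (auto simp: Hom_module_simps)
    subgoal premises xy for x y
    proof -
      have x: "x \<in> module_hom R A B" and y: "y \<in> module_hom R A B"
        using xy by (auto simp: Hom_module_simps)
      note E = D(1)[OF x] D(1)[OF y]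
      have "(\<lambda>a\<in>carrier A. x a \<oplus>\<^bsub>B\<^esub> y a) \<in> module_hom R A B"
        by (rule module_homI)
          (simp_all add: E D(2,3)[OF x] D(2,3)[OF y] B.smult_r_distr B.a_ac)
      then show ?thesis by (simp add: Hom_module_simps)
    qed
    subgoal by (auto simp: Hom_module_simps)
    subgoal premises rx for r x
    proof -
      have x: "x \<in> module_hom R A B" and r: "r \<in> carrier R"
        using rx by (auto simp: Hom_module_simps)
      have "(\<lambda>a\<in>carrier A. r \<odot>\<^bsub>B\<^esub> x a) \<in> module_hom R A B"
        by (rule module_homI)
          (simp_all add: r D(1)[OF x] D(2,3)[OF x] B.smult_r_distr smult_left_commute[OF assms(2) r])
      then show ?thesis by (simp add: Hom_module_simps)
    qed
    done
qed

lemma Hom_moduleI: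
  assumes "f \<in> module_hom R A B" "module R A"
  shows "restrict f (carrier A) \<in> carrier (Hom_module R A B)"
  using module_hom_cong[OF assms(1) _ assms(2)] by (auto simp: Hom_module_simps)

lemma Hom_moduleD:
  assumes "f \<in> carrier (Hom_module R A B)"
  shows "f \<in> module_hom R A B" "\<And>x. x \<in> carrier A \<Longrightarrow> f x \<in> carrier B"
  using assms by (auto simp: Hom_module_simps module_hom_def)

lemma Hom_module_eqI:
  assumes "f \<in> carrier (Hom_module R A B)" "g \<in> carrier (Hom_module R A B)"
    and "\<And>x. x \<in> carrier A \<Longrightarrow> f x = g x"
  shows "f = g"
  using assms by (auto simp: Hom_module_simps intro: extensionalityI)

lemma free_module_simps:
  "carrier (free_module R X) = {u. range u \<subseteq> carrier R \<and> finite {x. u x \<noteq> \<zero>\<^bsub>R\<^esub>} \<and>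
       {x. u x \<noteq> \<zero>\<^bsub>R\<^esub>} \<subseteq> X}"
  "\<zero>\<^bsub>free_module R X\<^esub> = (\<lambda>x. \<zero>\<^bsub>R\<^esub>)"
  "u \<oplus>\<^bsub>free_module R X\<^esub> v = (\<lambda>x. u x \<oplus>\<^bsub>R\<^esub> v x)"
  "r \<odot>\<^bsub>free_module R X\<^esub> u = (\<lambda>x. r \<otimes>\<^bsub>R\<^esub> u x)"
  by (auto simp: free_module_def)

lemma free_moduleD:
  assumes "u \<in> carrier (free_module R X)"
  shows "\<And>x. u x \<in> carrier R" "finite {x. u x \<noteq> \<zero>\<^bsub>R\<^esub>}" "\<And>x. x \<notin> X \<Longrightarrow> u x = \<zero>\<^bsub>R\<^esub>"
  using assms by (auto simp: free_module_simps)

lemma free_moduleI: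
  assumes "\<And>x. u x \<in> carrier R" "finite {x. u x \<noteq> \<zero>\<^bsub>R\<^esub>}" "\<And>x. x \<notin> X \<Longrightarrow> u x = \<zero>\<^bsub>R\<^esub>"
  shows "u \<in> carrier (free_module R X)"
  using assms by (auto simp: free_module_simps)

lemma module_free:
  assumes "cring R"
  shows "module R (free_module R X)"
proof -
  interpret R: cring R by fact
  note D = free_moduleD[where R=R and X=X]
  show ?thesis
  proof (rule module_pointwise[OF module_regular[OF assms], where D = UNIV])
    fix x y assume xy: "x \<in> carrier (free_module R X)" "y \<in> carrier (free_module R X)"
    have "finite {i. x i \<oplus>\<^bsub>R\<^esub> y i \<noteq> \<zero>\<^bsub>R\<^esub>}"
      by (rule finite_subset[OF _ finite_UnI[OF D(2)[OF xy(1)] D(2)[OF xy(2)]]]) auto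
    then show "x \<oplus>\<^bsub>free_module R X\<^esub> y \<in> carrier (free_module R X)"
      using D(1)[OF xy(1)] D(1)[OF xy(2)] D(3)[OF xy(1)] D(3)[OF xy(2)]
      unfolding free_module_simps(3) by (intro free_moduleI) simp_all
  next
    fix r x assume rx: "r \<in> carrier R" "x \<in> carrier (free_module R X)"
    have "finite {i. r \<otimes>\<^bsub>R\<^esub> x i \<noteq> \<zero>\<^bsub>R\<^esub>}"
      by (rule finite_subset[OF _ D(2)[OF rx(2)]]) (auto simp: rx)
    then show "r \<odot>\<^bsub>free_module R X\<^esub> x \<in> carrier (free_module R X)"
      using D(1)[OF rx(2)] D(3)[OF rx(2)] rx(1)
      unfolding free_module_simps(4) by (intro free_moduleI) simp_all
  qed (auto simp: free_module_simps(2-) regular_module_def D intro: free_moduleI)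
qed

lemma basis_vec_closed:
  assumes "cring R" "x \<in> X"
  shows "basis_vec R x \<in> carrier (free_module R X)"
proof -
  interpret R: cring R by fact
  have "finite {y. basis_vec R x y \<noteq> \<zero>\<^bsub>R\<^esub>}"
    by (rule finite_subset[of _ "{x}"]) (auto simp: basis_vec_def)
  then show ?thesis using assms(2) by (intro free_moduleI) (auto simp: basis_vec_def)
qed

subsection \<open>Finite sums\<close>

lemma finsum_submodule:
  assumes "module R N" "submodule K R N" "x \<in> S \<rightarrow> K"
  shows "(\<Oplus>\<^bsub>N\<^esub>i\<in>S. x i) \<in> K"
proof -
  interpret N: module R N by fact
  note K = submoduleD[OF assms(1,2)]
  show ?thesis using assms(3)
  proof (induction S rule: infinite_finite_induct)
    case (insert i S)
    have "(\<Oplus>\<^bsub>N\<^esub>i\<in>insert i S. x i) = x i \<oplus>\<^bsub>N\<^esub> (\<Oplus>\<^bsub>N\<^esub>i\<in>S. x i)"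
      using insert K(1) by (intro N.finsum_insert) auto
    then show ?case using insert K(3) by auto
  qed (auto simp: K(2))
qed

lemma finsum_restricted_hom:
  assumes "module R N" "module R L" "submodule K R N" "g \<in> module_hom R (N\<lparr>carrier := K\<rparr>) L"
    and "x \<in> S \<rightarrow> K"
  shows "g (\<Oplus>\<^bsub>N\<^esub>i\<in>S. x i) = (\<Oplus>\<^bsub>L\<^esub>i\<in>S. g (x i))"
proof -
  interpret N: module R N by fact
  interpret L: module R L by fact
  note K = submoduleD[OF assms(1,3)]
  note g = module_homD[OF assms(4), simplified]
  show ?thesis using assms(5)
  proof (induction S rule: infinite_finite_induct)
    case (insert i S)
    have "(\<Oplus>\<^bsub>N\<^esub>i\<in>insert i S. x i) = x i \<oplus>\<^bsub>N\<^esub> (\<Oplus>\<^bsub>N\<^esub>i\<in>S. x i)"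
      using insert K(1) by (intro N.finsum_insert) auto
    moreover have "(\<Oplus>\<^bsub>L\<^esub>i\<in>insert i S. g (x i)) = g (x i) \<oplus>\<^bsub>L\<^esub> (\<Oplus>\<^bsub>L\<^esub>i\<in>S. g (x i))"
      using insert g(1) by (intro L.finsum_insert) auto
    moreover have "(\<Oplus>\<^bsub>N\<^esub>i\<in>S. x i) \<in> K"
      using insert by (intro finsum_submodule[OF assms(1,3)]) auto
    ultimately show ?case using insert g(2) by simp
  qed (auto simp: restricted_hom_zero[OF assms(1-4)])
qed

lemma finsum_module_hom:
  assumes "module R N" "module R L" "g \<in> module_hom R N L" "x \<in> S \<rightarrow> carrier N"
  shows "g (\<Oplus>\<^bsub>N\<^esub>i\<in>S. x i) = (\<Oplus>\<^bsub>L\<^esub>i\<in>S. g (x i))"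
  using finsum_restricted_hom[OF assms(1,2) carrier_submodule[OF assms(1)] _ assms(4), of g] assms(3)
  by simp

lemma finsum_swap:
  assumes "module R N" "finite S" "finite T" "\<And>i j. i \<in> S \<Longrightarrow> j \<in> T \<Longrightarrow> f i j \<in> carrier N"
  shows "(\<Oplus>\<^bsub>N\<^esub>i\<in>S. \<Oplus>\<^bsub>N\<^esub>j\<in>T. f i j) = (\<Oplus>\<^bsub>N\<^esub>j\<in>T. \<Oplus>\<^bsub>N\<^esub>i\<in>S. f i j)"
proof -
  interpret N: module R N by fact
  show ?thesis using assms(2,4)
  proof (induction S)
    case (insert i S)
    have "(\<Oplus>\<^bsub>N\<^esub>i\<in>insert i S. \<Oplus>\<^bsub>N\<^esub>j\<in>T. f i j)
        = (\<Oplus>\<^bsub>N\<^esub>j\<in>T. f i j) \<oplus>\<^bsub>N\<^esub> (\<Oplus>\<^bsub>N\<^esub>i\<in>S. \<Oplus>\<^bsub>N\<^esub>j\<in>T. f i j)"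
      using insert by (intro N.finsum_insert) (auto intro!: N.finsum_closed)
    also have "\<dots> = (\<Oplus>\<^bsub>N\<^esub>j\<in>T. f i j) \<oplus>\<^bsub>N\<^esub> (\<Oplus>\<^bsub>N\<^esub>j\<in>T. \<Oplus>\<^bsub>N\<^esub>i\<in>S. f i j)"
      using insert by auto
    also have "\<dots> = (\<Oplus>\<^bsub>N\<^esub>j\<in>T. f i j \<oplus>\<^bsub>N\<^esub> (\<Oplus>\<^bsub>N\<^esub>i\<in>S. f i j))"
      using insert by (intro N.finsum_addf[symmetric]) (auto intro!: N.finsum_closed)
    also have "\<dots> = (\<Oplus>\<^bsub>N\<^esub>j\<in>T. \<Oplus>\<^bsub>N\<^esub>i\<in>insert i S. f i j)"
      using insert by (intro N.finsum_cong' refl N.finsum_insert[symmetric])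
        (auto intro!: N.finsum_closed N.a_closed)
    finally show ?case .
  qed (auto simp: N.finsum_zero)
qed

lemma finsum_smult_right:
  assumes "module R N" "finite S" "r \<in> S \<rightarrow> carrier R" "x \<in> carrier N"
  shows "(\<Oplus>\<^bsub>R\<^esub>i\<in>S. r i) \<odot>\<^bsub>N\<^esub> x = (\<Oplus>\<^bsub>N\<^esub>i\<in>S. r i \<odot>\<^bsub>N\<^esub> x)"
proof -
  interpret N: module R N by fact
  show ?thesis using assms(2,3)
  proof (induction S)
    case (insert i S)
    have "(\<Oplus>\<^bsub>N\<^esub>i\<in>insert i S. r i \<odot>\<^bsub>N\<^esub> x) = r i \<odot>\<^bsub>N\<^esub> x \<oplus>\<^bsub>N\<^esub> (\<Oplus>\<^bsub>N\<^esub>i\<in>S. r i \<odot>\<^bsub>N\<^esub> x)"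
      using insert assms by (intro N.finsum_insert) auto
    moreover have "(\<Oplus>\<^bsub>R\<^esub>i\<in>insert i S. r i) = r i \<oplus>\<^bsub>R\<^esub> (\<Oplus>\<^bsub>R\<^esub>i\<in>S. r i)"
      using insert by (intro N.R.finsum_insert) auto
    moreover have "(\<Oplus>\<^bsub>R\<^esub>i\<in>S. r i) \<in> carrier R" using insert by auto
    ultimately show ?case using insert assms by (auto simp: N.smult_l_distr)
  qed (use assms in auto)
qed

section \<open>Matrices acting on tuples over a module\<close>

text \<open>A matrix acting on tuples over an arbitrary module. Only the number \<open>q\<close> of
  columns is an argument: the result is a total function of the row index, read only below the
  intended number of rows.\<close>

definition mact :: "('r, 'n) module \<Rightarrow> (nat \<Rightarrow> nat \<Rightarrow> 'r) \<Rightarrow> nat \<Rightarrow> (nat \<Rightarrow> 'n) \<Rightarrow> nat \<Rightarrow> 'n" where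
  "mact N A q x = (\<lambda>k. \<Oplus>\<^bsub>N\<^esub>l\<in>{..<q}. A k l \<odot>\<^bsub>N\<^esub> x l)"

lemma mact_submodule:
  assumes "module R N" "submodule K R N" "\<And>k l. A k l \<in> carrier R" "x \<in> {..<q} \<rightarrow> K"
  shows "mact N A q x k \<in> K"
  unfolding mact_def using assms(3,4) submoduleD(6)[OF assms(1,2)]
  by (intro finsum_submodule[OF assms(1,2)]) auto

lemma mact_closed:
  assumes "module R N" "\<And>k l. A k l \<in> carrier R" "x \<in> {..<q} \<rightarrow> carrier N"
  shows "mact N A q x k \<in> carrier N"
  by (rule mact_submodule[OF assms(1) carrier_submodule[OF assms(1)] assms(2,3)])

lemma mact_cong:
  assumes "module R N" "\<And>k l. A k l \<in> carrier R" "x \<in> {..<q} \<rightarrow> carrier N"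
    and "\<And>l. l < q \<Longrightarrow> y l = x l"
  shows "mact N A q y k = mact N A q x k"
proof -
  interpret N: module R N by fact
  show ?thesis unfolding mact_def using assms by (intro N.finsum_cong') auto
qed

lemma mact_restricted_hom:
  assumes "module R N" "module R L" "submodule K R N" "g \<in> module_hom R (N\<lparr>carrier := K\<rparr>) L"
    and "\<And>k l. A k l \<in> carrier R" "x \<in> {..<q} \<rightarrow> K"
  shows "g (mact N A q x k) = mact L A q (\<lambda>l. g (x l)) k"
proof -
  interpret L: module R L by fact
  note K = submoduleD[OF assms(1,3)]
  note g = module_homD[OF assms(4), simplified]
  have "g (mact N A q x k) = (\<Oplus>\<^bsub>L\<^esub>l\<in>{..<q}. g (A k l \<odot>\<^bsub>N\<^esub> x l))"
    unfolding mact_def using K assms(5,6) by (intro finsum_restricted_hom[OF assms(1-4)]) auto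
  also have "\<dots> = mact L A q (\<lambda>l. g (x l)) k"
    unfolding mact_def using g assms(5,6) by (intro L.finsum_cong') auto
  finally show ?thesis .
qed

lemma mact_module_hom:
  assumes "module R N" "module R L" "g \<in> module_hom R N L"
    and "\<And>k l. A k l \<in> carrier R" "x \<in> {..<q} \<rightarrow> carrier N"
  shows "g (mact N A q x k) = mact L A q (\<lambda>l. g (x l)) k"
  using mact_restricted_hom[OF assms(1,2) carrier_submodule[OF assms(1)] _ assms(4,5), of g] assms(3)
  by simp

lemma mact_diff:
  assumes "module R N" "\<And>k l. A k l \<in> carrier R" "x \<in> {..<q} \<rightarrow> carrier N" "y \<in> {..<q} \<rightarrow> carrier N"
  shows "mact N A q (\<lambda>l. x l \<ominus>\<^bsub>N\<^esub> y l) k = mact N A q x k \<ominus>\<^bsub>N\<^esub> mact N A q y k"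
proof -
  interpret N: module R N by fact
  have m: "\<ominus>\<^bsub>R\<^esub> \<one>\<^bsub>R\<^esub> \<in> carrier R" by simp
  have "mact N A q (\<lambda>l. x l \<ominus>\<^bsub>N\<^esub> y l) k
      = (\<Oplus>\<^bsub>N\<^esub>l\<in>{..<q}. A k l \<odot>\<^bsub>N\<^esub> x l \<oplus>\<^bsub>N\<^esub> (\<ominus>\<^bsub>R\<^esub> \<one>\<^bsub>R\<^esub>) \<odot>\<^bsub>N\<^esub> (A k l \<odot>\<^bsub>N\<^esub> y l))"
    unfolding mact_def
  proof (intro N.finsum_cong' refl)
    fix l assume "l \<in> {..<q}"
    then have "x l \<in> carrier N" "y l \<in> carrier N" using assms by auto
    then show "A k l \<odot>\<^bsub>N\<^esub> (x l \<ominus>\<^bsub>N\<^esub> y l)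
      = A k l \<odot>\<^bsub>N\<^esub> x l \<oplus>\<^bsub>N\<^esub> (\<ominus>\<^bsub>R\<^esub> \<one>\<^bsub>R\<^esub>) \<odot>\<^bsub>N\<^esub> (A k l \<odot>\<^bsub>N\<^esub> y l)"
      using assms(2)[of k l] by (simp add: minus_as_smult[OF assms(1)] N.smult_r_distr
        N.smult_assoc1[symmetric] N.R.m_comm del: N.R.l_minus)
  qed (use assms m in \<open>auto intro!: N.a_closed N.smult_closed\<close>)
  also have "\<dots> = mact N A q x k \<oplus>\<^bsub>N\<^esub> (\<Oplus>\<^bsub>N\<^esub>l\<in>{..<q}. (\<ominus>\<^bsub>R\<^esub> \<one>\<^bsub>R\<^esub>) \<odot>\<^bsub>N\<^esub> (A k l \<odot>\<^bsub>N\<^esub> y l))"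
    unfolding mact_def using assms m by (intro N.finsum_addf) auto
  also have "(\<Oplus>\<^bsub>N\<^esub>l\<in>{..<q}. (\<ominus>\<^bsub>R\<^esub> \<one>\<^bsub>R\<^esub>) \<odot>\<^bsub>N\<^esub> (A k l \<odot>\<^bsub>N\<^esub> y l))
      = (\<ominus>\<^bsub>R\<^esub> \<one>\<^bsub>R\<^esub>) \<odot>\<^bsub>N\<^esub> mact N A q y k"
    unfolding mact_def using assms m by (intro N.finsum_smult_ldistr[symmetric]) auto
  finally show ?thesis
    using mact_closed[OF assms(1,2,3)] mact_closed[OF assms(1,2,4)]
    by (simp add: minus_as_smult[OF assms(1)])
qed

lemma mact_mact:
  assumes "module R N" "\<And>k l. A k l \<in> carrier R" "\<And>k l. B k l \<in> carrier R" "x \<in> {..<q} \<rightarrow> carrier N"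
  shows "mact N A p (mact N B q x) i = mact N (\<lambda>i l. \<Oplus>\<^bsub>R\<^esub>k\<in>{..<p}. A i k \<otimes>\<^bsub>R\<^esub> B k l) q x i"
proof -
  interpret N: module R N by fact
  have x: "x l \<in> carrier N" if "l < q" for l using that assms(4) by auto
  have "mact N A p (mact N B q x) i = (\<Oplus>\<^bsub>N\<^esub>k\<in>{..<p}. \<Oplus>\<^bsub>N\<^esub>l\<in>{..<q}. (A i k \<otimes>\<^bsub>R\<^esub> B k l) \<odot>\<^bsub>N\<^esub> x l)"
    unfolding mact_def
  proof (intro N.finsum_cong' refl)
    fix k
    have "A i k \<odot>\<^bsub>N\<^esub> (\<Oplus>\<^bsub>N\<^esub>l\<in>{..<q}. B k l \<odot>\<^bsub>N\<^esub> x l)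
        = (\<Oplus>\<^bsub>N\<^esub>l\<in>{..<q}. A i k \<odot>\<^bsub>N\<^esub> (B k l \<odot>\<^bsub>N\<^esub> x l))"
      using assms x by (intro N.finsum_smult_ldistr) auto
    also have "\<dots> = (\<Oplus>\<^bsub>N\<^esub>l\<in>{..<q}. (A i k \<otimes>\<^bsub>R\<^esub> B k l) \<odot>\<^bsub>N\<^esub> x l)"
      using assms x by (intro N.finsum_cong') (auto simp: N.smult_assoc1)
    finally show "A i k \<odot>\<^bsub>N\<^esub> (\<Oplus>\<^bsub>N\<^esub>l\<in>{..<q}. B k l \<odot>\<^bsub>N\<^esub> x l)
        = (\<Oplus>\<^bsub>N\<^esub>l\<in>{..<q}. (A i k \<otimes>\<^bsub>R\<^esub> B k l) \<odot>\<^bsub>N\<^esub> x l)" .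
  qed (use assms x in \<open>auto intro!: N.finsum_closed\<close>)
  also have "\<dots> = (\<Oplus>\<^bsub>N\<^esub>l\<in>{..<q}. \<Oplus>\<^bsub>N\<^esub>k\<in>{..<p}. (A i k \<otimes>\<^bsub>R\<^esub> B k l) \<odot>\<^bsub>N\<^esub> x l)"
    using assms x by (intro finsum_swap[OF assms(1)]) auto
  also have "\<dots> = mact N (\<lambda>i l. \<Oplus>\<^bsub>R\<^esub>k\<in>{..<p}. A i k \<otimes>\<^bsub>R\<^esub> B k l) q x i"
    unfolding mact_def using assms x
    by (intro N.finsum_cong' refl finsum_smult_right[OF assms(1), symmetric])
      (auto intro!: N.finsum_closed)
  finally show ?thesis .
qed

subsection \<open>Complexes of matrices\<close>

text \<open>The matrices are fixed and the module varies, so one complex of matrices gives a complex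
  of powers N^(m j) for every \<open>N\<close> at once. The degree goes up, and products are only
  required to vanish at entries inside the matrix format.\<close>

locale matrix_complex = cring R for R :: "'r ring" (structure) +
  fixes m :: "int \<Rightarrow> nat" and A :: "int \<Rightarrow> nat \<Rightarrow> nat \<Rightarrow> 'r"
  assumes A_closed: "A j k l \<in> carrier R"
    and A_A: "i < m (j + 1 + 1) \<Longrightarrow> l < m j \<Longrightarrow>
      (\<Oplus>k\<in>{..<m (j + 1)}. A (j + 1) i k \<otimes> A j k l) = \<zero>"
begin

abbreviation D :: "('r, 'n) module \<Rightarrow> int \<Rightarrow> (nat \<Rightarrow> 'n) \<Rightarrow> nat \<Rightarrow> 'n" where
  "D N j \<equiv> mact N (A j) (m j)"

text \<open>Cycles and preimages both have entries in \<open>K\<close>, and tuples are compared only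
  below \<open>m j\<close>, which spares restrictions to index sets. For a submodule
  \<open>K\<close> this is the vanishing of the j-th homology of the complex of powers of
  \<open>K\<close>.\<close>

definition exact_at :: "('r, 'n) module \<Rightarrow> 'n set \<Rightarrow> int \<Rightarrow> bool" where
  "exact_at N K j \<longleftrightarrow> (\<forall>x\<in>{..<m j} \<rightarrow> K. (\<forall>k<m (j + 1). D N j x k = \<zero>\<^bsub>N\<^esub>) \<longrightarrow>
     (\<exists>y\<in>{..<m (j - 1)} \<rightarrow> K. \<forall>k<m j. x k = D N (j - 1) y k))"

lemma exact_atD:
  assumes "exact_at N K j" "x \<in> {..<m j} \<rightarrow> K" "\<And>k. k < m (j + 1) \<Longrightarrow> D N j x k = \<zero>\<^bsub>N\<^esub>"
  obtains y where "y \<in> {..<m (j - 1)} \<rightarrow> K" "\<And>k. k < m j \<Longrightarrow> x k = D N (j - 1) y k"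
  using assms unfolding exact_at_def by meson

text \<open>Starting point of the dimension shifts, in a degree where the module is zero; the zero
  tuple is the preimage.\<close>

lemma exact_at_trivial:
  assumes "module R N" and K: "\<zero>\<^bsub>N\<^esub> \<in> K" and "m j = 0 \<or> K = {\<zero>\<^bsub>N\<^esub>}"
  shows "exact_at N K j"
proof -
  interpret N: module R N by fact
  have z: "(\<lambda>_. \<zero>\<^bsub>N\<^esub>) \<in> {..<m (j - 1)} \<rightarrow> {\<zero>\<^bsub>N\<^esub>}" by auto
  have "D N (j - 1) (\<lambda>_. \<zero>\<^bsub>N\<^esub>) k = \<zero>\<^bsub>N\<^esub>" for k
    using mact_submodule[OF assms(1) zero_submodule[OF assms(1)] A_closed z] by auto
  then have D0: "x k = D N (j - 1) (\<lambda>_. \<zero>\<^bsub>N\<^esub>) k" if "x k = \<zero>\<^bsub>N\<^esub>" for x k using that by simp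
  have "(\<lambda>_. \<zero>\<^bsub>N\<^esub>) \<in> {..<m (j - 1)} \<rightarrow> K" using K by simp
  moreover have "x k = \<zero>\<^bsub>N\<^esub>" if "x \<in> {..<m j} \<rightarrow> K" "k < m j" for x k
    using that assms(3) by auto
  ultimately show ?thesis unfolding exact_at_def using D0 by meson
qed

lemma D_D:
  assumes "module R N" "x \<in> {..<m j} \<rightarrow> carrier N" "i < m (j + 1 + 1)"
  shows "D N (j + 1) (D N j x) i = \<zero>\<^bsub>N\<^esub>"
proof -
  interpret N: module R N by fact
  have "D N (j + 1) (D N j x) i
      = (\<Oplus>\<^bsub>N\<^esub>l\<in>{..<m j}. (\<Oplus>k\<in>{..<m (j + 1)}. A (j + 1) i k \<otimes> A j k l) \<odot>\<^bsub>N\<^esub> x l)"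
    using mact_mact[OF assms(1) A_closed A_closed assms(2)] by (simp add: mact_def)
  also have "\<dots> = (\<Oplus>\<^bsub>N\<^esub>l\<in>{..<m j}. \<zero>\<^bsub>N\<^esub>)"
  proof (intro N.finsum_cong' refl)
    fix l assume "l \<in> {..<m j}"
    then show "(\<Oplus>k\<in>{..<m (j + 1)}. A (j + 1) i k \<otimes> A j k l) \<odot>\<^bsub>N\<^esub> x l = \<zero>\<^bsub>N\<^esub>"
      using assms A_A[OF assms(3), of l] by (auto intro!: N.smult_l_null)
  qed auto
  finally show ?thesis by simp
qed

lemma D_D':
  assumes "module R N" "x \<in> {..<m (j - 1)} \<rightarrow> carrier N" "i < m (j + 1)"
    and "\<And>k. k < m j \<Longrightarrow> y k = D N (j - 1) x k"
  shows "D N j y i = \<zero>\<^bsub>N\<^esub>"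
proof -
  have "D N j y i = D N j (D N (j - 1) x) i"
    using assms A_closed by (intro mact_cong) (auto intro: mact_closed)
  then show ?thesis using D_D[OF assms(1,2), of i] assms(3) by simp
qed

context
  fixes N :: "('r, 'n) module" and L :: "('r, 'l) module" and K g
  assumes N: "module R N" and L: "module R L" and K: "submodule K R N"
    and g: "g \<in> module_hom R (N\<lparr>carrier := K\<rparr>) L"
begin

abbreviation (input) "K' \<equiv> {x \<in> K. g x = \<zero>\<^bsub>L\<^esub>}"

lemma tuple_lift:
  assumes "x \<in> {..<n::nat} \<rightarrow> g ` K"
  obtains y where "y \<in> {..<n} \<rightarrow> K" "\<And>k. k < n \<Longrightarrow> g (y k) = x k"
proof -
  have "\<forall>k\<in>{..<n}. \<exists>z. z \<in> K \<and> g z = x k" using assms by force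
  then obtain y where "\<forall>k\<in>{..<n}. y k \<in> K \<and> g (y k) = x k" by (rule bchoice[THEN exE])
  then show ?thesis by (intro that[of y]) auto
qed

lemma ambient: "x \<in> S \<rightarrow> K \<Longrightarrow> x \<in> S \<rightarrow> carrier N"
  using submoduleD(1)[OF N K] by (simp add: Pi_iff)

lemma image_closed: "x \<in> S \<rightarrow> K \<Longrightarrow> (\<lambda>l. g (x l)) \<in> S \<rightarrow> carrier L"
  using module_homD(1)[OF g] by (simp add: Pi_iff)

lemma g_D: "x \<in> {..<m j} \<rightarrow> K \<Longrightarrow> g (D N j x k) = D L j (\<lambda>l. g (x l)) k"
  by (rule mact_restricted_hom[OF N L K g A_closed])

lemma D_in: "x \<in> {..<m j} \<rightarrow> K \<Longrightarrow> D N j x k \<in> K"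
  by (rule mact_submodule[OF N K A_closed])

text \<open>The stretch H^j(K') -> H^j(K) -> H^j(g(K)) of the long exact sequence. A preimage of
  g(x) is lifted to y over \<open>K\<close>; then x - Dy has entries in the kernel, so it equals Dw
  with w over the kernel, and x = D(y + w).\<close>

lemma exact_at_middle:
  assumes K'_ex: "exact_at N K' j" and im_ex: "exact_at L (g ` K) j"
  shows "exact_at N K j"
  unfolding exact_at_def
proof (intro ballI impI)
  interpret N: module R N by (rule N)
  note KD = submoduleD[OF N K]
  fix x assume x: "x \<in> {..<m j} \<rightarrow> K" and Dx: "\<forall>k<m (j + 1). D N j x k = \<zero>\<^bsub>N\<^esub>"
  obtain y' where y': "y' \<in> {..<m (j - 1)} \<rightarrow> g ` K" "\<And>k. k < m j \<Longrightarrow> g (x k) = D L (j - 1) y' k"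
  proof (rule exact_atD[OF im_ex, of "\<lambda>l. g (x l)"])
    show "(\<lambda>l. g (x l)) \<in> {..<m j} \<rightarrow> g ` K" using x by auto
    fix k assume "k < m (j + 1)"
    then show "D L j (\<lambda>l. g (x l)) k = \<zero>\<^bsub>L\<^esub>"
      using g_D[OF x, of k] Dx restricted_hom_zero[OF N L K g] by simp
  qed (use that in blast)
  from y'(1) obtain y where y: "y \<in> {..<m (j - 1)} \<rightarrow> K" "\<And>k. k < m (j - 1) \<Longrightarrow> g (y k) = y' k"
    by (rule tuple_lift) blast
  define z where "z l = x l \<ominus>\<^bsub>N\<^esub> D N (j - 1) y l" for l
  have gy: "g (D N (j - 1) y k) = D L (j - 1) y' k" for k
    using g_D[OF y(1)] mact_cong[OF L A_closed image_closed[OF y(1)], of y'] y(2) by simp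
  have "g (z l) = \<zero>\<^bsub>L\<^esub>" if "l < m j" for l
  proof -
    have xl: "x l \<in> K" using x that by auto
    show ?thesis unfolding z_def restricted_hom_diff[OF N L K g xl D_in[OF y(1)]] gy
      using module_homD(1)[OF g] xl by (simp flip: y'(2)[OF that] add: module_minus_self[OF L])
  qed
  then have z: "z \<in> {..<m j} \<rightarrow> K'"
    using x D_in[OF y(1)] KD(5) by (auto simp: z_def)
  obtain w where w: "w \<in> {..<m (j - 1)} \<rightarrow> K'" "\<And>k. k < m j \<Longrightarrow> z k = D N (j - 1) w k"
  proof (rule exact_atD[OF K'_ex z])
    fix k assume k: "k < m (j + 1)"
    have "D N j z k = D N j x k \<ominus>\<^bsub>N\<^esub> D N j (D N (j - 1) y) k"
      unfolding z_def using ambient[OF x] mact_closed[OF N A_closed ambient[OF y(1)]]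
      by (intro mact_diff[OF N A_closed]) auto
    also have "\<dots> = \<zero>\<^bsub>N\<^esub>"
      using Dx k D_D'[OF N ambient[OF y(1)] k] by (simp add: module_minus_self[OF N])
    finally show "D N j z k = \<zero>\<^bsub>N\<^esub>" .
  qed (use that in blast)
  have w': "w \<in> {..<m (j - 1)} \<rightarrow> K" using w(1) by auto
  \<comment> \<open>The sum y + w is written as y - (0 - w), so that compatibility of matrices with
    differences suffices.\<close>
  let ?nw = "\<lambda>l. \<zero>\<^bsub>N\<^esub> \<ominus>\<^bsub>N\<^esub> w l"
  let ?v = "\<lambda>l. y l \<ominus>\<^bsub>N\<^esub> ?nw l"
  have zK: "(\<lambda>_. \<zero>\<^bsub>N\<^esub>) \<in> {..<m (j - 1)} \<rightarrow> {\<zero>\<^bsub>N\<^esub>}" by simp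
  have nw: "?nw \<in> {..<m (j - 1)} \<rightarrow> K" using w' KD by auto
  have v: "?v \<in> {..<m (j - 1)} \<rightarrow> K" using y(1) nw KD(5) by auto
  have "x k = D N (j - 1) ?v k" if k: "k < m j" for k
  proof -
    have a: "D N (j - 1) y k \<in> carrier N" "D N (j - 1) w k \<in> carrier N" "x k \<in> carrier N"
      using mact_closed[OF N A_closed] ambient[OF y(1)] ambient[OF w'] ambient[OF x] k by auto
    have D0: "D N (j - 1) (\<lambda>_. \<zero>\<^bsub>N\<^esub>) k = \<zero>\<^bsub>N\<^esub>"
      using mact_submodule[OF N zero_submodule[OF N] A_closed zK] by auto
    have "D N (j - 1) ?v k = D N (j - 1) y k \<ominus>\<^bsub>N\<^esub> D N (j - 1) ?nw k"
      by (rule mact_diff[OF N A_closed ambient[OF y(1)] ambient[OF nw]])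
    also have "D N (j - 1) ?nw k = \<zero>\<^bsub>N\<^esub> \<ominus>\<^bsub>N\<^esub> D N (j - 1) w k"
      using mact_diff[OF N A_closed _ ambient[OF w'], of "\<lambda>_. \<zero>\<^bsub>N\<^esub>"] D0 by simp
    also have "D N (j - 1) w k = x k \<ominus>\<^bsub>N\<^esub> D N (j - 1) y k"
      using w(2)[OF k] by (simp add: z_def)
    also have "D N (j - 1) y k \<ominus>\<^bsub>N\<^esub> (\<zero>\<^bsub>N\<^esub> \<ominus>\<^bsub>N\<^esub> (x k \<ominus>\<^bsub>N\<^esub> D N (j - 1) y k)) = x k"
      using a by (simp add: a_minus_def N.minus_add N.a_ac N.r_neg N.r_neg1 N.r_neg2)
    finally show ?thesis by simp
  qed
  then show "\<exists>y\<in>{..<m (j - 1)} \<rightarrow> K. \<forall>k<m j. x k = D N (j - 1) y k"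
    using v by (intro bexI[of _ ?v]) auto
qed

text \<open>The stretch H^j(K) -> H^j(g(K)) -> H^(j+1)(K'). For a lift x of a cycle x', the tuple Dx
  lies over the kernel and is a cycle there, so Dx = Dz with z over the kernel; x - z is then a
  cycle over \<open>K\<close> that still maps to x'.\<close>

lemma exact_at_image:
  assumes K_ex: "exact_at N K j" and K'_ex: "exact_at N K' (j + 1)"
  shows "exact_at L (g ` K) j"
  unfolding exact_at_def
proof (intro ballI impI)
  interpret N: module R N by (rule N)
  note KD = submoduleD[OF N K]
  fix x' assume x': "x' \<in> {..<m j} \<rightarrow> g ` K" and Dx: "\<forall>k<m (j + 1). D L j x' k = \<zero>\<^bsub>L\<^esub>"
  from x' obtain x where x: "x \<in> {..<m j} \<rightarrow> K" "\<And>k. k < m j \<Longrightarrow> g (x k) = x' k"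
    by (rule tuple_lift) blast
  have "g (D N j x k) = D L j x' k" for k
    using g_D[OF x(1)] mact_cong[OF L A_closed image_closed[OF x(1)], of x'] x(2) by simp
  then have Dx_K': "D N j x \<in> {..<m (j + 1)} \<rightarrow> K'" using D_in[OF x(1)] Dx by auto
  obtain z where z: "z \<in> {..<m j} \<rightarrow> K'" "\<And>k. k < m (j + 1) \<Longrightarrow> D N j x k = D N j z k"
  proof (rule exact_atD[OF K'_ex Dx_K'])
    fix k assume "k < m (j + 1 + 1)"
    then show "D N (j + 1) (D N j x) k = \<zero>\<^bsub>N\<^esub>" by (rule D_D[OF N ambient[OF x(1)]])
  qed (use that in simp)
  have z': "z \<in> {..<m j} \<rightarrow> K" using z(1) by auto
  let ?d = "\<lambda>l. x l \<ominus>\<^bsub>N\<^esub> z l"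
  have d: "?d \<in> {..<m j} \<rightarrow> K" using x(1) z' KD(5) by auto
  obtain y where y: "y \<in> {..<m (j - 1)} \<rightarrow> K" "\<And>k. k < m j \<Longrightarrow> ?d k = D N (j - 1) y k"
  proof (rule exact_atD[OF K_ex d])
    fix k assume "k < m (j + 1)"
    then show "D N j ?d k = \<zero>\<^bsub>N\<^esub>"
      using mact_diff[OF N A_closed ambient[OF x(1)] ambient[OF z']] z(2)
        mact_closed[OF N A_closed ambient[OF x(1)]]  mact_closed[OF N A_closed ambient[OF z']]
      by (simp add: module_minus_self[OF N])
  qed (use that in blast)
  have "x' k = D L (j - 1) (\<lambda>l. g (y l)) k" if k: "k < m j" for k
  proof -
    have xz: "x k \<in> K" "z k \<in> K" "g (z k) = \<zero>\<^bsub>L\<^esub>" using x(1) z k by auto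
    have "D L (j - 1) (\<lambda>l. g (y l)) k = g (?d k)" using g_D[OF y(1)] y(2)[OF k] by simp
    also have "\<dots> = g (x k)"
      using restricted_hom_diff[OF N L K g xz(1,2)] xz module_homD(1)[OF g]
      by (simp add: module_minus_zero[OF L])
    finally show ?thesis using x(2)[OF k] by simp
  qed
  moreover have "(\<lambda>l. g (y l)) \<in> {..<m (j - 1)} \<rightarrow> g ` K" using y(1) by auto
  ultimately show "\<exists>y\<in>{..<m (j - 1)} \<rightarrow> g ` K. \<forall>k<m j. x' k = D L (j - 1) y k" by blast
qed

text \<open>Vanishing of H^j(g(K)) makes H^(j+1)(K') -> H^(j+1)(K) injective. In the tensor complex
  with j = -1 this reads: if Tor_1 of the image vanishes, C (x) K' -> C (x) K is injective, so a
  relation over \<open>K\<close> between tuples over the kernel can be replaced by one over the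
  kernel.\<close>

lemma boundary_in_kernel:
  assumes im_ex: "exact_at L (g ` K) j" and x: "x \<in> {..<m (j + 1)} \<rightarrow> K'"
    and y: "y \<in> {..<m j} \<rightarrow> K" "\<And>k. k < m (j + 1) \<Longrightarrow> x k = D N j y k"
  obtains z where "z \<in> {..<m j} \<rightarrow> K'" "\<And>k. k < m (j + 1) \<Longrightarrow> x k = D N j z k"
proof -
  interpret N: module R N by (rule N)
  note KD = submoduleD[OF N K]
  obtain w' where w': "w' \<in> {..<m (j - 1)} \<rightarrow> g ` K"
    "\<And>k. k < m j \<Longrightarrow> g (y k) = D L (j - 1) w' k"
  proof (rule exact_atD[OF im_ex, of "\<lambda>l. g (y l)"])
    show "(\<lambda>l. g (y l)) \<in> {..<m j} \<rightarrow> g ` K" using y by auto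
    fix k assume k: "k < m (j + 1)"
    then have "x k \<in> K'" using x by auto
    then have "g (x k) = \<zero>\<^bsub>L\<^esub>" by simp
    then show "D L j (\<lambda>l. g (y l)) k = \<zero>\<^bsub>L\<^esub>"
      using g_D[OF y(1), of k] k y(2)[of k] by simp
  qed (use that in blast)
  from w'(1) obtain w where w: "w \<in> {..<m (j - 1)} \<rightarrow> K" "\<And>k. k < m (j - 1) \<Longrightarrow> g (w k) = w' k"
    by (rule tuple_lift) blast
  define z where "z l = y l \<ominus>\<^bsub>N\<^esub> D N (j - 1) w l" for l
  have gw: "g (D N (j - 1) w k) = D L (j - 1) w' k" for k
    using g_D[OF w(1)] mact_cong[OF L A_closed image_closed[OF w(1)], of w'] w(2) by simp
  have "g (z l) = \<zero>\<^bsub>L\<^esub>" if "l < m j" for l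
  proof -
    have yl: "y l \<in> K" using y that by auto
    show ?thesis unfolding z_def restricted_hom_diff[OF N L K g yl D_in[OF w(1)]] gw
      using module_homD(1)[OF g] yl by (simp flip: w'(2)[OF that] add: module_minus_self[OF L])
  qed
  then have z: "z \<in> {..<m j} \<rightarrow> K'"
    using y D_in[OF w(1)] KD(5) by (auto simp: z_def)
  have "x k = D N j z k" if k: "k < m (j + 1)" for k
  proof -
    have "D N j z k = D N j y k \<ominus>\<^bsub>N\<^esub> D N j (D N (j - 1) w) k"
      unfolding z_def using ambient[OF y(1)] mact_closed[OF N A_closed ambient[OF w(1)]]
      by (intro mact_diff[OF N A_closed]) auto
    also have "\<dots> = D N j y k"
      unfolding D_D'[OF N ambient[OF w(1)] k refl]
      using mact_closed[OF N A_closed ambient[OF y(1)]] by (rule module_minus_zero[OF N])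
    finally show ?thesis using y(2)[OF k] by simp
  qed
  then show ?thesis using z that by blast
qed

text \<open>The stretch H^(j-1)(g(K)) -> H^j(K') -> H^j(K): a preimage over \<open>K\<close> exists,
  and \<open>boundary_in_kernel\<close> moves it into the kernel.\<close>

lemma exact_at_kernel:
  assumes K_ex: "exact_at N K j" and im_ex: "exact_at L (g ` K) (j - 1)"
  shows "exact_at N K' j"
  unfolding exact_at_def
proof (intro ballI impI)
  fix x assume x: "x \<in> {..<m j} \<rightarrow> K'" and Dx: "\<forall>k<m (j + 1). D N j x k = \<zero>\<^bsub>N\<^esub>"
  have "x \<in> {..<m j} \<rightarrow> K" using x by auto
  from exact_atD[OF K_ex this] Dx
  obtain y where "y \<in> {..<m (j - 1)} \<rightarrow> K" "\<And>k. k < m j \<Longrightarrow> x k = D N (j - 1) y k"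
    by blast
  then show "\<exists>y\<in>{..<m (j - 1)} \<rightarrow> K'. \<forall>k<m j. x k = D N (j - 1) y k"
  proof -
    assume y: "y \<in> {..<m (j - 1)} \<rightarrow> K" "\<And>k. k < m j \<Longrightarrow> x k = D N (j - 1) y k"
    show ?thesis
    proof (rule boundary_in_kernel[OF im_ex, of x y])
      fix z assume "z \<in> {..<m (j - 1)} \<rightarrow> K'" "\<And>k. k < m (j - 1 + 1) \<Longrightarrow> x k = D N (j - 1) z k"
      then show ?thesis by (intro bexI[of _ z]) auto
    qed (use x y in auto)
  qed
qed

end

end

subsection \<open>Linear combinations\<close>

text \<open>The linear extension of a map from a basis to the free module. The sum runs over the
  support, in the same form as inside \<open>tensor_lift\<close>, so that the two can be matched by
  unfolding.\<close>

definition lincomb :: "'r ring \<Rightarrow> ('r, 't) module \<Rightarrow> ('x \<Rightarrow> 't) \<Rightarrow> ('x \<Rightarrow> 'r) \<Rightarrow> 't" where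
  "lincomb R T \<beta> u = (\<Oplus>\<^bsub>T\<^esub>x\<in>{x. u x \<noteq> \<zero>\<^bsub>R\<^esub>}. u x \<odot>\<^bsub>T\<^esub> \<beta> x)"

lemma lincomb_superset:
  assumes "module R T" "u \<in> carrier (free_module R X)" "finite S" "{x. u x \<noteq> \<zero>\<^bsub>R\<^esub>} \<subseteq> S"
    and "\<beta> \<in> S \<rightarrow> carrier T"
  shows "lincomb R T \<beta> u = (\<Oplus>\<^bsub>T\<^esub>x\<in>S. u x \<odot>\<^bsub>T\<^esub> \<beta> x)"
proof -
  interpret T: module R T by fact
  show ?thesis unfolding lincomb_def
  proof (rule T.add.finprod_mono_neutral_cong_left)
    fix x assume "x \<in> S - {x. u x \<noteq> \<zero>\<^bsub>R\<^esub>}"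
    then show "u x \<odot>\<^bsub>T\<^esub> \<beta> x = \<zero>\<^bsub>T\<^esub>" using assms(5) by auto
  qed (use assms free_moduleD(1)[OF assms(2)] in auto)
qed

lemma lincomb_closed:
  assumes "module R T" "u \<in> carrier (free_module R X)" "\<beta> \<in> X \<rightarrow> carrier T"
  shows "lincomb R T \<beta> u \<in> carrier T"
proof -
  interpret T: module R T by fact
  note u = free_moduleD[OF assms(2)]
  show ?thesis unfolding lincomb_def
    using u assms(3) by (intro T.finsum_closed) (auto intro!: T.smult_closed)
qed

lemma lincomb_hom:
  assumes "module R T" "\<beta> \<in> X \<rightarrow> carrier T"
  shows "lincomb R T \<beta> \<in> module_hom R (free_module R X) T"
proof (rule module_homI)
  interpret T: module R T by fact
  interpret F: module R "free_module R X" by (rule module_free[OF T.R.cring_axioms])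
  fix u assume u: "u \<in> carrier (free_module R X)"
  show "lincomb R T \<beta> u \<in> carrier T" by (rule lincomb_closed[OF assms(1) u assms(2)])
  note uD = free_moduleD[OF u]
  {
    fix v assume v: "v \<in> carrier (free_module R X)"
    note vD = free_moduleD[OF v]
    let ?S = "{x. u x \<noteq> \<zero>\<^bsub>R\<^esub>} \<union> {x. v x \<noteq> \<zero>\<^bsub>R\<^esub>}"
    have S: "finite ?S" "\<beta> \<in> ?S \<rightarrow> carrier T" using uD(2,3) vD(2,3) assms(2) by auto
    have uv: "u \<oplus>\<^bsub>free_module R X\<^esub> v \<in> carrier (free_module R X)" using u v by simp
    have "lincomb R T \<beta> (u \<oplus>\<^bsub>free_module R X\<^esub> v) = (\<Oplus>\<^bsub>T\<^esub>x\<in>?S. (u x \<oplus>\<^bsub>R\<^esub> v x) \<odot>\<^bsub>T\<^esub> \<beta> x)"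
      by (subst lincomb_superset[OF assms(1) uv S(1) _ S(2)]) (auto simp: free_module_simps(3))
    also have "\<dots> = (\<Oplus>\<^bsub>T\<^esub>x\<in>?S. u x \<odot>\<^bsub>T\<^esub> \<beta> x \<oplus>\<^bsub>T\<^esub> v x \<odot>\<^bsub>T\<^esub> \<beta> x)"
      using S(2) uD(1) vD(1)
      by (intro T.finsum_cong' T.smult_l_distr refl Pi_I T.a_closed T.smult_closed) auto
    also have "\<dots> = (\<Oplus>\<^bsub>T\<^esub>x\<in>?S. u x \<odot>\<^bsub>T\<^esub> \<beta> x) \<oplus>\<^bsub>T\<^esub> (\<Oplus>\<^bsub>T\<^esub>x\<in>?S. v x \<odot>\<^bsub>T\<^esub> \<beta> x)"
      using S(2) uD(1) vD(1) by (intro T.finsum_addf Pi_I T.smult_closed) auto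
    also have "(\<Oplus>\<^bsub>T\<^esub>x\<in>?S. u x \<odot>\<^bsub>T\<^esub> \<beta> x) = lincomb R T \<beta> u"
      by (rule lincomb_superset[OF assms(1) u S(1) _ S(2), symmetric]) auto
    also have "(\<Oplus>\<^bsub>T\<^esub>x\<in>?S. v x \<odot>\<^bsub>T\<^esub> \<beta> x) = lincomb R T \<beta> v"
      by (rule lincomb_superset[OF assms(1) v S(1) _ S(2), symmetric]) auto
    finally show "lincomb R T \<beta> (u \<oplus>\<^bsub>free_module R X\<^esub> v) = lincomb R T \<beta> u \<oplus>\<^bsub>T\<^esub> lincomb R T \<beta> v" .
  }
  fix r assume r: "r \<in> carrier R"
  let ?S = "{x. u x \<noteq> \<zero>\<^bsub>R\<^esub>}"
  have S: "finite ?S" "\<beta> \<in> ?S \<rightarrow> carrier T" using uD(2,3) assms(2) by auto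
  have ru: "r \<odot>\<^bsub>free_module R X\<^esub> u \<in> carrier (free_module R X)" using u r by simp
  have "lincomb R T \<beta> (r \<odot>\<^bsub>free_module R X\<^esub> u) = (\<Oplus>\<^bsub>T\<^esub>x\<in>?S. (r \<otimes>\<^bsub>R\<^esub> u x) \<odot>\<^bsub>T\<^esub> \<beta> x)"
    by (subst lincomb_superset[OF assms(1) ru S(1) _ S(2)]) (auto simp: free_module_simps(4) r)
  also have "\<dots> = (\<Oplus>\<^bsub>T\<^esub>x\<in>?S. r \<odot>\<^bsub>T\<^esub> (u x \<odot>\<^bsub>T\<^esub> \<beta> x))"
    using S(2) uD(1) r by (intro T.finsum_cong' T.smult_assoc1 refl Pi_I T.smult_closed) auto
  also have "\<dots> = r \<odot>\<^bsub>T\<^esub> lincomb R T \<beta> u"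
    unfolding lincomb_def using S uD(1) r
    by (intro T.finsum_smult_ldistr[symmetric] Pi_I T.smult_closed) auto
  finally show "lincomb R T \<beta> (r \<odot>\<^bsub>free_module R X\<^esub> u) = r \<odot>\<^bsub>T\<^esub> lincomb R T \<beta> u" .
qed

lemma lincomb_basis_vec:
  assumes "module R T" "\<beta> x \<in> carrier T"
  shows "lincomb R T \<beta> (basis_vec R x) = \<beta> x"
proof -
  interpret T: module R T by fact
  have b: "basis_vec R x \<in> carrier (free_module R {x})"
    by (rule basis_vec_closed[OF T.R.cring_axioms]) simp
  have "lincomb R T \<beta> (basis_vec R x) = (\<Oplus>\<^bsub>T\<^esub>y\<in>{x}. basis_vec R x y \<odot>\<^bsub>T\<^esub> \<beta> y)"
    using assms(2) by (intro lincomb_superset[OF assms(1) b]) (auto simp: basis_vec_def)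
  also have "\<dots> = \<beta> x" using assms(2) by (simp add: T.finsum_insert basis_vec_def)
  finally show ?thesis .
qed

text \<open>Induction over a finite set containing the support: clearing one coordinate splits off a
  multiple of a basis vector.\<close>

lemma free_module_submodule_eq:
  assumes "cring R" "submodule K R (free_module R X)" "\<And>x. x \<in> X \<Longrightarrow> basis_vec R x \<in> K"
    and u: "u \<in> carrier (free_module R X)"
  shows "u \<in> K"
proof -
  interpret R: cring R by fact
  note F = module_free[OF assms(1), of X]
  note K = submoduleD[OF F assms(2)]
  have "\<forall>u\<in>carrier (free_module R X). {x. u x \<noteq> \<zero>\<^bsub>R\<^esub>} \<subseteq> S \<longrightarrow> u \<in> K" if "finite S" "S \<subseteq> X" for S
    using that
  proof (induction S)
    case empty
    have "u = \<zero>\<^bsub>free_module R X\<^esub>" if "{x. u x \<noteq> \<zero>\<^bsub>R\<^esub>} \<subseteq> {}" for u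
      using that by (auto simp: free_module_simps)
    with K(2) show ?case by blast
  next
    case (insert y S)
    show ?case
    proof (intro ballI impI)
      fix u assume u: "u \<in> carrier (free_module R X)" and s: "{x. u x \<noteq> \<zero>\<^bsub>R\<^esub>} \<subseteq> insert y S"
      note uD = free_moduleD[OF u]
      let ?v = "u(y := \<zero>\<^bsub>R\<^esub>)"
      have "?v \<in> carrier (free_module R X)"
        using uD by (intro free_moduleI) (auto intro: finite_subset[OF _ uD(2)])
      moreover have "{x. ?v x \<noteq> \<zero>\<^bsub>R\<^esub>} \<subseteq> S" using s by auto
      ultimately have v: "?v \<in> K" using insert by auto
      have "u y \<odot>\<^bsub>free_module R X\<^esub> basis_vec R y \<in> K"
        using insert by (intro K(6) uD(1) assms(3)) auto
      moreover have "?v \<oplus>\<^bsub>free_module R X\<^esub> (u y \<odot>\<^bsub>free_module R X\<^esub> basis_vec R y) = u"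
      proof
        fix x
        show "(?v \<oplus>\<^bsub>free_module R X\<^esub> (u y \<odot>\<^bsub>free_module R X\<^esub> basis_vec R y)) x = u x"
          using uD(1)[of x] uD(1)[of y]
          by (cases "x = y") (simp_all add: free_module_simps(3,4) basis_vec_def)
      qed
      ultimately show "u \<in> K" using K(3)[OF v, of "u y \<odot>\<^bsub>free_module R X\<^esub> basis_vec R y"] by simp
    qed
  qed
  from this[OF free_moduleD(2)[OF u]] free_moduleD(3)[OF u] u show ?thesis by blast
qed

lemma free_module_hom_eqI:
  assumes "module R T" "g \<in> module_hom R (free_module R X) T" "h \<in> module_hom R (free_module R X) T"
    and "\<And>x. x \<in> X \<Longrightarrow> g (basis_vec R x) = h (basis_vec R x)"
    and u: "u \<in> carrier (free_module R X)"
  shows "g u = h u"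
proof -
  note R = cring_of_module[OF assms(1)]
  note F = module_free[OF R, of X]
  interpret F: module R "free_module R X" by (rule F)
  let ?K = "{u \<in> carrier (free_module R X). g u = h u}"
  have "submodule ?K R (free_module R X)"
  proof (rule module_submoduleI[OF F])
    show "\<zero>\<^bsub>free_module R X\<^esub> \<in> ?K"
      by (simp add: module_hom_zero[OF F assms(1,2)] module_hom_zero[OF F assms(1,3)])
  qed (auto simp: module_homD(2,3)[OF assms(2)] module_homD(2,3)[OF assms(3)])
  moreover have "basis_vec R x \<in> ?K" if "x \<in> X" for x
    using assms(4)[OF that] basis_vec_closed[OF R that] by simp
  ultimately have "u \<in> ?K" by (intro free_module_submodule_eq[OF R _ _ u])
  then show ?thesis by simp
qed

lemma hom_lincomb:
  assumes "module R T" "module R T'" "g \<in> module_hom R T T'" "\<beta> \<in> X \<rightarrow> carrier T"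
    and u: "u \<in> carrier (free_module R X)"
  shows "g (lincomb R T \<beta> u) = lincomb R T' (\<lambda>x. g (\<beta> x)) u"
proof (rule free_module_hom_eqI[OF assms(2) _ _ _ u])
  have b: "(\<lambda>x. g (\<beta> x)) \<in> X \<rightarrow> carrier T'" using assms(4) module_homD(1)[OF assms(3)] by auto
  show "(\<lambda>u. g (lincomb R T \<beta> u)) \<in> module_hom R (free_module R X) T'"
    by (rule module_hom_comp[OF lincomb_hom[OF assms(1,4)] assms(3)])
  show "lincomb R T' (\<lambda>x. g (\<beta> x)) \<in> module_hom R (free_module R X) T'"
    by (rule lincomb_hom[OF assms(2) b])
  fix x assume "x \<in> X"
  then show "g (lincomb R T \<beta> (basis_vec R x)) = lincomb R T' (\<lambda>x. g (\<beta> x)) (basis_vec R x)"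
    using assms(4) b lincomb_basis_vec[OF assms(1), of \<beta> x]
      lincomb_basis_vec[OF assms(2), of "\<lambda>x. g (\<beta> x)" x]
    by (simp add: Pi_iff)
qed

lemma hom_eq_lincomb:
  assumes "module R T" "g \<in> module_hom R (free_module R X) T" "u \<in> carrier (free_module R X)"
  shows "g u = lincomb R T (\<lambda>x. g (basis_vec R x)) u"
proof (rule free_module_hom_eqI[OF assms(1,2) lincomb_hom[OF assms(1)] _ assms(3)])
  have *: "g (basis_vec R x) \<in> carrier T" if "x \<in> X" for x
    using that by (intro module_homD(1)[OF assms(2)] basis_vec_closed cring_of_module[OF assms(1)])
  then show "(\<lambda>x. g (basis_vec R x)) \<in> X \<rightarrow> carrier T" by auto
  show "g (basis_vec R x) = lincomb R T (\<lambda>x. g (basis_vec R x)) (basis_vec R x)" if "x \<in> X" for x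
    using lincomb_basis_vec[OF assms(1), of "\<lambda>x. g (basis_vec R x)" x] *[OF that] by simp
qed

lemma lincomb_lessThan:
  assumes "module R T" "u \<in> carrier (free_module R {..<n::nat})" "x \<in> {..<n} \<rightarrow> carrier T"
  shows "lincomb R T x u = (\<Oplus>\<^bsub>T\<^esub>l\<in>{..<n}. u l \<odot>\<^bsub>T\<^esub> x l)"
proof (rule lincomb_superset[OF assms(1,2) _ _ assms(3)])
  show "{x. u x \<noteq> \<zero>\<^bsub>R\<^esub>} \<subseteq> {..<n}" using assms(2) by (simp add: free_module_simps)
qed simp

lemma lincomb_submodule:
  assumes "module R T" "submodule K R T" "u \<in> carrier (free_module R X)" "x \<in> X \<rightarrow> K"
  shows "lincomb R T x u \<in> K"
proof -
  note K = submoduleD[OF assms(1,2)]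
  show ?thesis unfolding lincomb_def
  proof (rule finsum_submodule[OF assms(1,2)], rule Pi_I)
    fix y assume "y \<in> {x. u x \<noteq> \<zero>\<^bsub>R\<^esub>}"
    then have "y \<in> X" using assms(3) by (auto simp: free_module_simps)
    then show "u y \<odot>\<^bsub>T\<^esub> x y \<in> K"
      using assms(4) by (intro K(6) free_moduleD(1)[OF assms(3)]) auto
  qed
qed

text \<open>The factored map is defined by choosing preimages under \<open>p\<close>; two preimages
  differ by an element of the kernel of \<open>p\<close>, which \<open>\<phi>\<close> kills by
  assumption.\<close>

lemma hom_factor:
  assumes "module R A" "module R C" "module R N" "p \<in> module_hom R A C" "\<phi> \<in> module_hom R A N"
    and surj: "p ` carrier A = carrier C"
    and ker: "\<And>a. a \<in> carrier A \<Longrightarrow> p a = \<zero>\<^bsub>C\<^esub> \<Longrightarrow> \<phi> a = \<zero>\<^bsub>N\<^esub>"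
  obtains f where "f \<in> module_hom R C N" "\<And>a. a \<in> carrier A \<Longrightarrow> f (p a) = \<phi> a"
proof -
  interpret A: module R A by fact
  define f where "f c = \<phi> (SOME a. a \<in> carrier A \<and> p a = c)" for c
  have f: "f (p a) = \<phi> a" if a: "a \<in> carrier A" for a
  proof -
    let ?b = "SOME b. b \<in> carrier A \<and> p b = p a"
    have b: "?b \<in> carrier A \<and> p ?b = p a" by (rule someI[of _ a]) (simp add: a)
    then have "p (?b \<ominus>\<^bsub>A\<^esub> a) = \<zero>\<^bsub>C\<^esub>"
      using a module_homD(1)[OF assms(4)]
      by (simp add: module_hom_diff[OF assms(1,2,4)] module_minus_self[OF assms(2)])
    then have "\<phi> (?b \<ominus>\<^bsub>A\<^esub> a) = \<zero>\<^bsub>N\<^esub>" using a b by (intro ker) auto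
    then show ?thesis
      using a b module_homD(1)[OF assms(5)]
      by (simp add: f_def module_hom_diff[OF assms(1,3,5)] module_minus_eq_zero_iff[OF assms(3)])
  qed
  have rep: "\<exists>a\<in>carrier A. c = p a" if "c \<in> carrier C" for c using that surj by auto
  have "f \<in> module_hom R C N"
  proof (rule module_homI)
    fix c assume "c \<in> carrier C"
    then obtain a where "a \<in> carrier A" "c = p a" using rep by meson
    then show "f c \<in> carrier N" using f module_homD(1)[OF assms(5)] by simp
  next
    fix c c' assume "c \<in> carrier C" "c' \<in> carrier C"
    then obtain a a' where "a \<in> carrier A" "a' \<in> carrier A" "c = p a" "c' = p a'" using rep by meson
    then show "f (c \<oplus>\<^bsub>C\<^esub> c') = f c \<oplus>\<^bsub>N\<^esub> f c'"
      using f module_homD(2)[OF assms(5)] by (simp flip: module_homD(2)[OF assms(4)])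
  next
    fix r c assume "r \<in> carrier R" "c \<in> carrier C"
    moreover from this obtain a where "a \<in> carrier A" "c = p a" using rep by meson
    ultimately show "f (r \<odot>\<^bsub>C\<^esub> c) = r \<odot>\<^bsub>N\<^esub> f c"
      using f module_homD(3)[OF assms(5)] by (simp flip: module_homD(3)[OF assms(4)])
  qed
  with f show ?thesis by (rule that[rotated])
qed

subsection \<open>Resolutions by finitely generated free modules\<close>

text \<open>That \<open>S\<close> generates \<open>K\<close> is expressed as minimality among
  submodules of the ambient \<open>N\<close>. It is applied to the image of the free module, which
  gives one inclusion; the other holds because the images of the basis lie in
  \<open>K\<close>.\<close>

lemma finite_generators_cover:
  assumes "module R N" "submodule K R N" "finite S" "S \<subseteq> K"
    and gen: "\<And>H. submodule H R N \<Longrightarrow> S \<subseteq> H \<Longrightarrow> K \<subseteq> H"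
  obtains n :: nat and h where "h \<in> module_hom R (free_module R {..<n}) N"
    "h ` carrier (free_module R {..<n}) = K"
proof -
  obtain x :: "nat \<Rightarrow> _" where x: "S = x ` {..<card S}"
    using ex_bij_betw_nat_finite[OF assms(3)] by (auto simp: bij_betw_def atLeast0LessThan)
  let ?F = "free_module R {..<card S}"
  note R = cring_of_module[OF assms(1)]
  note F = module_free[OF R, of "{..<card S}"]
  have xK: "x \<in> {..<card S} \<rightarrow> K" using x assms(4) by auto
  then have xN: "x \<in> {..<card S} \<rightarrow> carrier N" using submoduleD(1)[OF assms(1,2)] by auto
  note h = lincomb_hom[OF assms(1) xN]
  have "S \<subseteq> lincomb R N x ` carrier ?F"
  proof
    fix s assume "s \<in> S"
    then obtain i where i: "i < card S" "s = x i" using x by auto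
    have xi: "x i \<in> carrier N" using i(1) xN by auto
    show "s \<in> lincomb R N x ` carrier ?F"
      unfolding i(2) lincomb_basis_vec[where \<beta> = x and x = i, OF assms(1) xi, symmetric]
      by (intro imageI basis_vec_closed[OF R]) (simp add: i)
  qed
  then have "K \<subseteq> lincomb R N x ` carrier ?F"
    using image_submodule[OF F assms(1) carrier_submodule[OF F]] h by (intro gen) auto
  moreover have "lincomb R N x ` carrier ?F \<subseteq> K"
    using lincomb_submodule[OF assms(1,2) _ xK] by auto
  ultimately show ?thesis using that[OF h] by blast
qed

text \<open>Induction on the rank: the last coordinates of the elements of \<open>K\<close> form an
  ideal, and lifts of its finitely many generators together with generators of the part of
  \<open>K\<close> with last coordinate zero generate \<open>K\<close>.\<close>

lemma noetherian_submodule_generators: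
  assumes R: "cring R" "noetherian_ring R" and K: "submodule K R (free_module R {..<n::nat})"
  shows "\<exists>S. finite S \<and> S \<subseteq> K \<and>
    (\<forall>H. submodule H R (free_module R {..<n}) \<longrightarrow> S \<subseteq> H \<longrightarrow> K \<subseteq> H)"
  using K
proof (induction n arbitrary: K)
  case 0
  have "K \<subseteq> {\<zero>\<^bsub>free_module R {..<0::nat}\<^esub>}"
  proof
    fix u assume "u \<in> K"
    then have "u \<in> carrier (free_module R {..<0::nat})"
      by (rule submoduleD(1)[OF module_free[OF R(1)] 0])
    then show "u \<in> {\<zero>\<^bsub>free_module R {..<0::nat}\<^esub>}"
      by (simp add: free_module_simps fun_eq_iff)
  qed
  then have "K \<subseteq> H" if "submodule H R (free_module R {..<0::nat})" for H
    using submoduleD(2)[OF module_free[OF R(1)] that] by blast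
  then show ?case by (intro exI[of _ "{}"]) simp
next
  case (Suc n)
  interpret R: cring R by fact
  let ?F = "free_module R {..<Suc n}" and ?F' = "free_module R {..<n}"
  note F = module_free[OF R(1), of "{..<Suc n}"] and F' = module_free[OF R(1), of "{..<n}"]
  interpret F: module R ?F by (rule F)
  note K = submoduleD[OF F Suc.prems]
  \<comment> \<open>Elements of free modules are zero outside the index set, so R^n literally lies
    in R^(n+1), with the same operations.\<close>
  have ops: "\<zero>\<^bsub>?F'\<^esub> = \<zero>\<^bsub>?F\<^esub>" "(\<oplus>\<^bsub>?F'\<^esub>) = (\<oplus>\<^bsub>?F\<^esub>)" "(\<odot>\<^bsub>?F'\<^esub>) = (\<odot>\<^bsub>?F\<^esub>)"
    by (auto simp: free_module_def)
  have last: "u \<in> carrier ?F' \<longleftrightarrow> u \<in> carrier ?F \<and> u n = \<zero>\<^bsub>R\<^esub>" for u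
    by (auto simp: free_module_simps less_Suc_eq)
  have sub: "submodule (H \<inter> carrier ?F') R ?F'" if "submodule H R ?F" for H
  proof -
    interpret F': module R ?F' by (rule F')
    show ?thesis
      using submoduleD[OF F that] F'.zero_closed F'.a_closed F'.smult_closed
      by (intro module_submoduleI[OF F']) (auto simp flip: ops)
  qed
  have idl: "ideal {u n | u. u \<in> H} R" if H: "submodule H R ?F" for H
  proof (rule idealI)
    note HD = submoduleD[OF F H]
    show "ring R" by (rule R.ring_axioms)
    have "submodule {u n | u. u \<in> H} R (regular_module R)"
    proof (rule module_submoduleI[OF module_regular[OF R(1)]])
      show "{u n |u. u \<in> H} \<subseteq> carrier (regular_module R)"
        using HD(1) free_moduleD(1) by (fastforce simp: regular_module_def)
      show "\<zero>\<^bsub>regular_module R\<^esub> \<in> {u n |u. u \<in> H}"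
        using HD(2) by (force simp: regular_module_def free_module_simps)
      fix x y assume "x \<in> {u n |u. u \<in> H}" "y \<in> {u n |u. u \<in> H}"
      then obtain u v where "u \<in> H" "v \<in> H" "x = u n" "y = v n" by auto
      then show "x \<oplus>\<^bsub>regular_module R\<^esub> y \<in> {u n |u. u \<in> H}"
        using HD(3)[of u v] by (auto simp: regular_module_def free_module_simps)
    next
      fix r x assume "r \<in> carrier R" "x \<in> {u n |u. u \<in> H}"
      moreover from this obtain u where "u \<in> H" "x = u n" by auto
      ultimately show "r \<odot>\<^bsub>regular_module R\<^esub> x \<in> {u n |u. u \<in> H}"
        using HD(6)[of r u] by (auto simp: regular_module_def free_module_simps)
    qed
    from submodule.axioms(1)[OF this] show "subgroup {u n |u. u \<in> H} (add_monoid R)"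
      unfolding subgroup_def by (simp add: regular_module_def m_inv_def)
    fix a x assume a: "a \<in> {u n |u. u \<in> H}" and x: "x \<in> carrier R"
    then obtain u where u: "u \<in> H" "a = u n" by auto
    then have "x \<otimes>\<^bsub>R\<^esub> a = (x \<odot>\<^bsub>?F\<^esub> u) n" "x \<odot>\<^bsub>?F\<^esub> u \<in> H"
      using HD(6)[OF x u(1)] by (auto simp: free_module_simps)
    then show "x \<otimes>\<^bsub>R\<^esub> a \<in> {u n |u. u \<in> H}" by auto
    moreover have "a \<otimes>\<^bsub>R\<^esub> x = x \<otimes>\<^bsub>R\<^esub> a"
      using x u HD(1)[OF u(1)] free_moduleD(1) by (metis R.m_comm)
    ultimately show "a \<otimes>\<^bsub>R\<^esub> x \<in> {u n |u. u \<in> H}" by simp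
  qed
  obtain A where A: "A \<subseteq> carrier R" "finite A" "{u n | u. u \<in> K} = Idl\<^bsub>R\<^esub> A"
    using noetherian_ring.finetely_gen[OF R(2) idl[OF Suc.prems]] by blast
  have "\<exists>w. w \<in> K \<and> w n = a" if "a \<in> A" for a
  proof -
    have "a \<in> {u n | u. u \<in> K}" unfolding A(3) using that R.genideal_self[OF A(1)] by blast
    then show ?thesis by blast
  qed
  then obtain w where w: "\<And>a. a \<in> A \<Longrightarrow> w a \<in> K \<and> w a n = a" by metis
  from Suc.IH[OF sub[OF Suc.prems]] obtain S where S: "finite S \<and> S \<subseteq> K \<inter> carrier ?F' \<and>
    (\<forall>H. submodule H R ?F' \<longrightarrow> S \<subseteq> H \<longrightarrow> K \<inter> carrier ?F' \<subseteq> H)" by (rule exE)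
  show ?case
  proof (intro exI[of _ "w ` A \<union> S"] conjI allI impI)
    show "finite (w ` A \<union> S)" using A(2) S by simp
    show "w ` A \<union> S \<subseteq> K" using S w by blast
    fix H assume H: "submodule H R ?F" and wS: "w ` A \<union> S \<subseteq> H"
    note HD = submoduleD[OF F H]
    \<comment> \<open>Passing to the intersection with \<open>K\<close> makes the element v found
      below lie in \<open>K\<close>, so that u - v stays in \<open>K\<close>.\<close>
    have HK: "submodule (H \<inter> K) R ?F"
      using HD K by (intro module_submoduleI[OF F]) auto
    have K': "K \<inter> carrier ?F' \<subseteq> H \<inter> carrier ?F'"
      using S sub[OF H] wS by blast
    show "K \<subseteq> H"
    proof
      fix u assume u: "u \<in> K"
      have "A \<subseteq> {v n | v. v \<in> H \<inter> K}"
      proof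
        fix a assume "a \<in> A"
        then have "w a \<in> H \<inter> K" "a = w a n" using w wS by auto
        then show "a \<in> {v n | v. v \<in> H \<inter> K}" by blast
      qed
      \<comment> \<open>The last coordinates of elements common to \<open>H\<close> and
        \<open>K\<close> form an ideal containing the generators, hence contain the last coordinate
        of u. Subtracting v clears it, and u - v falls under the induction hypothesis.\<close>
      then have "Idl\<^bsub>R\<^esub> A \<subseteq> {v n | v. v \<in> H \<inter> K}" by (rule R.genideal_minimal[OF idl[OF HK]])
      then obtain v where v: "v \<in> H" "v \<in> K" "u n = v n" using A(3) u by blast
      have "(u \<ominus>\<^bsub>?F\<^esub> v) n = u n \<oplus>\<^bsub>R\<^esub> (\<ominus>\<^bsub>R\<^esub> \<one>\<^bsub>R\<^esub>) \<otimes>\<^bsub>R\<^esub> v n"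
        using K(1)[OF u] K(1)[OF v(2)] by (simp add: minus_as_smult[OF F] free_module_simps)
      also have "\<dots> = \<zero>\<^bsub>R\<^esub>"
        using v(3) free_moduleD(1)[OF K(1)[OF v(2)]] by (simp add: R.l_minus R.r_neg)
      finally have "u \<ominus>\<^bsub>?F\<^esub> v \<in> H"
        using K' K(1)[OF K(5)[OF u v(2)]] K(5)[OF u v(2)] last by blast
      from HD(3)[OF this v(1)] show "u \<in> H"
        using K(1)[OF u] K(1)[OF v(2)] by (simp add: a_minus_def F.a_assoc F.l_neg)
    qed
  qed
qed

lemma free_cover_of_kernel:
  assumes "noetherian_ring R" "module R N" "d \<in> module_hom R (free_module R {..<n::nat}) N"
  shows "\<exists>q d'. d' \<in> module_hom R (free_module R {..<q::nat}) (free_module R {..<n}) \<and>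
    d' ` carrier (free_module R {..<q}) = {u \<in> carrier (free_module R {..<n}). d u = \<zero>\<^bsub>N\<^esub>}"
proof -
  note R = cring_of_module[OF assms(2)]
  note F = module_free[OF R, of "{..<n}"]
  have K: "submodule {u \<in> carrier (free_module R {..<n}). d u = \<zero>\<^bsub>N\<^esub>} R (free_module R {..<n})"
    using kernel_submodule[OF F assms(2) carrier_submodule[OF F]] assms(3) by simp
  from noetherian_submodule_generators[OF R assms(1) K]
  obtain S where "finite S" "S \<subseteq> {u \<in> carrier (free_module R {..<n}). d u = \<zero>\<^bsub>N\<^esub>}"
    "\<And>H. submodule H R (free_module R {..<n}) \<Longrightarrow> S \<subseteq> H \<Longrightarrow>
      {u \<in> carrier (free_module R {..<n}). d u = \<zero>\<^bsub>N\<^esub>} \<subseteq> H" by auto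
  from finite_generators_cover[OF F K this]
  obtain q :: nat and h where "h \<in> module_hom R (free_module R {..<q}) (free_module R {..<n})"
    "h ` carrier (free_module R {..<q}) = {u \<in> carrier (free_module R {..<n}). d u = \<zero>\<^bsub>N\<^esub>}" .
  then show ?thesis by blast
qed

subsection \<open>Homology\<close>

abbreviation cycles :: "('r, 'm) cpx \<Rightarrow> int \<Rightarrow> 'm set" where
  "cycles X i \<equiv> {x \<in> carrier (cobj X i). cdiff X i x = \<zero>\<^bsub>cobj X (i - 1)\<^esub>}"

abbreviation boundaries :: "('r, 'm) cpx \<Rightarrow> int \<Rightarrow> 'm set" where
  "boundaries X i \<equiv> cdiff X (i + 1) ` carrier (cobj X (i + 1))"

lemma chain_cpxD:
  assumes "chain_cpx R X"
  shows "module R (cobj X i)" "cdiff X i \<in> module_hom R (cobj X i) (cobj X (i - 1))"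
    "x \<in> carrier (cobj X (i + 1)) \<Longrightarrow> cdiff X i (cdiff X (i + 1) x) = \<zero>\<^bsub>cobj X (i - 1)\<^esub>"
proof -
  show "module R (cobj X i)" "cdiff X i \<in> module_hom R (cobj X i) (cobj X (i - 1))"
    using assms unfolding chain_cpx_def by blast+
  assume "x \<in> carrier (cobj X (i + 1))"
  moreover have "\<forall>x\<in>carrier (cobj X (i + 1)). cdiff X (i + 1 - 1) (cdiff X (i + 1) x) = \<zero>\<^bsub>cobj X (i + 1 - 2)\<^esub>"
    using assms unfolding chain_cpx_def by blast
  ultimately show "cdiff X i (cdiff X (i + 1) x) = \<zero>\<^bsub>cobj X (i - 1)\<^esub>" by simp
qed

lemma
  assumes "chain_cpx R X"
  shows cycles_submodule: "submodule (cycles X i) R (cobj X i)"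
    and boundaries_submodule: "submodule (boundaries X i) R (cobj X i)"
    and boundaries_in_cycles: "boundaries X i \<subseteq> cycles X i"
proof -
  note X = chain_cpxD[OF assms]
  show "submodule (cycles X i) R (cobj X i)"
    using kernel_submodule[OF X(1,1) carrier_submodule[OF X(1)], of "cdiff X i"] X(2) by simp
  have d: "cdiff X (i + 1) \<in> module_hom R (cobj X (i + 1)) (cobj X i)" using X(2)[of "i + 1"] by simp
  then show "submodule (boundaries X i) R (cobj X i)"
    using image_submodule[OF X(1,1) carrier_submodule[OF X(1)], of "cdiff X (i + 1)"] by simp
  show "boundaries X i \<subseteq> cycles X i"
  proof
    fix x assume "x \<in> boundaries X i"
    then obtain y where "y \<in> carrier (cobj X (i + 1))" "x = cdiff X (i + 1) y" by blast
    then show "x \<in> cycles X i" using X(3) module_homD(1)[OF d] by simp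
  qed
qed

lemma a_kernel_eq: "a_kernel A B f = {x \<in> carrier A. f x = \<zero>\<^bsub>B\<^esub>}"
  by (simp add: a_kernel_def kernel_def)

lemma homology_eq: "homology X i = quotient_module (cobj X i\<lparr>carrier := cycles X i\<rparr>) (boundaries X i)"
  unfolding homology_def a_kernel_eq ..

lemma boundaries_submodule_cycles:
  assumes "chain_cpx R X"
  shows "submodule (boundaries X i) R (cobj X i\<lparr>carrier := cycles X i\<rparr>)"
proof -
  note B = submoduleD[OF chain_cpxD(1)[OF assms] boundaries_submodule[OF assms]]
  note X = module_restrict[OF chain_cpxD(1)[OF assms] cycles_submodule[OF assms]]
  show ?thesis
  proof (rule module_submoduleI[OF X])
    show "boundaries X i \<subseteq> carrier (cobj X i\<lparr>carrier := cycles X i\<rparr>)"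
      using boundaries_in_cycles[OF assms] by simp
  qed (use B in simp_all)
qed

lemma trivial_homology_iff:
  assumes "chain_cpx R X"
  shows "trivial_module (homology X i) \<longleftrightarrow> boundaries X i = cycles X i"
  unfolding homology_eq
  by (subst trivial_quotient_iff[OF module_restrict[OF chain_cpxD(1)[OF assms] cycles_submodule[OF assms]]
        boundaries_submodule_cycles[OF assms]]) simp

text \<open>Quotients disappear from here on: homology is identified by a surjection from the cycles
  whose kernel is the set of boundaries, and isomorphisms are used and produced in this
  form.\<close>

lemma isomorphic_homology_iff:
  assumes "chain_cpx R X" "module R L"
  shows "isomorphic_modules R (homology X i) L \<longleftrightarrow>
    (\<exists>\<pi>\<in>module_hom R (cobj X i\<lparr>carrier := cycles X i\<rparr>) L. \<pi> ` cycles X i = carrier L \<and>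
      {x \<in> cycles X i. \<pi> x = \<zero>\<^bsub>L\<^esub>} = boundaries X i)"
  unfolding homology_eq
  by (subst isomorphic_quotient_iff[OF module_restrict[OF chain_cpxD(1)[OF assms(1)] cycles_submodule[OF assms(1)]]
        boundaries_submodule_cycles[OF assms(1)] assms(2)]) simp

section \<open>Sums and homomorphisms of powers\<close>

lemma finsum_regular_module:
  "finsum (regular_module R) f S = finsum R f S"
  by (simp add: finsum_def finprod_def regular_module_def comp_def)

lemma module_Hom_eval:
  assumes "z \<in> carrier A"
  shows "(\<lambda>f. f z) \<in> module_hom R (Hom_module R A B) B"
  using assms Hom_moduleD(2) by (intro module_homI) (auto simp: Hom_module_simps(3,4))

lemma module_power_proj:
  assumes "k < n"
  shows "(\<lambda>x. x k) \<in> module_hom R (power_module L n) L"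
  using assms by (intro module_homI) (auto simp: power_module_simps)

definition unit_tuple :: "('r, 'm) module \<Rightarrow> nat \<Rightarrow> nat \<Rightarrow> 'm \<Rightarrow> nat \<Rightarrow> 'm" where
  "unit_tuple L n k w = (\<lambda>i\<in>{..<n}. if i = k then w else \<zero>\<^bsub>L\<^esub>)"

lemma unit_tuple_hom:
  assumes "module R L"
  shows "unit_tuple L n k \<in> module_hom R L (power_module L n)"
proof -
  interpret L: module R L by fact
  show ?thesis
    by (intro module_homI) (auto simp: power_module_simps unit_tuple_def fun_eq_iff)
qed

lemma power_module_decomp:
  fixes R :: "'r ring"
  assumes "module R L" "z \<in> carrier (power_module L n)"
  shows "z = (\<Oplus>\<^bsub>power_module L n\<^esub>k\<in>{..<n}. unit_tuple L n k (z k))" (is "z = ?s")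
proof -
  interpret L: module R L by fact
  interpret P: module R "power_module L n" by (rule module_power) fact
  have z: "z k \<in> carrier L" if "k < n" for k using assms(2) that by (auto simp: power_module_simps)
  have u: "(\<lambda>k. unit_tuple L n k (z k)) \<in> {..<n} \<rightarrow> carrier (power_module L n)"
    using z module_homD(1)[OF unit_tuple_hom[OF assms(1)]] by auto
  have s: "?s \<in> carrier (power_module L n)" using u by (rule P.finsum_closed)
  have "?s i = z i" if i: "i < n" for i
  proof -
    have "?s i = (\<Oplus>\<^bsub>L\<^esub>k\<in>{..<n}. unit_tuple L n k (z k) i)"
      by (rule finsum_module_hom[OF P.module_axioms assms(1) module_power_proj[OF i] u])
    also have "\<dots> = (\<Oplus>\<^bsub>L\<^esub>k\<in>{..<n}. if i = k then z k else \<zero>\<^bsub>L\<^esub>)"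
      using i z by (intro L.finsum_cong') (auto simp: unit_tuple_def)
    also have "\<dots> = z i" using i z by (intro L.finsum_singleton) auto
    finally show ?thesis .
  qed
  then show ?thesis using assms(2) s unfolding power_module_simps
    by (intro PiE_ext[of z "{..<n}" "\<lambda>_. carrier L"]) auto
qed

lemma power_tuple_hom:
  assumes "\<And>k. k < n \<Longrightarrow> g k \<in> module_hom R A L"
  shows "(\<lambda>a. \<lambda>k\<in>{..<n}. g k a) \<in> module_hom R A (power_module L n)"
  using module_homD[OF assms] by (intro module_homI) (auto simp: power_module_simps fun_eq_iff)

lemma power_sum_hom:
  assumes "module R N" "module R X" and h: "\<And>l. l < q \<Longrightarrow> h l \<in> module_hom R N X"
  shows "(\<lambda>y. \<Oplus>\<^bsub>X\<^esub>l\<in>{..<q}. h l (y l)) \<in> module_hom R (power_module N q) X"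
proof (rule module_homI)
  interpret X: module R X by fact
  fix z assume "z \<in> carrier (power_module N q)"
  then have z: "z l \<in> carrier N" if "l < q" for l using that by (auto simp: power_module_simps)
  note hz = module_homD(1)[OF h z]
  show "(\<Oplus>\<^bsub>X\<^esub>l\<in>{..<q}. h l (z l)) \<in> carrier X" using hz by (intro X.finsum_closed) auto
  {
    fix w assume "w \<in> carrier (power_module N q)"
    then have w: "w l \<in> carrier N" if "l < q" for l using that by (auto simp: power_module_simps)
    note hw = module_homD(1)[OF h w]
    have "(\<Oplus>\<^bsub>X\<^esub>l\<in>{..<q}. h l ((z \<oplus>\<^bsub>power_module N q\<^esub> w) l))
        = (\<Oplus>\<^bsub>X\<^esub>l\<in>{..<q}. h l (z l) \<oplus>\<^bsub>X\<^esub> h l (w l))"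
      using hz hw z w module_homD(2)[OF h] by (intro X.finsum_cong') (auto simp: power_module_simps)
    also have "\<dots> = (\<Oplus>\<^bsub>X\<^esub>l\<in>{..<q}. h l (z l)) \<oplus>\<^bsub>X\<^esub> (\<Oplus>\<^bsub>X\<^esub>l\<in>{..<q}. h l (w l))"
      using hz hw by (intro X.finsum_addf) auto
    finally show "(\<Oplus>\<^bsub>X\<^esub>l\<in>{..<q}. h l ((z \<oplus>\<^bsub>power_module N q\<^esub> w) l))
      = (\<Oplus>\<^bsub>X\<^esub>l\<in>{..<q}. h l (z l)) \<oplus>\<^bsub>X\<^esub> (\<Oplus>\<^bsub>X\<^esub>l\<in>{..<q}. h l (w l))" .
  }
  fix r assume r: "r \<in> carrier R"
  have "(\<Oplus>\<^bsub>X\<^esub>l\<in>{..<q}. h l ((r \<odot>\<^bsub>power_module N q\<^esub> z) l)) = (\<Oplus>\<^bsub>X\<^esub>l\<in>{..<q}. r \<odot>\<^bsub>X\<^esub> h l (z l))"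
    using hz z r module_homD(3)[OF h] by (intro X.finsum_cong') (auto simp: power_module_simps)
  also have "\<dots> = r \<odot>\<^bsub>X\<^esub> (\<Oplus>\<^bsub>X\<^esub>l\<in>{..<q}. h l (z l))"
    using hz r by (intro X.finsum_smult_ldistr[symmetric]) auto
  finally show "(\<Oplus>\<^bsub>X\<^esub>l\<in>{..<q}. h l ((r \<odot>\<^bsub>power_module N q\<^esub> z) l))
    = r \<odot>\<^bsub>X\<^esub> (\<Oplus>\<^bsub>X\<^esub>l\<in>{..<q}. h l (z l))" .
qed

lemma smult_hom:
  assumes "module R N" "r \<in> carrier R"
  shows "(\<lambda>y. r \<odot>\<^bsub>N\<^esub> y) \<in> module_hom R N N"
proof -
  interpret N: module R N by fact
  show ?thesis
    using assms(2) by (intro module_homI) (auto simp: N.smult_r_distr intro: smult_left_commute[OF assms(1)])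
qed

lemma mact_power_hom:
  fixes R :: "'r ring"
  assumes "module R N" "\<And>k l. A k l \<in> carrier R"
  shows "(\<lambda>z. \<lambda>k\<in>{..<p}. mact N A q z k) \<in> module_hom R (power_module N q) (power_module N p)"
  unfolding mact_def
  by (intro power_tuple_hom power_sum_hom[OF assms(1,1)] smult_hom[OF assms(1)] assms(2))

text \<open>Transposition under the pairing of Hom(C, E)^p with C^p that sums the values g_k(z_k): a
  matrix on the side of \<open>C\<close> becomes the transposed matrix on the side of Hom(C, E).
  This turns statements on Hom(P, C) into statements on P (x) Hom(C, E).\<close>

lemma mact_adjoint:
  assumes "module R C" "module R E" "\<And>k l. A k l \<in> carrier R"
    and z: "z \<in> {..<q} \<rightarrow> carrier C" and g: "g \<in> {..<p} \<rightarrow> carrier (Hom_module R C E)"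
  shows "(\<Oplus>\<^bsub>E\<^esub>k\<in>{..<p}. g k (mact C A q z k))
    = (\<Oplus>\<^bsub>E\<^esub>l\<in>{..<q}. mact (Hom_module R C E) (\<lambda>l k. A k l) p g l (z l))"
proof -
  interpret E: module R E by fact
  have gz: "g k (z l) \<in> carrier E" if "k < p" "l < q" for k l
    using that g z Hom_moduleD(2)[of "g k" R C E] by auto
  have "(\<Oplus>\<^bsub>E\<^esub>k\<in>{..<p}. g k (mact C A q z k))
      = (\<Oplus>\<^bsub>E\<^esub>k\<in>{..<p}. \<Oplus>\<^bsub>E\<^esub>l\<in>{..<q}. A k l \<odot>\<^bsub>E\<^esub> g k (z l))"
  proof (intro E.finsum_cong' refl)
    fix k assume "k \<in> {..<p}"
    then have "g k \<in> module_hom R C E" using g by (blast intro: Hom_moduleD(1))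
    then show "g k (mact C A q z k) = (\<Oplus>\<^bsub>E\<^esub>l\<in>{..<q}. A k l \<odot>\<^bsub>E\<^esub> g k (z l))"
      using mact_module_hom[OF assms(1,2) _ assms(3) z] by (simp add: mact_def)
  qed (use gz assms(3) in \<open>auto intro!: E.finsum_closed\<close>)
  also have "\<dots> = (\<Oplus>\<^bsub>E\<^esub>l\<in>{..<q}. \<Oplus>\<^bsub>E\<^esub>k\<in>{..<p}. A k l \<odot>\<^bsub>E\<^esub> g k (z l))"
    using gz assms(3) by (intro finsum_swap[OF assms(2)]) auto
  also have "\<dots> = (\<Oplus>\<^bsub>E\<^esub>l\<in>{..<q}. mact (Hom_module R C E) (\<lambda>l k. A k l) p g l (z l))"
  proof (intro E.finsum_cong' refl)
    fix l assume "l \<in> {..<q}"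
    then have "z l \<in> carrier C" using z by auto
    then show "(\<Oplus>\<^bsub>E\<^esub>k\<in>{..<p}. A k l \<odot>\<^bsub>E\<^esub> g k (z l)) = mact (Hom_module R C E) (\<lambda>l k. A k l) p g l (z l)"
      using mact_module_hom[where A = "\<lambda>l k. A k l" and k = l, OF module_Hom[OF assms(1,2)] assms(2)
        module_Hom_eval[OF \<open>z l \<in> carrier C\<close>] assms(3) g]
      by (simp add: mact_def)
  next
    show "(\<lambda>l. mact (Hom_module R C E) (\<lambda>l k. A k l) p g l (z l)) \<in> {..<q} \<rightarrow> carrier E"
    proof
      fix l assume "l \<in> {..<q}"
      then have "z l \<in> carrier C" using z by auto
      then show "mact (Hom_module R C E) (\<lambda>l k. A k l) p g l (z l) \<in> carrier E"
        by (rule Hom_moduleD(2)[OF mact_closed[OF module_Hom[OF assms(1,2)] assms(3) g]])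
    qed
  qed
  finally show ?thesis .
qed

section \<open>Extension of maps into injective modules\<close>

text \<open>A copy of \<open>B\<close> along an injection, needed because
  \<open>injective_module\<close> tests only modules with elements in one fixed type.\<close>

definition transport_module :: "('b \<Rightarrow> 't) \<Rightarrow> ('r, 'b) module \<Rightarrow> ('r, 't) module" where
  "transport_module \<iota> B = \<lparr>carrier = \<iota> ` carrier B, monoid.mult = undefined, monoid.one = undefined,
     ring.zero = \<iota> \<zero>\<^bsub>B\<^esub>,
     ring.add = (\<lambda>x y. \<iota> (inv_into (carrier B) \<iota> x \<oplus>\<^bsub>B\<^esub> inv_into (carrier B) \<iota> y)),
     smult = (\<lambda>r x. \<iota> (r \<odot>\<^bsub>B\<^esub> inv_into (carrier B) \<iota> x))\<rparr>"

text \<open>Extension along a map that need not be injective: since \<open>\<phi>\<close> vanishes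
  on the kernel of j it descends to the image j(A), and injectivity is applied to the inclusion of
  j(A) into \<open>B\<close>, after both are copied into the test type. Only \<open>B\<close> has to
  fit into that type.\<close>

lemma injective_module_extend:
  fixes E :: "('r, 'i) module" and B :: "('r, 'b) module" and A :: "('r, 'a) module"
    and \<iota> :: "'b \<Rightarrow> ((nat \<Rightarrow> 'r) + 'i) set"
  assumes E: "injective_module R E" and A: "module R A" and B: "module R B"
    and \<iota>: "inj_on \<iota> (carrier B)"
    and j: "j \<in> module_hom R A B" and \<phi>: "\<phi> \<in> module_hom R A E"
    and ker: "\<And>a. a \<in> carrier A \<Longrightarrow> j a = \<zero>\<^bsub>B\<^esub> \<Longrightarrow> \<phi> a = \<zero>\<^bsub>E\<^esub>"
  obtains g where "g \<in> module_hom R B E" "\<And>a. a \<in> carrier A \<Longrightarrow> g (j a) = \<phi> a"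
proof -
  interpret B: module R B by fact
  have mE: "module R E" using E by (simp add: injective_module_def)
  let ?T = "transport_module \<iota> B" and ?K = "j ` carrier A"
  let ?B = "B\<lparr>carrier := ?K\<rparr>"
  have K: "submodule ?K R B"
    using image_submodule[OF A B carrier_submodule[OF A]] j by simp
  note KD = submoduleD[OF B K]
  have inv: "inv_into (carrier B) \<iota> (\<iota> x) = x" if "x \<in> carrier B" for x
    using \<iota> that by simp
  have T: "module R ?T"
    by (rule module_transport[OF B, of \<iota>]) (auto simp: transport_module_def inv)
  have \<iota>_hom: "\<iota> \<in> module_hom R B ?T"
    by (rule module_homI) (auto simp: transport_module_def inv)
  then have \<iota>_hom': "\<iota> \<in> module_hom R ?B ?T" by (rule module_hom_restrict[OF B K])
  have K': "submodule (\<iota> ` ?K) R ?T" by (rule image_submodule[OF B T K \<iota>_hom'])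
  let ?T' = "?T\<lparr>carrier := \<iota> ` ?K\<rparr>"
  have "j \<in> module_hom R A ?B" using j by (auto simp: module_hom_def)
  then obtain h where h: "h \<in> module_hom R ?B E" "\<And>a. a \<in> carrier A \<Longrightarrow> h (j a) = \<phi> a"
    using hom_factor[OF A module_restrict[OF B K] mE _ \<phi>] ker by auto
  define f where "f = (\<lambda>t. h (inv_into (carrier B) \<iota> t))"
  have f: "f (\<iota> x) = h x" if "x \<in> ?K" for x using inv KD(1)[OF that] by (simp add: f_def)
  have f_hom: "f \<in> module_hom R ?T' E"
  proof (rule module_homI)
    fix t assume "t \<in> carrier ?T'"
    then obtain x where x: "x \<in> ?K" "t = \<iota> x" by auto
    then show "f t \<in> carrier E" using f module_homD(1)[OF h(1)] by simp
    {
      fix s assume "s \<in> carrier ?T'"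
      then obtain y where y: "y \<in> ?K" "s = \<iota> y" by auto
      have "t \<oplus>\<^bsub>?T'\<^esub> s = \<iota> (x \<oplus>\<^bsub>B\<^esub> y)"
        using x y KD(1) inv by (simp add: transport_module_def)
      then show "f (t \<oplus>\<^bsub>?T'\<^esub> s) = f t \<oplus>\<^bsub>E\<^esub> f s"
        using x y f KD(3) module_homD(2)[OF h(1)] by simp
    }
    fix r assume r: "r \<in> carrier R"
    have "r \<odot>\<^bsub>?T'\<^esub> t = \<iota> (r \<odot>\<^bsub>B\<^esub> x)"
      using x KD(1) inv by (simp add: transport_module_def)
    then show "f (r \<odot>\<^bsub>?T'\<^esub> t) = r \<odot>\<^bsub>E\<^esub> f t"
      using x f KD(6) r module_homD(3)[OF h(1)] by simp
  qed
  have "id \<in> module_hom R ?T' ?T" "inj_on id (carrier ?T')"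
    using submoduleD(1)[OF T K'] by (auto simp: module_hom_def)
  with E T module_restrict[OF T K'] f_hom
  obtain g where g: "g \<in> module_hom R ?T E" "\<forall>t\<in>carrier ?T'. g (id t) = f t"
    unfolding injective_module_def by blast
  show ?thesis
  proof (rule that)
    show "(\<lambda>x. g (\<iota> x)) \<in> module_hom R B E" by (rule module_hom_comp[OF \<iota>_hom g(1)])
    fix a assume a: "a \<in> carrier A"
    then have "\<iota> (j a) \<in> carrier ?T'" by simp
    then show "g (\<iota> (j a)) = \<phi> a" using g(2) f h(2) a by simp
  qed
qed

subsection \<open>Presentations\<close>

text \<open>The content of \<open>fg_free_resolution\<close> on elements, with the ranks
  \<open>n\<close>, the differential and the augmentation \<open>e\<close> as parameters, so that
  matrices can be read off.\<close>

locale presentation = cring R for R :: "'r ring" (structure) +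
  fixes C :: "('r, 'c) module" and n :: "int \<Rightarrow> nat"
    and d :: "int \<Rightarrow> (nat \<Rightarrow> 'r) \<Rightarrow> nat \<Rightarrow> 'r" and e :: "(nat \<Rightarrow> 'r) \<Rightarrow> 'c"
  assumes C: "module R C"
    and n_neg: "i < 0 \<Longrightarrow> n i = 0"
    and d_hom: "d i \<in> module_hom R (free_module R {..<n i}) (free_module R {..<n (i - 1)})"
    and d_d: "u \<in> carrier (free_module R {..<n (i + 1)}) \<Longrightarrow> d i (d (i + 1) u) = (\<lambda>_. \<zero>)"
    and d_exact: "0 < i \<Longrightarrow> u \<in> carrier (free_module R {..<n i}) \<Longrightarrow> d i u = (\<lambda>_. \<zero>) \<Longrightarrow>
      u \<in> d (i + 1) ` carrier (free_module R {..<n (i + 1)})"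
    and e_hom: "e \<in> module_hom R (free_module R {..<n 0}) C"
    and e_surj: "e ` carrier (free_module R {..<n 0}) = carrier C"
    and e_d: "u \<in> carrier (free_module R {..<n 1}) \<Longrightarrow> e (d 1 u) = \<zero>\<^bsub>C\<^esub>"
    and e_exact: "u \<in> carrier (free_module R {..<n 0}) \<Longrightarrow> e u = \<zero>\<^bsub>C\<^esub> \<Longrightarrow>
      u \<in> d 1 ` carrier (free_module R {..<n 1})"
begin

abbreviation F where "F i \<equiv> free_module R {..<n i}"

lemma module_F: "module R (free_module R X)" by (rule module_free) (rule cring_axioms)

lemma basis_F: "l < n i \<Longrightarrow> basis_vec R l \<in> carrier (F i)"
  by (rule basis_vec_closed[OF cring_axioms]) simp

lemma d_closed: "u \<in> carrier (F i) \<Longrightarrow> d i u \<in> carrier (F (i - 1))"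
  by (rule module_homD(1)[OF d_hom])

text \<open>Column \<open>l\<close> is the image of the l-th basis vector. Columns beyond the rank
  are set to zero, so that the entries lie in \<open>R\<close> for all indices.\<close>

definition B :: "int \<Rightarrow> nat \<Rightarrow> nat \<Rightarrow> 'r" where
  "B j k l = (if l < n j then d j (basis_vec R l) k else \<zero>)"

lemma B_closed: "B j k l \<in> carrier R"
  using free_moduleD(1)[OF d_closed[OF basis_F]] by (auto simp: B_def)

lemma d_matrix:
  assumes u: "u \<in> carrier (F j)"
  shows "d j u k = (\<Oplus>l\<in>{..<n j}. u l \<otimes> B j k l)"
proof -
  let ?R = "regular_module R"
  have R: "module R ?R" by (rule module_regular) (rule cring_axioms)
  have "(\<lambda>u. d j u k) \<in> module_hom R (F j) ?R"
    using module_homD(2,3)[OF d_hom[of j]] free_moduleD(1)[OF d_closed]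
    by (intro module_homI) (simp_all add: regular_module_def free_module_simps(3,4))
  from hom_eq_lincomb[OF R this u]
  have "d j u k = lincomb R ?R (\<lambda>l. d j (basis_vec R l) k) u" .
  also have "\<dots> = (\<Oplus>\<^bsub>?R\<^esub>l\<in>{..<n j}. u l \<odot>\<^bsub>?R\<^esub> d j (basis_vec R l) k)"
    using free_moduleD(1)[OF d_closed[OF basis_F]]
    by (intro lincomb_lessThan[OF R u]) (auto simp: regular_module_def)
  also have "\<dots> = (\<Oplus>l\<in>{..<n j}. u l \<otimes> d j (basis_vec R l) k)"
    by (simp add: finsum_regular_module) (simp add: regular_module_def)
  also have "\<dots> = (\<Oplus>l\<in>{..<n j}. u l \<otimes> B j k l)"
  proof (rule finsum_cong'[OF refl])
    show "(\<lambda>l. u l \<otimes> B j k l) \<in> {..<n j} \<rightarrow> carrier R"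
      using B_closed free_moduleD(1)[OF u] by simp
  qed (simp add: B_def)
  finally show ?thesis .
qed

lemma B_B:
  assumes "l < n (j + 1)"
  shows "(\<Oplus>k\<in>{..<n j}. B (j + 1) k l \<otimes> B j i k) = \<zero>"
proof -
  have u: "d (j + 1) (basis_vec R l) \<in> carrier (F j)"
    using d_closed[OF basis_F[OF assms]] by simp
  have "(\<Oplus>k\<in>{..<n j}. B (j + 1) k l \<otimes> B j i k) = d j (d (j + 1) (basis_vec R l)) i"
    unfolding d_matrix[OF u] using assms by (simp add: B_def)
  also have "\<dots> = \<zero>" using d_d[OF basis_F[OF assms]] by simp
  finally show ?thesis .
qed

text \<open>\<open>ext\<close> and \<open>tor\<close> are the complexes \<open>Hom(P, -)\<close> and \<open>P \<otimes> -\<close> for the resolution \<open>P\<close>. Differentials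
  raise the degree in both, so that \<open>Tor\<^sub>i\<close> sits in degree \<open>-i\<close>.\<close>

sublocale ext: matrix_complex R n "\<lambda>j k l. B (j + 1) l k"
proof
  fix i l j assume "i < n (j + 1 + 1)"
  then show "(\<Oplus>k\<in>{..<n (j + 1)}. B (j + 1 + 1) k i \<otimes> B (j + 1) l k) = \<zero>" by (rule B_B)
qed (rule B_closed)

sublocale tor: matrix_complex R "\<lambda>j. n (- j)" "\<lambda>j. B (- j)"
proof
  fix i l j assume "l < n (- j)"
  then have l: "l < n (- (j + 1) + 1)" by simp
  have "(\<Oplus>k\<in>{..<n (- (j + 1))}. B (- (j + 1)) i k \<otimes> B (- j) k l)
      = (\<Oplus>k\<in>{..<n (- (j + 1))}. B (- (j + 1) + 1) k l \<otimes> B (- (j + 1)) i k)"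
    using B_closed by (intro finsum_cong') (auto simp: m_comm)
  also have "\<dots> = \<zero>" by (rule B_B[OF l])
  finally show "(\<Oplus>k\<in>{..<n (- (j + 1))}. B (- (j + 1)) i k \<otimes> B (- j) k l) = \<zero>" .
qed (rule B_closed)

text \<open>A tuple over \<open>N\<close> is a map on the free module, and the matrix acts by
  composing that map with the differential of the resolution.\<close>

lemma ext_D_eq:
  assumes N: "module R N" and x: "x \<in> {..<n j} \<rightarrow> carrier N" and k: "k < n (j + 1)"
  shows "ext.D N j x k = lincomb R N x (d (j + 1) (basis_vec R k))"
proof -
  have u: "d (j + 1) (basis_vec R k) \<in> carrier (F j)" using d_closed[OF basis_F[OF k]] by simp
  show ?thesis unfolding mact_def using k by (subst lincomb_lessThan[OF N u x]) (simp add: B_def)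
qed

lemma ext_D_zero:
  assumes N: "module R N" and x: "x \<in> {..<n j} \<rightarrow> carrier N"
    and z: "\<And>k. k < n (j + 1) \<Longrightarrow> ext.D N j x k = \<zero>\<^bsub>N\<^esub>" and u: "u \<in> carrier (F (j + 1))"
  shows "lincomb R N x (d (j + 1) u) = \<zero>\<^bsub>N\<^esub>"
proof (rule free_module_hom_eqI[OF N _ _ _ u, of "\<lambda>u. lincomb R N x (d (j + 1) u)" "\<lambda>u. \<zero>\<^bsub>N\<^esub>"])
  interpret N: module R N by fact
  have "d (j + 1) \<in> module_hom R (F (j + 1)) (F j)" using d_hom[of "j + 1"] by simp
  then show "(\<lambda>u. lincomb R N x (d (j + 1) u)) \<in> module_hom R (F (j + 1)) N"
    by (rule module_hom_comp) (rule lincomb_hom[OF N x])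
  show "(\<lambda>u. \<zero>\<^bsub>N\<^esub>) \<in> module_hom R (F (j + 1)) N" by (rule module_homI) auto
  fix k assume "k \<in> {..<n (j + 1)}"
  then show "lincomb R N x (d (j + 1) (basis_vec R k)) = \<zero>\<^bsub>N\<^esub>"
    using z ext_D_eq[OF N x] by simp
qed

text \<open>The generators of \<open>C\<close> coming from the basis of F 0; a map out of
  \<open>C\<close> is determined by its values on them.\<close>

definition c :: "nat \<Rightarrow> 'c" where "c l = e (basis_vec R l)"

lemma c_closed: "c \<in> {..<n 0} \<rightarrow> carrier C"
  using module_homD(1)[OF e_hom basis_F] by (auto simp: c_def)

lemma e_lincomb: "u \<in> carrier (F 0) \<Longrightarrow> e u = lincomb R C c u"
  unfolding c_def by (rule hom_eq_lincomb[OF C e_hom])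

lemma C_lincomb:
  assumes "z \<in> carrier C"
  obtains u where "u \<in> carrier (F 0)" "z = lincomb R C c u"
  using assms e_surj e_lincomb by (metis (no_types, lifting) imageE)

lemma hom_C_lincomb:
  assumes "module R N" "f \<in> module_hom R C N" "u \<in> carrier (F 0)"
  shows "f (e u) = lincomb R N (\<lambda>l. f (c l)) u"
  unfolding e_lincomb[OF assms(3)] by (rule hom_lincomb[OF C assms(1,2) c_closed assms(3)])

lemma hom_C_eqI:
  assumes "module R N" "f \<in> module_hom R C N" "g \<in> module_hom R C N"
    and "\<And>l. l < n 0 \<Longrightarrow> f (c l) = g (c l)" "z \<in> carrier C"
  shows "f z = g z"
proof -
  obtain u where u: "u \<in> carrier (F 0)" "z = e u" using assms(5) e_surj by auto
  have "f (e u) = g (e u)"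
  proof (rule free_module_hom_eqI[OF assms(1) _ _ _ u(1), of "\<lambda>u. f (e u)" "\<lambda>u. g (e u)"])
    show "(\<lambda>u. f (e u)) \<in> module_hom R (F 0) N" "(\<lambda>u. g (e u)) \<in> module_hom R (F 0) N"
      by (rule module_hom_comp[OF e_hom]; fact)+
  qed (use assms(4) in \<open>simp add: c_def\<close>)
  then show ?thesis using u(2) by simp
qed

lemma hom_C_tuple:
  assumes N: "module R N" and f: "f \<in> module_hom R C N" and k: "k < n 1"
  shows "ext.D N 0 (\<lambda>l. f (c l)) k = \<zero>\<^bsub>N\<^esub>"
proof -
  have fc: "(\<lambda>l. f (c l)) \<in> {..<n 0} \<rightarrow> carrier N" using module_homD(1)[OF f] c_closed by auto
  have u: "d 1 (basis_vec R k) \<in> carrier (F 0)" using d_closed[OF basis_F[OF k]] by simp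
  have "ext.D N 0 (\<lambda>l. f (c l)) k = f (e (d 1 (basis_vec R k)))"
    using ext_D_eq[OF N fc, of k] k hom_C_lincomb[OF N f u] by simp
  also have "\<dots> = \<zero>\<^bsub>N\<^esub>"
    using e_d[OF basis_F[OF k]] module_hom_zero[OF C N f] by simp
  finally show ?thesis .
qed

text \<open>Left exactness of Hom(-, N): the map on F 0 given by x vanishes on the image of d 1,
  which is the kernel of e, and so factors through \<open>C\<close>. The values are tracked in
  \<open>K\<close> because the maps wanted later take values in cycles.\<close>

lemma hom_C_of_tuple:
  assumes N: "module R N" and K: "submodule K R N" and x: "x \<in> {..<n 0} \<rightarrow> K"
    and z: "\<And>k. k < n 1 \<Longrightarrow> ext.D N 0 x k = \<zero>\<^bsub>N\<^esub>"
  obtains f where "f \<in> module_hom R C N" "\<And>l. l < n 0 \<Longrightarrow> f (c l) = x l"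
    "\<And>y. y \<in> carrier C \<Longrightarrow> f y \<in> K"
proof -
  have xN: "x \<in> {..<n 0} \<rightarrow> carrier N" using x submoduleD(1)[OF N K] by (simp add: Pi_iff)
  obtain f where f: "f \<in> module_hom R C N" "\<And>u. u \<in> carrier (F 0) \<Longrightarrow> f (e u) = lincomb R N x u"
  proof (rule hom_factor[OF module_F C N e_hom lincomb_hom[OF N xN] e_surj])
    fix u assume "u \<in> carrier (F 0)" "e u = \<zero>\<^bsub>C\<^esub>"
    then obtain v where "v \<in> carrier (F 1)" "u = d 1 v" using e_exact by blast
    then show "lincomb R N x u = \<zero>\<^bsub>N\<^esub>" using ext_D_zero[OF N xN, of v] z by simp
  qed (use that in blast)
  show ?thesis
  proof (rule that[OF f(1)])
    fix l assume l: "l < n 0"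
    then have "x l \<in> carrier N" using xN by auto
    then show "f (c l) = x l"
      using f(2)[OF basis_F[OF l]] lincomb_basis_vec[OF N, of x l] by (simp add: c_def)
  next
    fix y assume "y \<in> carrier C"
    then obtain u where "u \<in> carrier (F 0)" "y = e u" using e_surj by auto
    then show "f y \<in> K" using f(2) lincomb_submodule[OF N K _ x] by simp
  qed
qed

text \<open>Vanishing of Ext^1(C, ker g) makes Hom(C, K) -> Hom(C, g(K)) onto. The values of
  \<open>\<gamma>\<close> on the generators are lifted one by one, and the lifts are then corrected
  so that they satisfy the relations of \<open>C\<close>.\<close>

lemma hom_C_lift:
  assumes N: "module R N" and L: "module R L" and K: "submodule K R N"
    and g: "g \<in> module_hom R (N\<lparr>carrier := K\<rparr>) L"
    and ex: "ext.exact_at N {x \<in> K. g x = \<zero>\<^bsub>L\<^esub>} 1"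
    and \<gamma>: "\<gamma> \<in> module_hom R C L" "\<And>y. y \<in> carrier C \<Longrightarrow> \<gamma> y \<in> g ` K"
  obtains f where "f \<in> module_hom R C N" "\<And>y. y \<in> carrier C \<Longrightarrow> f y \<in> K"
    "\<And>y. y \<in> carrier C \<Longrightarrow> g (f y) = \<gamma> y"
proof -
  note KD = submoduleD[OF N K]
  have "(\<lambda>l. \<gamma> (c l)) \<in> {..<n 0} \<rightarrow> g ` K" using \<gamma>(2) c_closed by (simp add: Pi_iff)
  then obtain x where x: "x \<in> {..<n 0} \<rightarrow> K" "\<And>l. l < n 0 \<Longrightarrow> g (x l) = \<gamma> (c l)"
    using ext.tuple_lift[OF N L K g] by blast
  note xN = ext.ambient[OF N L K g x(1)]
  have "g (ext.D N 0 x k) = \<zero>\<^bsub>L\<^esub>" if k: "k < n 1" for k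
  proof -
    have "g (ext.D N 0 x k) = ext.D L 0 (\<lambda>l. g (x l)) k"
      by (rule ext.g_D[OF N L K g x(1)])
    also have "\<dots> = ext.D L 0 (\<lambda>l. \<gamma> (c l)) k"
      using x(2) \<gamma>(1) c_closed by (intro mact_cong[OF L B_closed]) (auto dest: module_homD(1))
    also have "\<dots> = \<zero>\<^bsub>L\<^esub>" by (rule hom_C_tuple[OF L \<gamma>(1) k])
    finally show ?thesis .
  qed
  then have Dx: "ext.D N 0 x \<in> {..<n 1} \<rightarrow> {x \<in> K. g x = \<zero>\<^bsub>L\<^esub>}"
    using ext.D_in[OF N L K g x(1)] by simp
  \<comment> \<open>Dx measures how far the lifts are from satisfying the relations. It is a cocycle
    over the kernel of g, so it equals Dw with w over that kernel, and x - w satisfies the relations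
    while having the same image under g.\<close>
  obtain w where w: "w \<in> {..<n (1 - 1)} \<rightarrow> {x \<in> K. g x = \<zero>\<^bsub>L\<^esub>}"
    "\<And>k. k < n 1 \<Longrightarrow> ext.D N 0 x k = ext.D N (1 - 1) w k"
  proof (rule ext.exact_atD[OF ex Dx])
    fix k assume "k < n (1 + 1)"
    then show "ext.D N 1 (ext.D N 0 x) k = \<zero>\<^bsub>N\<^esub>" using ext.D_D[OF N xN, of k] by simp
  qed (use that in blast)
  have w': "w \<in> {..<n 0} \<rightarrow> K" "\<And>l. l < n 0 \<Longrightarrow> g (w l) = \<zero>\<^bsub>L\<^esub>" using w(1) by auto
  note wN = ext.ambient[OF N L K g w'(1)]
  obtain f where f: "f \<in> module_hom R C N" "\<And>l. l < n 0 \<Longrightarrow> f (c l) = x l \<ominus>\<^bsub>N\<^esub> w l"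
    "\<And>y. y \<in> carrier C \<Longrightarrow> f y \<in> K"
  proof (rule hom_C_of_tuple[OF N K, of "\<lambda>l. x l \<ominus>\<^bsub>N\<^esub> w l"])
    show "(\<lambda>l. x l \<ominus>\<^bsub>N\<^esub> w l) \<in> {..<n 0} \<rightarrow> K" using x(1) w'(1) KD(5) by (simp add: Pi_iff)
    fix k assume k: "k < n 1"
    have "ext.D N 0 (\<lambda>l. x l \<ominus>\<^bsub>N\<^esub> w l) k = ext.D N 0 x k \<ominus>\<^bsub>N\<^esub> ext.D N 0 w k"
      by (rule mact_diff[OF N B_closed xN wN])
    also have "\<dots> = \<zero>\<^bsub>N\<^esub>"
      using w(2)[OF k] mact_closed[OF N B_closed wN] by (simp add: module_minus_self[OF N])
    finally show "ext.D N 0 (\<lambda>l. x l \<ominus>\<^bsub>N\<^esub> w l) k = \<zero>\<^bsub>N\<^esub>" .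
  qed (use that in blast)
  have fK: "f \<in> module_hom R C (N\<lparr>carrier := K\<rparr>)"
    using module_homD(2,3)[OF f(1)] f(3) by (intro module_homI) auto
  show ?thesis
  proof (rule that[OF f(1,3)])
    fix y assume "y \<in> carrier C"
    then show "g (f y) = \<gamma> y"
    proof (rule hom_C_eqI[OF L module_hom_comp[OF fK g] \<gamma>(1), rotated])
      fix l assume l: "l < n 0"
      have xw: "x l \<in> K" "w l \<in> K" using x(1) w'(1) l by auto
      show "g (f (c l)) = \<gamma> (c l)"
        unfolding f(2)[OF l] restricted_hom_diff[OF N L K g xw] x(2)[OF l] w'(2)[OF l]
        using module_homD(1)[OF \<gamma>(1)] c_closed l by (intro module_minus_zero[OF L]) auto
    qed
  qed auto
qed

end

section \<open>Ext on tuples, and its vanishing on injective modules\<close>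

context presentation
begin

lemma Hom_cong:
  assumes "module R N" "f \<in> carrier (Hom_module R C N)" "g \<in> carrier (Hom_module R C N)"
    and "\<And>l. l < n 0 \<Longrightarrow> f (c l) = g (c l)"
  shows "f = g"
  using hom_C_eqI[OF assms(1) Hom_moduleD(1)[OF assms(2)] Hom_moduleD(1)[OF assms(3)] assms(4)]
  by (intro Hom_module_eqI[OF assms(2,3)]) auto

context
  fixes P :: "('r, nat \<Rightarrow> 'r) cpx"
  assumes P: "cobj P = F" "cdiff P = d"
begin

lemma chain_coHom:
  assumes N: "module R N"
  shows "chain_cpx R (coHom_cpx R P N)"
  unfolding chain_cpx_def
proof (intro allI conjI ballI)
  fix i
  have FF: "module R (F j)" for j by (rule module_F)
  show "module R (cobj (coHom_cpx R P N) i)"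
    using module_Hom[OF FF N] by (simp add: coHom_cpx_def P)
  have d': "d (1 - j) \<in> module_hom R (F (1 - j)) (F (- j))" for j using d_hom[of "1 - j"] by simp
  have diff: "cdiff (coHom_cpx R P N) j f \<in> carrier (Hom_module R (F (1 - j)) N)"
    if "f \<in> carrier (Hom_module R (F (- j)) N)" for f j
    using Hom_moduleI[OF module_hom_comp[OF d' Hom_moduleD(1)[OF that]] FF]
    by (simp add: coHom_cpx_def P restrict_def)
  show "cdiff (coHom_cpx R P N) i \<in> module_hom R (cobj (coHom_cpx R P N) i) (cobj (coHom_cpx R P N) (i - 1))"
  proof (rule module_homI)
    fix f assume "f \<in> carrier (cobj (coHom_cpx R P N) i)"
    then show "cdiff (coHom_cpx R P N) i f \<in> carrier (cobj (coHom_cpx R P N) (i - 1))"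
      using diff by (simp add: coHom_cpx_def P)
  qed (auto simp: coHom_cpx_def P Hom_module_simps fun_eq_iff module_homD(1)[OF d'])
  fix f assume "f \<in> carrier (cobj (coHom_cpx R P N) i)"
  then have f: "f \<in> carrier (Hom_module R (F (- i)) N)" by (simp add: coHom_cpx_def P)
  have dd: "d (- i + 1) (d (- i + 1 + 1) x) = (\<lambda>_. \<zero>)" "d (- i + 1 + 1) x \<in> carrier (F (- i + 1))"
    "d (- i + 1) (d (- i + 1 + 1) x) \<in> carrier (F (- i))" if "x \<in> carrier (F (- i + 1 + 1))" for x
    using d_d[OF that] d_closed[OF that] d_closed[OF d_closed[OF that]] by auto
  have "f (\<lambda>_. \<zero>) = \<zero>\<^bsub>N\<^esub>"
    using module_hom_zero[OF FF N Hom_moduleD(1)[OF f]] by (simp add: free_module_simps(2))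
  then show "cdiff (coHom_cpx R P N) (i - 1) (cdiff (coHom_cpx R P N) i f) = \<zero>\<^bsub>cobj (coHom_cpx R P N) (i - 2)\<^esub>"
    using dd by (simp add: coHom_cpx_def P Hom_module_simps restrict_def algebra_simps cong: if_cong)
qed

text \<open>The link between Ext as homology of Hom(P, N) and tuples: x is extended linearly to a
  cycle, and the values of a preimage on the basis vectors form the tuple wanted.\<close>

lemma ext_exact_at_of_trivial:
  assumes N: "module R N" and i: "0 < i"
    and triv: "trivial_module (homology (coHom_cpx R P N) (- i))"
  shows "ext.exact_at N (carrier N) i"
  unfolding ext.exact_at_def
proof (intro ballI impI)
  interpret N: module R N by fact
  let ?X = "coHom_cpx R P N"
  fix x assume x: "x \<in> {..<n i} \<rightarrow> carrier N" and Dx: "\<forall>k<n (i + 1). ext.D N i x k = \<zero>\<^bsub>N\<^esub>"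
  let ?\<phi> = "restrict (lincomb R N x) (carrier (F i))"
  have \<phi>: "?\<phi> \<in> carrier (Hom_module R (F i) N)"
    by (rule Hom_moduleI[OF lincomb_hom[OF N x] module_F])
  have "lincomb R N x (d (i + 1) u) = \<zero>\<^bsub>N\<^esub>" if "u \<in> carrier (F (i + 1))" for u
    by (rule ext_D_zero[OF N x _ that]) (use Dx in simp)
  moreover have "d (i + 1) u \<in> carrier (F i)" if "u \<in> carrier (F (i + 1))" for u
    using d_closed[OF that] by simp
  ultimately have "?\<phi> \<in> cycles ?X (- i)"
    using \<phi> by (simp add: coHom_cpx_def P Hom_module_simps(2) fun_eq_iff add.commute)
  then have "?\<phi> \<in> boundaries ?X (- i)"
    using triv trivial_homology_iff[OF chain_coHom[OF N]] by simp
  then obtain \<psi> where \<psi>: "\<psi> \<in> carrier (Hom_module R (F (i - 1)) N)"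
    "?\<phi> = (\<lambda>u\<in>carrier (F i). \<psi> (d i u))"
    by (auto simp: coHom_cpx_def P)
  note \<psi>h = Hom_moduleD(1)[OF \<psi>(1)]
  let ?y = "\<lambda>l. \<psi> (basis_vec R l)"
  have y: "?y \<in> {..<n (i - 1)} \<rightarrow> carrier N" using module_homD(1)[OF \<psi>h basis_F] by simp
  have "x k = ext.D N (i - 1) ?y k" if k: "k < n i" for k
  proof -
    have xk: "x k \<in> carrier N" using x k by auto
    have "x k = ?\<phi> (basis_vec R k)"
      using lincomb_basis_vec[where \<beta> = x and x = k, OF N xk] basis_F[OF k] by simp
    also have "\<dots> = \<psi> (d i (basis_vec R k))" using \<psi>(2) basis_F[OF k] by simp
    also have "\<dots> = lincomb R N ?y (d i (basis_vec R k))"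
      by (rule hom_eq_lincomb[OF N \<psi>h d_closed[OF basis_F[OF k]]])
    also have "\<dots> = ext.D N (i - 1) ?y k" using ext_D_eq[OF N y, of k] k by simp
    finally show ?thesis .
  qed
  then show "\<exists>y\<in>{..<n (i - 1)} \<rightarrow> carrier N. \<forall>k<n i. x k = ext.D N (i - 1) y k" using y by blast
qed

end

text \<open>The map on F i given by x vanishes on the image of d (i + 1), which is the kernel of d i
  for positive i; injectivity extends it along d i to F (i - 1).\<close>

lemma ext_exact_at_injective:
  fixes E :: "('r, 'i) module"
  assumes E: "injective_module R E" and i: "0 < i"
  shows "ext.exact_at E (carrier E) i"
  unfolding ext.exact_at_def
proof (intro ballI impI)
  have N: "module R E" using E by (simp add: injective_module_def)
  fix x assume x: "x \<in> {..<n i} \<rightarrow> carrier E" and Dx: "\<forall>k<n (i + 1). ext.D E i x k = \<zero>\<^bsub>E\<^esub>"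
  \<comment> \<open>Elements of the test type are sets over a sum type; tuples over \<open>R\<close>
    enter it as singletons.\<close>
  let ?\<iota> = "\<lambda>u :: nat \<Rightarrow> 'r. {Inl u :: (nat \<Rightarrow> 'r) + 'i}"
  obtain \<psi> where \<psi>: "\<psi> \<in> module_hom R (F (i - 1)) E"
    "\<And>u. u \<in> carrier (F i) \<Longrightarrow> \<psi> (d i u) = lincomb R E x u"
  proof (rule injective_module_extend[OF E module_F module_F _ d_hom lincomb_hom[OF N x]])
    show "inj_on ?\<iota> (carrier (F (i - 1)))" by (auto simp: inj_on_def)
    fix u assume u: "u \<in> carrier (F i)" "d i u = \<zero>\<^bsub>F (i - 1)\<^esub>"
    then obtain v where "v \<in> carrier (F (i + 1))" "u = d (i + 1) v"
      using d_exact[OF i u(1)] by (auto simp: free_module_simps(2))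
    then show "lincomb R E x u = \<zero>\<^bsub>E\<^esub>" using ext_D_zero[OF N x, of v] Dx by simp
  qed (use that in blast)
  let ?y = "\<lambda>l. \<psi> (basis_vec R l)"
  have y: "?y \<in> {..<n (i - 1)} \<rightarrow> carrier E" using module_homD(1)[OF \<psi>(1) basis_F] by simp
  have "x k = ext.D E (i - 1) ?y k" if k: "k < n i" for k
  proof -
    have xk: "x k \<in> carrier E" using x k by auto
    have "x k = \<psi> (d i (basis_vec R k))"
      using lincomb_basis_vec[where \<beta> = x and x = k, OF N xk] \<psi>(2)[OF basis_F[OF k]] by simp
    also have "\<dots> = lincomb R E ?y (d i (basis_vec R k))"
      by (rule hom_eq_lincomb[OF N \<psi>(1) d_closed[OF basis_F[OF k]]])
    also have "\<dots> = ext.D E (i - 1) ?y k" using ext_D_eq[OF N y, of k] k by simp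
    finally show ?thesis .
  qed
  then show "\<exists>y\<in>{..<n (i - 1)} \<rightarrow> carrier E. \<forall>k<n i. x k = ext.D E (i - 1) y k" using y by blast
qed

text \<open>Elements of \<open>C\<close> have a type unrelated to the test type. Each is coded by a
  chosen preimage in F 0, a sequence over \<open>R\<close>, and \<open>q\<close> such sequences are
  interleaved into a single one by the pairing of natural numbers.\<close>

lemma power_embedding:
  obtains \<iota> :: "(nat \<Rightarrow> 'c) \<Rightarrow> ((nat \<Rightarrow> 'r) + 'i) set" where "inj_on \<iota> (carrier (power_module C q))"
proof -
  define p where "p y = (SOME u. u \<in> carrier (F 0) \<and> e u = y)" for y
  have p: "e (p y) = y" if "y \<in> carrier C" for y
  proof -
    from that have "y \<in> e ` carrier (F 0)" by (simp add: e_surj)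
    then have "\<exists>u. u \<in> carrier (F 0) \<and> e u = y" by blast
    then show ?thesis unfolding p_def by (rule someI2_ex) simp
  qed
  let ?\<iota> = "\<lambda>z. {Inl (\<lambda>j. p (z (fst (prod_decode j))) (snd (prod_decode j))) :: (nat \<Rightarrow> 'r) + 'i}"
  have "inj_on ?\<iota> (carrier (power_module C q))"
  proof (rule inj_onI)
    fix z w assume z: "z \<in> carrier (power_module C q)" and w: "w \<in> carrier (power_module C q)"
      and eq: "?\<iota> z = ?\<iota> w"
    have "z k = w k" if k: "k < q" for k
    proof -
      have "p (z k) m = p (w k) m" for m
      proof -
        have "(\<lambda>j. p (z (fst (prod_decode j))) (snd (prod_decode j)))
          = (\<lambda>j. p (w (fst (prod_decode j))) (snd (prod_decode j)))" using eq by simp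
        from fun_cong[OF this, of "prod_encode (k, m)"] show ?thesis by simp
      qed
      then have "p (z k) = p (w k)" by blast
      moreover have "z k \<in> carrier C" "w k \<in> carrier C" using z w k by (auto simp: power_module_simps)
      ultimately show ?thesis using p by metis
    qed
    then show "z = w" using z w unfolding power_module_simps
      by (intro PiE_ext[of z "{..<q}" "\<lambda>_. carrier C"]) auto
  qed
  then show ?thesis by (rule that)
qed

text \<open>\<open>C \<otimes> Hom(C, M)\<close> is the cokernel of \<open>Hom(C, M)\<^bsup>n 1\<^esup> \<rightarrow> Hom(C, M)\<^bsup>n 0\<^esup>\<close>. On representatives
  the evaluation map is \<open>ev\<close>, and \<open>ev_exact\<close> says that it is an isomorphism onto \<open>M\<close>.\<close>

definition ev :: "('r, 'm) module \<Rightarrow> (nat \<Rightarrow> 'c \<Rightarrow> 'm) \<Rightarrow> 'm" where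
  "ev M f = (\<Oplus>\<^bsub>M\<^esub>l\<in>{..<n 0}. f l (c l))"

definition ev_exact :: "('r, 'm) module \<Rightarrow> bool" where
  "ev_exact M \<longleftrightarrow>
     (\<forall>x\<in>carrier M. \<exists>f\<in>{..<n 0} \<rightarrow> carrier (Hom_module R C M). ev M f = x) \<and>
     (\<forall>f\<in>{..<n 0} \<rightarrow> carrier (Hom_module R C M). ev M f = \<zero>\<^bsub>M\<^esub> \<longrightarrow>
       (\<exists>h\<in>{..<n 1} \<rightarrow> carrier (Hom_module R C M).
          \<forall>k<n 0. f k = tor.D (Hom_module R C M) (- 1) h k))"

lemma ev_closed:
  assumes "module R M" "f \<in> {..<n 0} \<rightarrow> carrier (Hom_module R C M)"
  shows "ev M f \<in> carrier M"
proof -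
  interpret M: module R M by fact
  have "f l (c l) \<in> carrier M" if "l < n 0" for l
  proof -
    have "f l \<in> carrier (Hom_module R C M)" "c l \<in> carrier C" using that assms(2) c_closed by auto
    then show ?thesis by (rule Hom_moduleD(2))
  qed
  then show ?thesis unfolding ev_def by (intro M.finsum_closed) auto
qed

lemma ev_cong:
  assumes "module R M" "f \<in> {..<n 0} \<rightarrow> carrier (Hom_module R C M)" "\<And>l. l < n 0 \<Longrightarrow> g l = f l"
  shows "ev M g = ev M f"
proof -
  interpret M: module R M by fact
  have "f l (c l) \<in> carrier M" if "l < n 0" for l
  proof -
    have "f l \<in> carrier (Hom_module R C M)" "c l \<in> carrier C" using that assms(2) c_closed by auto
    then show ?thesis by (rule Hom_moduleD(2))
  qed
  then show ?thesis unfolding ev_def using assms(3) by (intro M.finsum_cong') auto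
qed

text \<open>Transposing moves the matrix to the generators, where it produces the elements e(d 1 u)
  = 0 of \<open>C\<close>.\<close>

lemma ev_D:
  assumes M: "module R M" and h: "h \<in> {..<n 1} \<rightarrow> carrier (Hom_module R C M)"
  shows "ev M (tor.D (Hom_module R C M) (- 1) h) = \<zero>\<^bsub>M\<^esub>"
proof -
  interpret M: module R M by fact
  have "ev M (tor.D (Hom_module R C M) (- 1) h)
      = (\<Oplus>\<^bsub>M\<^esub>k\<in>{..<n 1}. h k (mact C (\<lambda>k l. B 1 l k) (n 0) c k))"
    unfolding ev_def
    using mact_adjoint[OF C M _ c_closed h, of "\<lambda>k l. B 1 l k"] B_closed by simp
  also have "\<dots> = (\<Oplus>\<^bsub>M\<^esub>k\<in>{..<n 1}. \<zero>\<^bsub>M\<^esub>)"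
  proof (intro M.finsum_cong' refl)
    fix k assume k: "k \<in> {..<n 1}"
    then have hk: "h k \<in> module_hom R C M" using h by (blast intro: Hom_moduleD(1))
    have u: "d 1 (basis_vec R k) \<in> carrier (F 0)" using d_closed[OF basis_F, of k 1] k by simp
    have "mact C (\<lambda>k l. B 1 l k) (n 0) c k = e (d 1 (basis_vec R k))"
      using ext_D_eq[OF C c_closed, of k] k e_lincomb[OF u] by simp
    then show "h k (mact C (\<lambda>k l. B 1 l k) (n 0) c k) = \<zero>\<^bsub>M\<^esub>"
      using e_d[OF basis_F, of k] k module_hom_zero[OF C M hk] by simp
  qed auto
  finally show ?thesis by simp
qed

lemma ev_diff:
  assumes M: "module R M" and f: "f \<in> {..<n 0} \<rightarrow> carrier (Hom_module R C M)"
    and g: "g \<in> {..<n 0} \<rightarrow> carrier (Hom_module R C M)"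
  shows "ev M (\<lambda>l. f l \<ominus>\<^bsub>Hom_module R C M\<^esub> g l) = ev M f \<ominus>\<^bsub>M\<^esub> ev M g"
proof -
  interpret M: module R M by fact
  let ?H = "Hom_module R C M"
  have H: "module R ?H" by (rule module_Hom[OF C M])
  have m: "\<ominus> \<one> \<in> carrier R" by simp
  have cl: "f l (c l) \<in> carrier M" "g l (c l) \<in> carrier M" if "l < n 0" for l
  proof -
    have "f l \<in> carrier ?H" "g l \<in> carrier ?H" "c l \<in> carrier C" using that f g c_closed by auto
    then show "f l (c l) \<in> carrier M" "g l (c l) \<in> carrier M" by (auto intro: Hom_moduleD(2))
  qed
  have "ev M (\<lambda>l. f l \<ominus>\<^bsub>?H\<^esub> g l)
      = (\<Oplus>\<^bsub>M\<^esub>l\<in>{..<n 0}. f l (c l) \<oplus>\<^bsub>M\<^esub> (\<ominus> \<one>) \<odot>\<^bsub>M\<^esub> g l (c l))"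
    unfolding ev_def
  proof (intro M.finsum_cong' refl)
    fix l assume l: "l \<in> {..<n 0}"
    then have "f l \<in> carrier ?H" "g l \<in> carrier ?H" "c l \<in> carrier C" using f g c_closed by auto
    then show "(f l \<ominus>\<^bsub>?H\<^esub> g l) (c l) = f l (c l) \<oplus>\<^bsub>M\<^esub> (\<ominus> \<one>) \<odot>\<^bsub>M\<^esub> g l (c l)"
      by (simp add: minus_as_smult[OF H] Hom_module_simps(3,4))
  qed (use cl m in \<open>auto intro!: M.a_closed M.smult_closed\<close>)
  also have "\<dots> = ev M f \<oplus>\<^bsub>M\<^esub> (\<Oplus>\<^bsub>M\<^esub>l\<in>{..<n 0}. (\<ominus> \<one>) \<odot>\<^bsub>M\<^esub> g l (c l))"
    unfolding ev_def using cl m by (intro M.finsum_addf) (auto intro!: M.smult_closed)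
  also have "(\<Oplus>\<^bsub>M\<^esub>l\<in>{..<n 0}. (\<ominus> \<one>) \<odot>\<^bsub>M\<^esub> g l (c l)) = (\<ominus> \<one>) \<odot>\<^bsub>M\<^esub> ev M g"
    unfolding ev_def using cl m by (intro M.finsum_smult_ldistr[symmetric]) auto
  finally show ?thesis
    using ev_closed[OF M f] ev_closed[OF M g] by (simp add: minus_as_smult[OF M])
qed

subsection \<open>Injective modules over a semidualizing module\<close>

context
  fixes E :: "('r, 'i) module"
  assumes E: "injective_module R E"
begin

abbreviation (input) J where "J \<equiv> Hom_module R C E"

lemma module_E: "module R E" using E by (simp add: injective_module_def)

lemma pairing_hom:
  assumes g: "g \<in> {..<q} \<rightarrow> carrier J"
  shows "(\<lambda>z. \<Oplus>\<^bsub>E\<^esub>l\<in>{..<q}. g l (z l)) \<in> module_hom R (power_module C q) E"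
  using g by (intro power_sum_hom[OF C module_E]) (blast intro: Hom_moduleD(1))

lemma power_hom_as_pairing:
  assumes H: "H \<in> module_hom R (power_module C q) E"
  obtains h where "h \<in> {..<q} \<rightarrow> carrier J"
    "\<And>z. z \<in> carrier (power_module C q) \<Longrightarrow> H z = (\<Oplus>\<^bsub>E\<^esub>k\<in>{..<q}. h k (z k))"
proof -
  interpret E: module R E by (rule module_E)
  let ?P = "power_module C q"
  let ?h = "\<lambda>k. restrict (\<lambda>w. H (unit_tuple C q k w)) (carrier C)"
  have h: "?h k \<in> carrier J" for k
    by (rule Hom_moduleI[OF module_hom_comp[OF unit_tuple_hom[OF C] H] C])
  show ?thesis
  proof (rule that[of ?h])
    show "?h \<in> {..<q} \<rightarrow> carrier J" using h by simp
    fix z assume z: "z \<in> carrier ?P"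
    then have zk: "z k \<in> carrier C" if "k < q" for k using that by (auto simp: power_module_simps)
    have u: "(\<lambda>k. unit_tuple C q k (z k)) \<in> {..<q} \<rightarrow> carrier ?P"
      using zk module_homD(1)[OF unit_tuple_hom[OF C]] by simp
    have "H z = H (\<Oplus>\<^bsub>?P\<^esub>k\<in>{..<q}. unit_tuple C q k (z k))"
      using power_module_decomp[OF C z] by simp
    also have "\<dots> = (\<Oplus>\<^bsub>E\<^esub>k\<in>{..<q}. H (unit_tuple C q k (z k)))"
      by (rule finsum_module_hom[OF module_power[OF C] module_E H u])
    also have "\<dots> = (\<Oplus>\<^bsub>E\<^esub>k\<in>{..<q}. ?h k (z k))"
    proof (intro E.finsum_cong' refl)
      show "(\<lambda>k. ?h k (z k)) \<in> {..<q} \<rightarrow> carrier E" using Hom_moduleD(2)[OF h zk] by simp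
    qed (use zk in simp)
    finally show "H z = (\<Oplus>\<^bsub>E\<^esub>k\<in>{..<q}. ?h k (z k))" .
  qed
qed

lemma pairing_unit_tuple:
  assumes g: "g \<in> {..<q} \<rightarrow> carrier J" and l: "l < q" and w: "w \<in> carrier C"
  shows "(\<Oplus>\<^bsub>E\<^esub>k\<in>{..<q}. g k (unit_tuple C q l w k)) = g l w"
proof -
  interpret E: module R E by (rule module_E)
  have gk: "g k \<in> module_hom R C E" if "k < q" for k using that g by (blast intro: Hom_moduleD(1))
  have "(\<Oplus>\<^bsub>E\<^esub>k\<in>{..<q}. g k (unit_tuple C q l w k)) = (\<Oplus>\<^bsub>E\<^esub>k\<in>{..<q}. if l = k then g k w else \<zero>\<^bsub>E\<^esub>)"
    using module_homD(1)[OF gk w] module_hom_zero[OF C module_E gk]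
    by (intro E.finsum_cong') (auto simp: unit_tuple_def)
  also have "\<dots> = g l w"
    using l module_homD(1)[OF gk w] by (intro E.finsum_singleton) auto
  finally show ?thesis .
qed

lemma ext_D_power_hom:
  "(\<lambda>z. \<lambda>k\<in>{..<n (i + 1)}. ext.D C i z k) \<in> module_hom R (power_module C (n i)) (power_module C (n (i + 1)))"
  by (rule mact_power_hom[OF C B_closed])

text \<open>\<open>Hom(-, E)\<close> is exact at the middle of \<open>C\<^bsup>n (i - 1)\<^esup> \<rightarrow> C\<^bsup>n i\<^esup> \<rightarrow> C\<^bsup>n (i + 1)\<^esup>\<close>.\<close>

lemma pairing_factor:
  assumes g: "g \<in> {..<n i} \<rightarrow> carrier J"
    and kill: "\<And>z. z \<in> {..<n i} \<rightarrow> carrier C \<Longrightarrow> (\<And>k. k < n (i + 1) \<Longrightarrow> ext.D C i z k = \<zero>\<^bsub>C\<^esub>) \<Longrightarrow>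
      (\<Oplus>\<^bsub>E\<^esub>l\<in>{..<n i}. g l (z l)) = \<zero>\<^bsub>E\<^esub>"
  obtains h where "h \<in> {..<n (i + 1)} \<rightarrow> carrier J" "\<And>l. l < n i \<Longrightarrow> g l = tor.D J (- (i + 1)) h l"
proof -
  interpret E: module R E by (rule module_E)
  let ?G = "\<lambda>z. \<Oplus>\<^bsub>E\<^esub>l\<in>{..<n i}. g l (z l)"
  let ?j = "\<lambda>z. \<lambda>k\<in>{..<n (i + 1)}. ext.D C i z k"
  have Jm: "module R J" by (rule module_Hom[OF C module_E])
  obtain \<iota> :: "(nat \<Rightarrow> 'c) \<Rightarrow> ((nat \<Rightarrow> 'r) + 'i) set"
    where \<iota>: "inj_on \<iota> (carrier (power_module C (n (i + 1))))" by (rule power_embedding)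
  \<comment> \<open>The extension is taken along the matrix C^(n i) -> C^(n (i + 1)), which need not
    be injective; \<open>kill\<close> is exactly the vanishing on its kernel.\<close>
  obtain H where H: "H \<in> module_hom R (power_module C (n (i + 1))) E"
    "\<And>z. z \<in> carrier (power_module C (n i)) \<Longrightarrow> H (?j z) = ?G z"
  proof (rule injective_module_extend[OF E module_power[OF C] module_power[OF C] \<iota>
        ext_D_power_hom pairing_hom[OF g]])
    fix z assume z: "z \<in> carrier (power_module C (n i))"
      and jz: "?j z = \<zero>\<^bsub>power_module C (n (i + 1))\<^esub>"
    have "ext.D C i z k = \<zero>\<^bsub>C\<^esub>" if "k < n (i + 1)" for k
      using fun_cong[OF jz, of k] that by (simp add: power_module_simps)
    then show "?G z = \<zero>\<^bsub>E\<^esub>" using z by (intro kill) (auto simp: power_module_simps)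
  qed (use that in blast)
  obtain h where h: "h \<in> {..<n (i + 1)} \<rightarrow> carrier J"
    "\<And>z. z \<in> carrier (power_module C (n (i + 1))) \<Longrightarrow> H z = (\<Oplus>\<^bsub>E\<^esub>k\<in>{..<n (i + 1)}. h k (z k))"
    by (rule power_hom_as_pairing[OF H(1)]) blast
  have "g l = tor.D J (- (i + 1)) h l" if l: "l < n i" for l
  proof (rule Hom_module_eqI)
    show "g l \<in> carrier J" using g l by auto
    \<comment> \<open>The tensor complex is indexed by negative degrees, so the length of its tuples
      is \<open>n\<close> at a double negative.\<close>
    have h': "h \<in> {..<n (- (- (i + 1)))} \<rightarrow> carrier J"
      using h(1) by (simp only: group_add_class.minus_minus)
    show Dh: "tor.D J (- (i + 1)) h l \<in> carrier J" by (rule mact_closed[OF Jm B_closed h'])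
    fix w assume w: "w \<in> carrier C"
    let ?u = "unit_tuple C (n i) l w"
    have u: "?u \<in> carrier (power_module C (n i))" by (rule module_homD(1)[OF unit_tuple_hom[OF C] w])
    then have u': "?u \<in> {..<n i} \<rightarrow> carrier C" by (auto simp: power_module_simps)
    have "g l w = ?G ?u" using pairing_unit_tuple[OF g l w] by simp
    also have "\<dots> = H (?j ?u)" using H(2)[OF u] by simp
    also have "\<dots> = (\<Oplus>\<^bsub>E\<^esub>k\<in>{..<n (i + 1)}. h k (?j ?u k))"
      by (rule h(2)[OF module_homD(1)[OF ext_D_power_hom u]])
    also have "\<dots> = (\<Oplus>\<^bsub>E\<^esub>k\<in>{..<n (i + 1)}. h k (ext.D C i ?u k))"
    proof (intro E.finsum_cong' refl)
      show "(\<lambda>k. h k (ext.D C i ?u k)) \<in> {..<n (i + 1)} \<rightarrow> carrier E"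
      proof
        fix k assume "k \<in> {..<n (i + 1)}"
        then have "h k \<in> carrier J" using h(1) by auto
        then show "h k (ext.D C i ?u k) \<in> carrier E"
          by (rule Hom_moduleD(2)) (rule mact_closed[OF C B_closed u'])
      qed
    qed simp
    also have "\<dots> = (\<Oplus>\<^bsub>E\<^esub>m\<in>{..<n i}. mact J (B (i + 1)) (n (i + 1)) h m (?u m))"
      by (rule mact_adjoint[OF C module_E B_closed u' h(1)])
    also have "\<dots> = mact J (B (i + 1)) (n (i + 1)) h l w"
      using mact_closed[OF Jm B_closed h(1)] by (intro pairing_unit_tuple l w) simp
    finally show "g l w = tor.D J (- (i + 1)) h l w" by (simp only: group_add_class.minus_minus)
  qed
  with h(1) show ?thesis by (rule that)
qed

text \<open>Tor_i(C, Hom(C, E)) is the dual Hom(Ext^i(C, C), E): the pairing with a cycle g vanishes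
  on boundaries by transposition, hence on all cycles since Ext^i(C, C) = 0, and a functional
  vanishing on the cycles comes from the next power of \<open>C\<close>.\<close>

lemma tor_exact_at_Hom_injective:
  assumes ex: "ext.exact_at C (carrier C) i" and i: "0 < i"
  shows "tor.exact_at J (carrier J) (- i)"
  unfolding tor.exact_at_def
proof (intro ballI impI)
  interpret E: module R E by (rule module_E)
  fix g assume g: "g \<in> {..<n (- (- i))} \<rightarrow> carrier J"
    and Dg: "\<forall>k<n (- (- i + 1)). tor.D J (- i) g k = \<zero>\<^bsub>J\<^esub>"
  have g': "g \<in> {..<n i} \<rightarrow> carrier J" using g by simp
  obtain h where h: "h \<in> {..<n (i + 1)} \<rightarrow> carrier J" "\<And>l. l < n i \<Longrightarrow> g l = tor.D J (- (i + 1)) h l"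
  proof (rule pairing_factor[OF g'])
    fix z assume z: "z \<in> {..<n i} \<rightarrow> carrier C" and Dz: "\<And>k. k < n (i + 1) \<Longrightarrow> ext.D C i z k = \<zero>\<^bsub>C\<^esub>"
    obtain y where y: "y \<in> {..<n (i - 1)} \<rightarrow> carrier C" "\<And>k. k < n i \<Longrightarrow> z k = ext.D C (i - 1) y k"
    proof (rule ext.exact_atD[OF ex z])
      show "ext.D C i z k = \<zero>\<^bsub>C\<^esub>" if "k < n (i + 1)" for k using that by (rule Dz)
    qed (use that in blast)
    have gk: "g k (ext.D C (i - 1) y k) \<in> carrier E" if "k < n i" for k
    proof -
      have "g k \<in> carrier J" using g' that by auto
      then show ?thesis by (rule Hom_moduleD(2)) (rule mact_closed[OF C B_closed y(1)])
    qed
    have "(\<Oplus>\<^bsub>E\<^esub>l\<in>{..<n i}. g l (z l)) = (\<Oplus>\<^bsub>E\<^esub>k\<in>{..<n i}. g k (ext.D C (i - 1) y k))"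
      using y(2) gk by (intro E.finsum_cong') auto
    also have "\<dots> = (\<Oplus>\<^bsub>E\<^esub>l\<in>{..<n (i - 1)}. mact J (B i) (n i) g l (y l))"
      using mact_adjoint[OF C module_E _ y(1) g', of "\<lambda>k l. B i l k"] B_closed by simp
    also have "\<dots> = (\<Oplus>\<^bsub>E\<^esub>l\<in>{..<n (i - 1)}. \<zero>\<^bsub>E\<^esub>)"
    proof (intro E.finsum_cong' refl)
      fix l assume l: "l \<in> {..<n (i - 1)}"
      then have "y l \<in> carrier C" using y(1) by auto
      moreover have "mact J (B i) (n i) g l = \<zero>\<^bsub>J\<^esub>" using Dg[rule_format, of l] l by simp
      ultimately show "mact J (B i) (n i) g l (y l) = \<zero>\<^bsub>E\<^esub>" by (simp add: Hom_module_simps(2))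
    qed auto
    finally show "(\<Oplus>\<^bsub>E\<^esub>l\<in>{..<n i}. g l (z l)) = \<zero>\<^bsub>E\<^esub>" by simp
  qed (use that in blast)
  have "- i - 1 = - (i + 1)" by simp
  then show "\<exists>y\<in>{..<n (- (- i - 1))} \<rightarrow> carrier J. \<forall>k<n (- (- i)). g k = tor.D J (- i - 1) y k"
    using h by (intro bexI[of _ h]) (simp_all add: add.commute)
qed

text \<open>The same duality in degree zero: C (x) Hom(C, E) is Hom(Hom(C, C), E), and Hom(C, C) is
  \<open>R\<close> by the homothety map.\<close>

lemma ev_exact_injective:
  assumes hty: "homothety R C \<in> module_iso R (regular_module R) (Hom_module R C C)"
  shows "ev_exact E"
  unfolding ev_exact_def
proof (intro conjI ballI impI)
  interpret E: module R E by (rule module_E)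
  interpret C: module R C by (rule C)
  let ?R = "regular_module R"
  have R: "module R ?R" by (rule module_regular) (rule cring_axioms)
  have hty_hom: "homothety R C \<in> module_hom R ?R (Hom_module R C C)"
    and hty_inj: "inj_on (homothety R C) (carrier R)"
    and hty_surj: "homothety R C ` carrier R = carrier (Hom_module R C C)"
    using hty by (auto simp: module_iso_def bij_betw_def regular_module_def)
  have cl: "c l \<in> carrier C" if "l < n 0" for l using that c_closed by auto
  {
    fix x assume x: "x \<in> carrier E"
    \<comment> \<open>\<open>R\<close> embeds into C^(n 0) by r -> (r c_0, r c_1, ...). The map r ->
      r x on \<open>R\<close> is extended along this embedding, and evaluating the extension at the
      image of 1 exhibits x as a value of \<open>ev\<close>.\<close>
    let ?j = "\<lambda>r. \<lambda>l\<in>{..<n 0}. r \<odot>\<^bsub>C\<^esub> c l"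
    have j: "?j \<in> module_hom R ?R (power_module C (n 0))"
      using cl by (intro module_homI)
        (auto simp: regular_module_def power_module_simps fun_eq_iff C.smult_l_distr C.smult_assoc1)
    have \<phi>: "(\<lambda>r. r \<odot>\<^bsub>E\<^esub> x) \<in> module_hom R ?R E"
      using x by (intro module_homI) (auto simp: regular_module_def E.smult_l_distr E.smult_assoc1)
    obtain \<iota> :: "(nat \<Rightarrow> 'c) \<Rightarrow> ((nat \<Rightarrow> 'r) + 'i) set"
      where \<iota>: "inj_on \<iota> (carrier (power_module C (n 0)))" by (rule power_embedding)
    obtain H where H: "H \<in> module_hom R (power_module C (n 0)) E"
      "\<And>r. r \<in> carrier ?R \<Longrightarrow> H (?j r) = r \<odot>\<^bsub>E\<^esub> x"
    proof (rule injective_module_extend[OF E R module_power[OF C] \<iota> j \<phi>])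
      fix r assume "r \<in> carrier ?R" and jr: "?j r = \<zero>\<^bsub>power_module C (n 0)\<^esub>"
      then have r: "r \<in> carrier R" by (simp add: regular_module_def)
      \<comment> \<open>A scalar that kills the generators acts as zero on \<open>C\<close>, and the
        homothety map is injective, so the embedding of \<open>R\<close> has zero kernel.\<close>
      have "homothety R C r = homothety R C \<zero>"
      proof (rule Hom_cong[OF C])
        show "homothety R C r \<in> carrier (Hom_module R C C)" "homothety R C \<zero> \<in> carrier (Hom_module R C C)"
          using r hty_surj by auto
        fix l assume l: "l < n 0"
        show "homothety R C r (c l) = homothety R C \<zero> (c l)"
          using fun_cong[OF jr, of l] l cl by (simp add: homothety_def power_module_simps)
      qed
      then have "r = \<zero>" using hty_inj r by (auto dest: inj_onD)
      then show "r \<odot>\<^bsub>E\<^esub> x = \<zero>\<^bsub>E\<^esub>" using x by simp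
    qed (use that in blast)
    obtain h where h: "h \<in> {..<n 0} \<rightarrow> carrier J"
      "\<And>z. z \<in> carrier (power_module C (n 0)) \<Longrightarrow> H z = (\<Oplus>\<^bsub>E\<^esub>k\<in>{..<n 0}. h k (z k))"
      by (rule power_hom_as_pairing[OF H(1)]) blast
    have j1: "?j \<one> \<in> carrier (power_module C (n 0))"
      using module_homD(1)[OF j, of \<one>] by (simp add: regular_module_def)
    have "x = H (?j \<one>)" using H(2)[of \<one>] x by (simp add: regular_module_def)
    also have "\<dots> = (\<Oplus>\<^bsub>E\<^esub>k\<in>{..<n 0}. h k (?j \<one> k))" by (rule h(2)[OF j1])
    also have "\<dots> = ev E h"
      unfolding ev_def
    proof (intro E.finsum_cong' refl)
      fix k assume k: "k \<in> {..<n 0}"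
      then show "h k (?j \<one> k) = h k (c k)" using cl by simp
    next
      show "(\<lambda>k. h k (c k)) \<in> {..<n 0} \<rightarrow> carrier E"
      proof
        fix k assume "k \<in> {..<n 0}"
        then have "h k \<in> carrier J" "c k \<in> carrier C" using h(1) cl by auto
        then show "h k (c k) \<in> carrier E" by (rule Hom_moduleD(2))
      qed
    qed
    finally show "\<exists>f\<in>{..<n 0} \<rightarrow> carrier J. ev E f = x" using h(1) by auto
  }
  fix g assume g: "g \<in> {..<n 0} \<rightarrow> carrier J" and evg: "ev E g = \<zero>\<^bsub>E\<^esub>"
  have gl: "g l \<in> module_hom R C E" if "l < n 0" for l using that g by (blast intro: Hom_moduleD(1))
  obtain h where h: "h \<in> {..<n (0 + 1)} \<rightarrow> carrier J" "\<And>l. l < n 0 \<Longrightarrow> g l = tor.D J (- (0 + 1)) h l"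
  proof (rule pairing_factor[OF g])
    fix z assume z: "z \<in> {..<n 0} \<rightarrow> carrier C" and Dz: "\<And>k. k < n (0 + 1) \<Longrightarrow> ext.D C 0 z k = \<zero>\<^bsub>C\<^esub>"
    \<comment> \<open>A tuple that satisfies the relations is an endomorphism of \<open>C\<close>,
      hence multiplication by some r. Its pairing with g is therefore r times the evaluation of g,
      which is zero.\<close>
    obtain \<gamma> where \<gamma>: "\<gamma> \<in> module_hom R C C" "\<And>l. l < n 0 \<Longrightarrow> \<gamma> (c l) = z l"
    proof (rule hom_C_of_tuple[OF C carrier_submodule[OF C] z])
      show "ext.D C 0 z k = \<zero>\<^bsub>C\<^esub>" if "k < n 1" for k using Dz[of k] that by simp
    qed (use that in blast)
    have "restrict \<gamma> (carrier C) \<in> homothety R C ` carrier R"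
      unfolding hty_surj by (rule Hom_moduleI[OF \<gamma>(1) C])
    then obtain r where r: "r \<in> carrier R" "restrict \<gamma> (carrier C) = homothety R C r" by auto
    have z': "z l = r \<odot>\<^bsub>C\<^esub> c l" if "l < n 0" for l
      using fun_cong[OF r(2), of "c l"] cl[OF that] \<gamma>(2)[OF that] by (simp add: homothety_def)
    have "(\<Oplus>\<^bsub>E\<^esub>l\<in>{..<n 0}. g l (z l)) = (\<Oplus>\<^bsub>E\<^esub>l\<in>{..<n 0}. r \<odot>\<^bsub>E\<^esub> g l (c l))"
      using module_homD(1,3)[OF gl] cl r(1) z' by (intro E.finsum_cong') auto
    also have "\<dots> = r \<odot>\<^bsub>E\<^esub> ev E g"
      unfolding ev_def using module_homD(1)[OF gl] cl r(1)
      by (intro E.finsum_smult_ldistr[symmetric]) auto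
    also have "\<dots> = \<zero>\<^bsub>E\<^esub>" using evg r(1) by simp
    finally show "(\<Oplus>\<^bsub>E\<^esub>l\<in>{..<n 0}. g l (z l)) = \<zero>\<^bsub>E\<^esub>" .
  qed (use that in blast)
  then show "\<exists>h\<in>{..<n 1} \<rightarrow> carrier J. \<forall>k<n 0. g k = tor.D J (- 1) h k"
    by (intro bexI[of _ h]) simp_all
qed

end

end

subsection \<open>Bilinear maps\<close>

definition bilinear_map ::
    "'r ring \<Rightarrow> ('r, 'a) module \<Rightarrow> ('r, 'b) module \<Rightarrow> ('r, 't) module \<Rightarrow> ('a \<Rightarrow> 'b \<Rightarrow> 't) \<Rightarrow> bool" where
  "bilinear_map R A B T \<beta> \<longleftrightarrow> (\<forall>b\<in>carrier B. (\<lambda>a. \<beta> a b) \<in> module_hom R A T) \<and>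
     (\<forall>a\<in>carrier A. \<beta> a \<in> module_hom R B T)"

lemma bilinear_mapD:
  assumes "bilinear_map R A B T \<beta>"
  shows "\<And>a b. a \<in> carrier A \<Longrightarrow> b \<in> carrier B \<Longrightarrow> \<beta> a b \<in> carrier T"
    and "\<And>a a' b. a \<in> carrier A \<Longrightarrow> a' \<in> carrier A \<Longrightarrow> b \<in> carrier B \<Longrightarrow>
      \<beta> (a \<oplus>\<^bsub>A\<^esub> a') b = \<beta> a b \<oplus>\<^bsub>T\<^esub> \<beta> a' b"
    and "\<And>a b b'. a \<in> carrier A \<Longrightarrow> b \<in> carrier B \<Longrightarrow> b' \<in> carrier B \<Longrightarrow>
      \<beta> a (b \<oplus>\<^bsub>B\<^esub> b') = \<beta> a b \<oplus>\<^bsub>T\<^esub> \<beta> a b'"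
    and "\<And>r a b. r \<in> carrier R \<Longrightarrow> a \<in> carrier A \<Longrightarrow> b \<in> carrier B \<Longrightarrow>
      \<beta> (r \<odot>\<^bsub>A\<^esub> a) b = r \<odot>\<^bsub>T\<^esub> \<beta> a b"
    and "\<And>r a b. r \<in> carrier R \<Longrightarrow> a \<in> carrier A \<Longrightarrow> b \<in> carrier B \<Longrightarrow>
      \<beta> a (r \<odot>\<^bsub>B\<^esub> b) = r \<odot>\<^bsub>T\<^esub> \<beta> a b"
proof -
  have l: "(\<lambda>a. \<beta> a b) \<in> module_hom R A T" if "b \<in> carrier B" for b
    using assms that by (simp add: bilinear_map_def)
  have r: "\<beta> a \<in> module_hom R B T" if "a \<in> carrier A" for a
    using assms that by (simp add: bilinear_map_def)
  fix a b assume a: "a \<in> carrier A" and b: "b \<in> carrier B"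
  show "\<beta> a b \<in> carrier T" by (rule module_homD(1)[OF r[OF a] b])
  show "\<beta> (a \<oplus>\<^bsub>A\<^esub> a') b = \<beta> a b \<oplus>\<^bsub>T\<^esub> \<beta> a' b" if "a' \<in> carrier A" for a'
    by (rule module_homD(2)[OF l[OF b] a that])
  show "\<beta> a (b \<oplus>\<^bsub>B\<^esub> b') = \<beta> a b \<oplus>\<^bsub>T\<^esub> \<beta> a b'" if "b' \<in> carrier B" for b'
    by (rule module_homD(2)[OF r[OF a] b that])
  show "\<beta> (r \<odot>\<^bsub>A\<^esub> a) b = r \<odot>\<^bsub>T\<^esub> \<beta> a b" if "r \<in> carrier R" for r
    by (rule module_homD(3)[OF l[OF b] that a])
  show "\<beta> a (r \<odot>\<^bsub>B\<^esub> b) = r \<odot>\<^bsub>T\<^esub> \<beta> a b" if "r \<in> carrier R" for r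
    by (rule module_homD(3)[OF r[OF a] that b])
qed

context
  fixes R :: "'r ring" and A :: "('r, 'a) module" and B :: "('r, 'b) module"
  assumes A: "module R A" and B: "module R B"
begin

abbreviation (input) FF where "FF \<equiv> free_module R (carrier A \<times> carrier B)"

abbreviation (input) TT where "TT \<equiv> tensor_product R A B"

abbreviation (input) rels where "rels \<equiv> tensor_relations R A B"

lemma module_FF: "module R FF" by (rule module_free[OF cring_of_module[OF A]])

lemma basis_FF: "a \<in> carrier A \<Longrightarrow> b \<in> carrier B \<Longrightarrow> basis_vec R (a, b) \<in> carrier FF"
  by (rule basis_vec_closed[OF cring_of_module[OF A]]) simp

lemma tensor_relations_minimal:
  assumes S: "submodule S R FF"
    and 1: "\<And>a a' b. a \<in> carrier A \<Longrightarrow> a' \<in> carrier A \<Longrightarrow> b \<in> carrier B \<Longrightarrow>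
      basis_vec R (a \<oplus>\<^bsub>A\<^esub> a', b) \<ominus>\<^bsub>FF\<^esub> (basis_vec R (a, b) \<oplus>\<^bsub>FF\<^esub> basis_vec R (a', b)) \<in> S"
    and 2: "\<And>a b b'. a \<in> carrier A \<Longrightarrow> b \<in> carrier B \<Longrightarrow> b' \<in> carrier B \<Longrightarrow>
      basis_vec R (a, b \<oplus>\<^bsub>B\<^esub> b') \<ominus>\<^bsub>FF\<^esub> (basis_vec R (a, b) \<oplus>\<^bsub>FF\<^esub> basis_vec R (a, b')) \<in> S"
    and 3: "\<And>r a b. r \<in> carrier R \<Longrightarrow> a \<in> carrier A \<Longrightarrow> b \<in> carrier B \<Longrightarrow>
      basis_vec R (r \<odot>\<^bsub>A\<^esub> a, b) \<ominus>\<^bsub>FF\<^esub> r \<odot>\<^bsub>FF\<^esub> basis_vec R (a, b) \<in> S"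
    and 4: "\<And>r a b. r \<in> carrier R \<Longrightarrow> a \<in> carrier A \<Longrightarrow> b \<in> carrier B \<Longrightarrow>
      basis_vec R (a, r \<odot>\<^bsub>B\<^esub> b) \<ominus>\<^bsub>FF\<^esub> r \<odot>\<^bsub>FF\<^esub> basis_vec R (a, b) \<in> S"
  shows "rels \<subseteq> S"
  unfolding tensor_relations_def Let_def
proof (rule submodule_span_minimal[OF S], intro Un_least subsetI; elim CollectE exE conjE)
qed (simp_all only: 1 2 3 4)

lemma tensor_relations_generators:
  shows "a \<in> carrier A \<Longrightarrow> a' \<in> carrier A \<Longrightarrow> b \<in> carrier B \<Longrightarrow>
      basis_vec R (a \<oplus>\<^bsub>A\<^esub> a', b) \<ominus>\<^bsub>FF\<^esub> (basis_vec R (a, b) \<oplus>\<^bsub>FF\<^esub> basis_vec R (a', b)) \<in> rels"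
    and "a \<in> carrier A \<Longrightarrow> b \<in> carrier B \<Longrightarrow> b' \<in> carrier B \<Longrightarrow>
      basis_vec R (a, b \<oplus>\<^bsub>B\<^esub> b') \<ominus>\<^bsub>FF\<^esub> (basis_vec R (a, b) \<oplus>\<^bsub>FF\<^esub> basis_vec R (a, b')) \<in> rels"
    and "r \<in> carrier R \<Longrightarrow> a \<in> carrier A \<Longrightarrow> b \<in> carrier B \<Longrightarrow>
      basis_vec R (r \<odot>\<^bsub>A\<^esub> a, b) \<ominus>\<^bsub>FF\<^esub> r \<odot>\<^bsub>FF\<^esub> basis_vec R (a, b) \<in> rels"
    and "r \<in> carrier R \<Longrightarrow> a \<in> carrier A \<Longrightarrow> b \<in> carrier B \<Longrightarrow>
      basis_vec R (a, r \<odot>\<^bsub>B\<^esub> b) \<ominus>\<^bsub>FF\<^esub> r \<odot>\<^bsub>FF\<^esub> basis_vec R (a, b) \<in> rels"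
  unfolding tensor_relations_def Let_def
proof (rule_tac [!] subsetD[OF submodule_span_superset])
qed (simp, metis)+

lemma tensor_relations_submodule: "submodule rels R FF"
  unfolding tensor_relations_def Let_def
proof (rule submodule_submodule_span[OF module_FF])
  interpret A: module R A by (rule A)
  interpret B: module R B by (rule B)
  interpret FF: module R FF by (rule module_FF)
  show "{basis_vec R (a \<oplus>\<^bsub>A\<^esub> a', b) \<ominus>\<^bsub>FF\<^esub> (basis_vec R (a, b) \<oplus>\<^bsub>FF\<^esub> basis_vec R (a', b)) | a a' b.
          a \<in> carrier A \<and> a' \<in> carrier A \<and> b \<in> carrier B} \<union>
       {basis_vec R (a, b \<oplus>\<^bsub>B\<^esub> b') \<ominus>\<^bsub>FF\<^esub> (basis_vec R (a, b) \<oplus>\<^bsub>FF\<^esub> basis_vec R (a, b')) | a b b'.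
          a \<in> carrier A \<and> b \<in> carrier B \<and> b' \<in> carrier B} \<union>
       {basis_vec R (r \<odot>\<^bsub>A\<^esub> a, b) \<ominus>\<^bsub>FF\<^esub> r \<odot>\<^bsub>FF\<^esub> basis_vec R (a, b) | r a b.
          r \<in> carrier R \<and> a \<in> carrier A \<and> b \<in> carrier B} \<union>
       {basis_vec R (a, r \<odot>\<^bsub>B\<^esub> b) \<ominus>\<^bsub>FF\<^esub> r \<odot>\<^bsub>FF\<^esub> basis_vec R (a, b) | r a b.
          r \<in> carrier R \<and> a \<in> carrier A \<and> b \<in> carrier B} \<subseteq> carrier FF"
    by (auto intro!: FF.minus_closed FF.a_closed FF.smult_closed basis_FF)
qed

lemma module_tensor: "module R TT"
  unfolding tensor_product_def by (rule module_quotient[OF module_FF tensor_relations_submodule])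

lemma coset_tensor_hom: "(\<lambda>u. rels +>\<^bsub>FF\<^esub> u) \<in> module_hom R FF TT"
  unfolding tensor_product_def by (rule coset_hom[OF module_FF tensor_relations_submodule])

lemma tensor_rep:
  assumes "t \<in> carrier TT"
  obtains u where "u \<in> carrier FF" "t = rels +>\<^bsub>FF\<^esub> u"
  using assms unfolding tensor_product_def
    quotient_module_coset(1)[OF module_FF tensor_relations_submodule, symmetric] by blast

lemma pure_tensor_closed: "a \<in> carrier A \<Longrightarrow> b \<in> carrier B \<Longrightarrow> pure_tensor R A B a b \<in> carrier TT"
  unfolding pure_tensor_def by (rule module_homD(1)[OF coset_tensor_hom basis_FF])

lemma pure_tensor_bilinear: "bilinear_map R A B TT (pure_tensor R A B)"
proof -
  interpret A: module R A by (rule A)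
  interpret B: module R B by (rule B)
  interpret FF: module R FF by (rule module_FF)
  note q = module_homD(2,3)[OF coset_tensor_hom]
  note eq = coset_eq_iff[OF module_FF tensor_relations_submodule, THEN iffD2]
  note gen = tensor_relations_generators
  show ?thesis
    unfolding bilinear_map_def
  proof (intro conjI ballI)
    fix b assume b: "b \<in> carrier B"
    show "(\<lambda>a. pure_tensor R A B a b) \<in> module_hom R A TT"
    proof (rule module_homI)
      show "pure_tensor R A B a b \<in> carrier TT" if "a \<in> carrier A" for a
        using that b by (rule pure_tensor_closed)
      show "pure_tensor R A B (a \<oplus>\<^bsub>A\<^esub> a') b = pure_tensor R A B a b \<oplus>\<^bsub>TT\<^esub> pure_tensor R A B a' b"
        if "a \<in> carrier A" "a' \<in> carrier A" for a a'
        unfolding pure_tensor_def 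
        by (subst q(1)[symmetric]; intro eq gen basis_FF FF.a_closed A.a_closed B.a_closed that b)
      show "pure_tensor R A B (r \<odot>\<^bsub>A\<^esub> a) b = r \<odot>\<^bsub>TT\<^esub> pure_tensor R A B a b"
        if "r \<in> carrier R" "a \<in> carrier A" for r a
        unfolding pure_tensor_def 
        by (subst q(2)[symmetric]; intro eq gen basis_FF FF.smult_closed A.smult_closed B.smult_closed that b)
    qed
  next
    fix a assume a: "a \<in> carrier A"
    show "pure_tensor R A B a \<in> module_hom R B TT"
    proof (rule module_homI)
      show "pure_tensor R A B a b \<in> carrier TT" if "b \<in> carrier B" for b
        using a that by (rule pure_tensor_closed)
      show "pure_tensor R A B a (b \<oplus>\<^bsub>B\<^esub> b') = pure_tensor R A B a b \<oplus>\<^bsub>TT\<^esub> pure_tensor R A B a b'"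
        if "b \<in> carrier B" "b' \<in> carrier B" for b b'
        unfolding pure_tensor_def 
        by (subst q(1)[symmetric]; intro eq gen basis_FF FF.a_closed A.a_closed B.a_closed that a)
      show "pure_tensor R A B a (r \<odot>\<^bsub>B\<^esub> b) = r \<odot>\<^bsub>TT\<^esub> pure_tensor R A B a b"
        if "r \<in> carrier R" "b \<in> carrier B" for r b
        unfolding pure_tensor_def 
        by (subst q(2)[symmetric]; intro eq gen basis_FF FF.smult_closed A.smult_closed B.smult_closed that a)
    qed
  qed
qed

lemma tensor_hom_eqI:
  assumes "module R X" "f \<in> module_hom R TT X" "g \<in> module_hom R TT X"
    and eq: "\<And>a b. a \<in> carrier A \<Longrightarrow> b \<in> carrier B \<Longrightarrow>
      f (pure_tensor R A B a b) = g (pure_tensor R A B a b)"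
    and t: "t \<in> carrier TT"
  shows "f t = g t"
proof -
  obtain u where u: "u \<in> carrier FF" "t = rels +>\<^bsub>FF\<^esub> u" using t by (rule tensor_rep)
  have "f (rels +>\<^bsub>FF\<^esub> u) = g (rels +>\<^bsub>FF\<^esub> u)"
  proof (rule free_module_hom_eqI[OF assms(1) _ _ _ u(1),
        of "\<lambda>u. f (rels +>\<^bsub>FF\<^esub> u)" "\<lambda>u. g (rels +>\<^bsub>FF\<^esub> u)"])
    show "(\<lambda>u. f (rels +>\<^bsub>FF\<^esub> u)) \<in> module_hom R FF X" "(\<lambda>u. g (rels +>\<^bsub>FF\<^esub> u)) \<in> module_hom R FF X"
      by (rule module_hom_comp[OF coset_tensor_hom]; fact)+
  qed (use eq in \<open>auto simp: pure_tensor_def\<close>)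
  then show ?thesis using u(2) by simp
qed

context
  fixes T :: "('r, 't) module" and \<beta> :: "'a \<Rightarrow> 'b \<Rightarrow> 't"
  assumes T: "module R T" and \<beta>: "bilinear_map R A B T \<beta>"
begin

abbreviation (input) lin where "lin \<equiv> lincomb R T (\<lambda>x. \<beta> (fst x) (snd x))"

lemma bilinear_lincomb_hom: "lin \<in> module_hom R FF T"
  using bilinear_mapD(1)[OF \<beta>] by (intro lincomb_hom[OF T]) auto

lemma bilinear_lincomb_basis:
  assumes "a \<in> carrier A" "b \<in> carrier B"
  shows "lin (basis_vec R (a, b)) = \<beta> a b"
  using lincomb_basis_vec[where \<beta> = "\<lambda>x. \<beta> (fst x) (snd x)" and x = "(a, b)", OF T]
    bilinear_mapD(1)[OF \<beta> assms] by simp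

lemma bilinear_lincomb_relations: "u \<in> rels \<Longrightarrow> lin u = \<zero>\<^bsub>T\<^esub>"
proof -
  interpret A: module R A by (rule A)
  interpret B: module R B by (rule B)
  interpret FF: module R FF by (rule module_FF)
  interpret T: module R T by (rule T)
  note \<beta>D = bilinear_mapD[OF \<beta>]
  have mem: "v \<ominus>\<^bsub>FF\<^esub> w \<in> {u \<in> carrier FF. lin u = \<zero>\<^bsub>T\<^esub>}"
    if "v \<in> carrier FF" "w \<in> carrier FF" "lin v = lin w" for v w
    using that module_homD(1)[OF bilinear_lincomb_hom]
    by (simp add: module_hom_diff[OF module_FF T bilinear_lincomb_hom] module_minus_self[OF T])
  have "rels \<subseteq> {u \<in> carrier FF. lin u = \<zero>\<^bsub>T\<^esub>}"
  proof (rule tensor_relations_minimal)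
    show "submodule {u \<in> carrier FF. lin u = \<zero>\<^bsub>T\<^esub>} R FF"
      using kernel_submodule[OF module_FF T carrier_submodule[OF module_FF]] bilinear_lincomb_hom by simp
  qed (rule mem;
      simp add: basis_FF module_homD(2,3)[OF bilinear_lincomb_hom] bilinear_lincomb_basis \<beta>D(2-5))+
  then show "u \<in> rels \<Longrightarrow> lin u = \<zero>\<^bsub>T\<^esub>" by blast
qed

text \<open>\<open>tensor_lift\<close> picks the element of the image of a coset under the linear
  extension. That extension kills the relations, so it is constant on cosets and the image is a
  singleton.\<close>

lemma tensor_lift_coset:
  assumes u: "u \<in> carrier FF"
  shows "tensor_lift R T \<beta> (rels +>\<^bsub>FF\<^esub> u) = lin u"
proof -
  interpret T: module R T by (rule T)
  note r = submoduleD[OF module_FF tensor_relations_submodule]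
  have "lin (v \<oplus>\<^bsub>FF\<^esub> u) = lin u" if "v \<in> rels" for v
    using module_homD(1,2)[OF bilinear_lincomb_hom] r(1)[OF that] u bilinear_lincomb_relations[OF that] by simp
  then have "lin ` (rels +>\<^bsub>FF\<^esub> u) = {lin u}"
    unfolding a_r_coset_def' using r(2) by (auto simp: image_UN)
  then show ?thesis unfolding tensor_lift_def lincomb_def by simp
qed

lemma tensor_lift_pure:
  assumes "a \<in> carrier A" "b \<in> carrier B"
  shows "tensor_lift R T \<beta> (pure_tensor R A B a b) = \<beta> a b"
  unfolding pure_tensor_def tensor_lift_coset[OF basis_FF[OF assms]] by (rule bilinear_lincomb_basis[OF assms])

lemma tensor_lift_hom: "tensor_lift R T \<beta> \<in> module_hom R TT T"
proof (rule module_homI)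
  interpret FF: module R FF by (rule module_FF)
  note q = module_homD(2,3)[OF coset_tensor_hom]
  note l = module_homD[OF bilinear_lincomb_hom]
  fix t assume "t \<in> carrier TT"
  then obtain u where u: "u \<in> carrier FF" "t = rels +>\<^bsub>FF\<^esub> u" by (rule tensor_rep)
  show "tensor_lift R T \<beta> t \<in> carrier T" using u l(1) by (simp add: tensor_lift_coset)
  {
    fix s assume "s \<in> carrier TT"
    then obtain v where v: "v \<in> carrier FF" "s = rels +>\<^bsub>FF\<^esub> v" by (rule tensor_rep)
    show "tensor_lift R T \<beta> (t \<oplus>\<^bsub>TT\<^esub> s) = tensor_lift R T \<beta> t \<oplus>\<^bsub>T\<^esub> tensor_lift R T \<beta> s"
      unfolding u(2) v(2) q(1)[OF u(1) v(1), symmetric]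
      using u(1) v(1) l(2) by (simp add: tensor_lift_coset)
  }
  fix r assume r: "r \<in> carrier R"
  show "tensor_lift R T \<beta> (r \<odot>\<^bsub>TT\<^esub> t) = r \<odot>\<^bsub>T\<^esub> tensor_lift R T \<beta> t"
    unfolding u(2) q(2)[OF r u(1), symmetric]
    using u(1) r l(3) by (simp add: tensor_lift_coset)
qed

end

end

section \<open>Tor on tuples\<close>

context presentation
begin

context
  fixes P :: "('r, nat \<Rightarrow> 'r) cpx" and N :: "('r, 'n) module"
  assumes P: "cobj P = F" "cdiff P = d" and N: "module R N"
begin

abbreviation (input) X where "X i \<equiv> tensor_product R (F i) N"

abbreviation (input) pt where "pt i \<equiv> pure_tensor R (F i) N"

abbreviation (input) dX where "dX i \<equiv> cdiff (tensor_cpx R P N) i"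

lemma module_X: "module R (X i)" by (rule module_tensor[OF module_F N])

lemma pt_bilinear: "bilinear_map R (F i) N (X i) (pt i)" by (rule pure_tensor_bilinear[OF module_F N])

lemma pt_d_bilinear: "bilinear_map R (F i) N (X (i - 1)) (\<lambda>p. pt (i - 1) (d i p))"
  unfolding bilinear_map_def
proof (intro conjI ballI)
  fix b assume "b \<in> carrier N"
  then have "(\<lambda>a. pt (i - 1) a b) \<in> module_hom R (F (i - 1)) (X (i - 1))"
    using pt_bilinear by (auto simp: bilinear_map_def)
  then show "(\<lambda>a. pt (i - 1) (d i a) b) \<in> module_hom R (F i) (X (i - 1))"
    by (rule module_hom_comp[OF d_hom])
next
  fix a assume "a \<in> carrier (F i)"
  then show "pt (i - 1) (d i a) \<in> module_hom R N (X (i - 1))"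
    using pt_bilinear d_closed by (auto simp: bilinear_map_def)
qed

lemma dX_eq: "dX i = tensor_lift R (X (i - 1)) (\<lambda>p. pt (i - 1) (d i p))"
  by (simp add: tensor_cpx_def P)

lemma dX_hom: "dX i \<in> module_hom R (X i) (X (i - 1))"
  unfolding dX_eq by (rule tensor_lift_hom[OF module_F N module_X pt_d_bilinear])

lemma dX_pure:
  assumes "p \<in> carrier (F i)" "y \<in> carrier N"
  shows "dX i (pt i p y) = pt (i - 1) (d i p) y"
  unfolding dX_eq by (rule tensor_lift_pure[OF module_F N module_X pt_d_bilinear assms])

lemma chain_tensor: "chain_cpx R (tensor_cpx R P N)"
  unfolding chain_cpx_def
proof (intro allI conjI ballI)
  fix i
  have ob: "cobj (tensor_cpx R P N) j = X j" for j by (simp add: tensor_cpx_def P)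
  show "module R (cobj (tensor_cpx R P N) i)" unfolding ob by (rule module_X)
  show "dX i \<in> module_hom R (cobj (tensor_cpx R P N) i) (cobj (tensor_cpx R P N) (i - 1))"
    unfolding ob by (rule dX_hom)
  fix t assume t: "t \<in> carrier (cobj (tensor_cpx R P N) i)"
  have i2: "i - 1 - 1 = i - 2" by simp
  interpret X2: module R "X (i - 2)" by (rule module_X)
  show "dX (i - 1) (dX i t) = \<zero>\<^bsub>cobj (tensor_cpx R P N) (i - 2)\<^esub>"
    unfolding ob
  proof (rule tensor_hom_eqI[OF module_F N module_X _ _ _ t[unfolded ob],
        where f = "\<lambda>t. dX (i - 1) (dX i t)" and g = "\<lambda>_. \<zero>\<^bsub>X (i - 2)\<^esub>"])
    show "(\<lambda>t. dX (i - 1) (dX i t)) \<in> module_hom R (X i) (X (i - 2))"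
      by (rule module_hom_comp[OF dX_hom dX_hom[of "i - 1", unfolded i2]])
    show "(\<lambda>_. \<zero>\<^bsub>X (i - 2)\<^esub>) \<in> module_hom R (X i) (X (i - 2))" by (rule module_homI) auto
    fix p y assume p: "p \<in> carrier (F i)" and y: "y \<in> carrier N"
    have "d (i - 1) (d (i - 1 + 1) p) = (\<lambda>_. \<zero>)" using p by (intro d_d) simp
    then have dd: "d (i - 1) (d i p) = \<zero>\<^bsub>F (i - 2)\<^esub>" by (simp add: free_module_simps(2))
    have "dX (i - 1) (dX i (pt i p y)) = pt (i - 2) (d (i - 1) (d i p)) y"
      using dX_pure[OF p y] dX_pure[OF d_closed[OF p] y] i2 by simp
    also have "\<dots> = \<zero>\<^bsub>X (i - 2)\<^esub>"
    proof -
      have "(\<lambda>a. pt (i - 2) a y) \<in> module_hom R (F (i - 2)) (X (i - 2))"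
        using pt_bilinear y by (auto simp: bilinear_map_def)
      then show ?thesis unfolding dd by (rule module_hom_zero[OF module_F module_X])
    qed
    finally show "dX (i - 1) (dX i (pt i p y)) = \<zero>\<^bsub>X (i - 2)\<^esub>" .
  qed
qed

text \<open>The coordinates of \<open>F i \<otimes> N \<cong> N\<^bsup>n i\<^esup>\<close>.\<close>

definition coord :: "int \<Rightarrow> nat \<Rightarrow> ((nat \<Rightarrow> 'r) \<times> 'n \<Rightarrow> 'r) set \<Rightarrow> 'n" where
  "coord i l = tensor_lift R N (\<lambda>p y. p l \<odot>\<^bsub>N\<^esub> y)"

lemma coord_bilinear: "bilinear_map R (F i) N N (\<lambda>p y. p l \<odot>\<^bsub>N\<^esub> y)"
proof -
  interpret N: module R N by (rule N)
  show ?thesis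
    unfolding bilinear_map_def
    by (intro conjI ballI module_homI)
      (simp_all add: free_moduleD(1) free_module_simps(3,4) N.smult_l_distr N.smult_r_distr
        N.smult_assoc1 smult_left_commute[OF N])
qed

lemma coord_hom: "coord i l \<in> module_hom R (X i) N"
  unfolding coord_def by (rule tensor_lift_hom[OF module_F N N coord_bilinear])

lemma coord_pure: "p \<in> carrier (F i) \<Longrightarrow> y \<in> carrier N \<Longrightarrow> coord i l (pt i p y) = p l \<odot>\<^bsub>N\<^esub> y"
  unfolding coord_def by (rule tensor_lift_pure[OF module_F N N coord_bilinear])

text \<open>Both sides are linear in t, so it suffices to compare them on pure tensors, where the
  left side is read off from the matrix form of d.\<close>

lemma coord_dX:
  assumes t: "t \<in> carrier (X i)" and k: "k < n (i - 1)"
  shows "coord (i - 1) k (dX i t) = mact N (B i) (n i) (\<lambda>l. coord i l t) k"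
proof (rule tensor_hom_eqI[OF module_F N N _ _ _ t])
  interpret N: module R N by (rule N)
  show "(\<lambda>t. coord (i - 1) k (dX i t)) \<in> module_hom R (X i) N"
    by (rule module_hom_comp[OF dX_hom coord_hom])
  have cl: "coord i l t \<in> carrier N" if "t \<in> carrier (X i)" for l t
    by (rule module_homD(1)[OF coord_hom that])
  have tup: "(\<lambda>t. \<lambda>l\<in>{..<n i}. coord i l t) \<in> module_hom R (X i) (power_module N (n i))"
    by (rule power_tuple_hom) (rule coord_hom)
  have "(\<lambda>t. (\<lambda>k\<in>{..<n (i - 1)}. mact N (B i) (n i) (\<lambda>l\<in>{..<n i}. coord i l t) k) k) \<in> module_hom R (X i) N"
    by (rule module_hom_comp[OF module_hom_comp[OF tup mact_power_hom[OF N B_closed]] module_power_proj[OF k]])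
  then show "(\<lambda>t. mact N (B i) (n i) (\<lambda>l. coord i l t) k) \<in> module_hom R (X i) N"
  proof (rule module_hom_cong[OF _ _ module_X])
    fix t assume "t \<in> carrier (X i)"
    then show "mact N (B i) (n i) (\<lambda>l. coord i l t) k =
      (\<lambda>k\<in>{..<n (i - 1)}. mact N (B i) (n i) (\<lambda>l\<in>{..<n i}. coord i l t) k) k"
      using k cl by (simp, intro mact_cong[OF N B_closed]) auto
  qed
  fix p y assume p: "p \<in> carrier (F i)" and y: "y \<in> carrier N"
  have pl: "p l \<in> carrier R" for l using free_moduleD(1)[OF p] .
  have "coord (i - 1) k (dX i (pt i p y)) = d i p k \<odot>\<^bsub>N\<^esub> y"
    using dX_pure[OF p y] coord_pure[OF d_closed[OF p] y] by simp
  also have "\<dots> = (\<Oplus>\<^bsub>N\<^esub>l\<in>{..<n i}. (p l \<otimes> B i k l) \<odot>\<^bsub>N\<^esub> y)"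
    unfolding d_matrix[OF p] using pl B_closed y by (intro finsum_smult_right[OF N]) auto
  also have "\<dots> = (\<Oplus>\<^bsub>N\<^esub>l\<in>{..<n i}. B i k l \<odot>\<^bsub>N\<^esub> (p l \<odot>\<^bsub>N\<^esub> y))"
    using pl B_closed y by (intro N.finsum_cong') (auto simp: N.smult_assoc1[symmetric] m_comm)
  also have "\<dots> = mact N (B i) (n i) (\<lambda>l. coord i l (pt i p y)) k"
    using coord_pure[OF p y] by (simp add: mact_def)
  finally show "coord (i - 1) k (dX i (pt i p y)) = mact N (B i) (n i) (\<lambda>l. coord i l (pt i p y)) k" .
qed

text \<open>Checked on pure tensors, by expanding the first factor in the basis. It shows that an
  element with zero coordinates is zero.\<close>

lemma coord_decomp:
  assumes t: "t \<in> carrier (X i)"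
  shows "t = (\<Oplus>\<^bsub>X i\<^esub>l\<in>{..<n i}. pt i (basis_vec R l) (coord i l t))"
proof (rule tensor_hom_eqI[OF module_F N module_X _ _ _ t])
  interpret N: module R N by (rule N)
  interpret X: module R "X i" by (rule module_X)
  show "(\<lambda>t. t) \<in> module_hom R (X i) (X i)" by (rule module_homI) auto
  have e: "pt i (basis_vec R l) \<in> module_hom R N (X i)" if "l < n i" for l
    using pt_bilinear basis_F[OF that] by (auto simp: bilinear_map_def)
  have tup: "(\<lambda>t. \<lambda>l\<in>{..<n i}. coord i l t) \<in> module_hom R (X i) (power_module N (n i))"
    by (rule power_tuple_hom) (rule coord_hom)
  have "(\<lambda>t. \<Oplus>\<^bsub>X i\<^esub>l\<in>{..<n i}. pt i (basis_vec R l) ((\<lambda>l\<in>{..<n i}. coord i l t) l)) \<in> module_hom R (X i) (X i)"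
    by (rule module_hom_comp[OF tup power_sum_hom[OF N module_X e]])
  then show "(\<lambda>t. \<Oplus>\<^bsub>X i\<^esub>l\<in>{..<n i}. pt i (basis_vec R l) (coord i l t)) \<in> module_hom R (X i) (X i)"
  proof (rule module_hom_cong[OF _ _ module_X])
    fix t assume t: "t \<in> carrier (X i)"
    show "(\<Oplus>\<^bsub>X i\<^esub>l\<in>{..<n i}. pt i (basis_vec R l) (coord i l t)) =
      (\<Oplus>\<^bsub>X i\<^esub>l\<in>{..<n i}. pt i (basis_vec R l) ((\<lambda>l\<in>{..<n i}. coord i l t) l))"
      using module_homD(1)[OF e module_homD(1)[OF coord_hom t]] by (intro X.finsum_cong') auto
  qed
  fix p y assume p: "p \<in> carrier (F i)" and y: "y \<in> carrier N"
  have h: "(\<lambda>p. pt i p y) \<in> module_hom R (F i) (X i)"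
    using pt_bilinear y by (auto simp: bilinear_map_def)
  have ey: "pt i (basis_vec R l) y \<in> carrier (X i)" if "l < n i" for l
    using module_homD(1)[OF e[OF that] y] .
  have "pt i p y = lincomb R (X i) (\<lambda>l. pt i (basis_vec R l) y) p"
    by (rule hom_eq_lincomb[OF module_X h p])
  also have "\<dots> = (\<Oplus>\<^bsub>X i\<^esub>l\<in>{..<n i}. p l \<odot>\<^bsub>X i\<^esub> pt i (basis_vec R l) y)"
    using ey by (intro lincomb_lessThan[OF module_X p]) auto
  also have "\<dots> = (\<Oplus>\<^bsub>X i\<^esub>l\<in>{..<n i}. pt i (basis_vec R l) (coord i l (pt i p y)))"
  proof (intro X.finsum_cong' refl)
    fix l assume "l \<in> {..<n i}"
    then show "p l \<odot>\<^bsub>X i\<^esub> pt i (basis_vec R l) y = pt i (basis_vec R l) (coord i l (pt i p y))"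
      using coord_pure[OF p y] module_homD(3)[OF e, of l "p l" y] y free_moduleD(1)[OF p] by simp
  next
    show "(\<lambda>l. pt i (basis_vec R l) (coord i l (pt i p y))) \<in> {..<n i} \<rightarrow> carrier (X i)"
      using coord_pure[OF p y] module_homD(1)[OF e] y free_moduleD(1)[OF p] by auto
  qed
  finally show "pt i p y = (\<Oplus>\<^bsub>X i\<^esub>l\<in>{..<n i}. pt i (basis_vec R l) (coord i l (pt i p y)))" .
qed

text \<open>The link between Tor as homology of P (x) N and tuples: x is assembled to an element of
  F i (x) N with coordinates x, which is a cycle since its boundary has zero coordinates; the
  coordinates of a preimage form the tuple wanted.\<close>

lemma tor_exact_at_of_trivial:
  assumes triv: "trivial_module (homology (tensor_cpx R P N) i)"
  shows "tor.exact_at N (carrier N) (- i)"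
  unfolding tor.exact_at_def
proof (intro ballI impI)
  interpret N: module R N by (rule N)
  interpret X: module R "X i" by (rule module_X)
  fix x assume "x \<in> {..<n (- (- i))} \<rightarrow> carrier N" and "\<forall>k<n (- (- i + 1)). tor.D N (- i) x k = \<zero>\<^bsub>N\<^esub>"
  then have x: "x \<in> {..<n i} \<rightarrow> carrier N"
    and Dx: "\<And>k. k < n (i - 1) \<Longrightarrow> mact N (B i) (n i) x k = \<zero>\<^bsub>N\<^esub>" by simp_all
  have xl: "x l \<in> carrier N" if "l < n i" for l using x that by auto
  have e: "pt j (basis_vec R l) \<in> module_hom R N (X j)" if "l < n j" for l j
    using pt_bilinear basis_F[OF that] by (auto simp: bilinear_map_def)
  let ?t = "\<Oplus>\<^bsub>X i\<^esub>l\<in>{..<n i}. pt i (basis_vec R l) (x l)"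
  have ex: "(\<lambda>l. pt i (basis_vec R l) (x l)) \<in> {..<n i} \<rightarrow> carrier (X i)"
    using module_homD(1)[OF e xl] by auto
  then have t: "?t \<in> carrier (X i)" by (rule X.finsum_closed)
  have coord_t: "coord i l ?t = x l" if l: "l < n i" for l
  proof -
    have "coord i l ?t = (\<Oplus>\<^bsub>N\<^esub>k\<in>{..<n i}. coord i l (pt i (basis_vec R k) (x k)))"
      by (rule finsum_module_hom[OF module_X N coord_hom ex])
    also have "\<dots> = (\<Oplus>\<^bsub>N\<^esub>k\<in>{..<n i}. if l = k then x k else \<zero>\<^bsub>N\<^esub>)"
      using xl coord_pure[OF basis_F xl] by (intro N.finsum_cong') (auto simp: basis_vec_def)
    also have "\<dots> = x l" using l xl by (intro N.finsum_singleton) auto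
    finally show ?thesis .
  qed
  have dt: "dX i ?t \<in> carrier (X (i - 1))" by (rule module_homD(1)[OF dX_hom t])
  interpret X': module R "X (i - 1)" by (rule module_X)
  have "coord (i - 1) k (dX i ?t) = \<zero>\<^bsub>N\<^esub>" if k: "k < n (i - 1)" for k
  proof -
    have "coord (i - 1) k (dX i ?t) = mact N (B i) (n i) (\<lambda>l. coord i l ?t) k"
      by (rule coord_dX[OF t k])
    also have "\<dots> = mact N (B i) (n i) x k" by (rule mact_cong[OF N B_closed x coord_t])
    finally show ?thesis using Dx[OF k] by simp
  qed
  then have "dX i ?t = (\<Oplus>\<^bsub>X (i - 1)\<^esub>k\<in>{..<n (i - 1)}. \<zero>\<^bsub>X (i - 1)\<^esub>)"
    using module_hom_zero[OF N module_X e]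
    by (subst coord_decomp[OF dt]) (intro X'.finsum_cong', auto)
  then have "dX i ?t = \<zero>\<^bsub>X (i - 1)\<^esub>" by simp
  then have "?t \<in> cycles (tensor_cpx R P N) i"
    using t by (simp add: tensor_cpx_def P)
  then have "?t \<in> boundaries (tensor_cpx R P N) i"
    using triv trivial_homology_iff[OF chain_tensor] by simp
  then obtain s where s: "s \<in> carrier (X (i + 1))" "?t = dX (i + 1) s"
    by (auto simp: tensor_cpx_def P)
  let ?y = "\<lambda>l. coord (i + 1) l s"
  have "x k = mact N (B (i + 1)) (n (i + 1)) ?y k" if k: "k < n i" for k
  proof -
    have "x k = coord (i + 1 - 1) k (dX (i + 1) s)" using coord_t[OF k] s(2) by simp
    also have "\<dots> = mact N (B (i + 1)) (n (i + 1)) ?y k"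
      using k by (intro coord_dX[OF s(1)]) simp
    finally show ?thesis .
  qed
  moreover have "?y \<in> {..<n (i + 1)} \<rightarrow> carrier N" using module_homD(1)[OF coord_hom s(1)] by simp
  moreover have "- (- i - 1) = i + 1" by simp
  ultimately show "\<exists>y\<in>{..<n (- (- i - 1))} \<rightarrow> carrier N. \<forall>k<n (- (- i)). x k = tor.D N (- i - 1) y k"
    by (intro bexI[of _ ?y]) (simp_all only: group_add_class.minus_minus, simp_all)
qed

end

end

section \<open>The evaluation map on representatives\<close>

context presentation
begin

lemma ev_power_hom:
  assumes "module R M"
  shows "ev M \<in> module_hom R (power_module (Hom_module R C M) (n 0)) M"
  unfolding ev_def[abs_def] using c_closed
  by (intro power_sum_hom[OF module_Hom[OF C assms] assms] module_Hom_eval) auto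

lemma restrict_power:
  "x \<in> {..<q} \<rightarrow> carrier L \<Longrightarrow> restrict x {..<q} \<in> carrier (power_module L q)"
  by (auto simp: power_module_simps)

text \<open>Right exactness of - (x) Hom(C, M) on F 1 -> F 0 -> C -> 0, carried out with formal
  sums. Surjectivity follows because the values of \<open>ev\<close> form a submodule containing all
  f(y). For injectivity a linear map from formal sums to the power of Hom(C, M) is built that sends
  the tensor relations into the image of the matrix, and the formal sum of the pairs (c_k, g_k) to g
  up to that image.\<close>

lemma ev_exact_of_evaluation:
  assumes M: "module R M"
    and iso: "evaluation_map R M \<in> module_iso R (tensor_product R C (Hom_module R C M)) M"
  shows "ev_exact M"
proof -
  let ?H = "Hom_module R C M"
  have H: "module R ?H" by (rule module_Hom[OF C M])
  interpret M: module R M by (rule M)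
  interpret H: module R ?H by (rule H)
  let ?FF = "free_module R (carrier C \<times> carrier ?H)" and ?TT = "tensor_product R C ?H"
    and ?rels = "tensor_relations R C ?H"
  have FF: "module R ?FF" by (rule module_F)
  interpret FF: module R ?FF by (rule FF)
  have TT: "module R ?TT" by (rule module_tensor[OF C H])
  have cl: "c l \<in> carrier C" if "l < n 0" for l using that c_closed by auto
  have \<beta>: "bilinear_map R C ?H M (\<lambda>y f. f y)"
    unfolding bilinear_map_def
  proof (intro conjI ballI)
    show "(\<lambda>y. f y) \<in> module_hom R C M" if "f \<in> carrier ?H" for f
      using Hom_moduleD(1)[OF that] by simp
    show "(\<lambda>f. f y) \<in> module_hom R ?H M" if "y \<in> carrier C" for y
      by (rule module_Hom_eval[OF that])
  qed
  let ?lin = "lincomb R M (\<lambda>x. snd x (fst x))"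
  have evm: "evaluation_map R M (?rels +>\<^bsub>?FF\<^esub> u) = ?lin u" if "u \<in> carrier ?FF" for u
    unfolding evaluation_map_def by (rule tensor_lift_coset[OF C H M \<beta> that])
  have ev_hom: "evaluation_map R M \<in> module_hom R ?TT M"
    and ev_inj: "inj_on (evaluation_map R M) (carrier ?TT)"
    and ev_surj: "evaluation_map R M ` carrier ?TT = carrier M"
    using iso by (auto simp: module_iso_def bij_betw_def)
  show ?thesis
    unfolding ev_exact_def
  proof (intro conjI ballI impI)
    let ?Pw = "power_module ?H (n 0)"
    have Pw: "module R ?Pw" by (rule module_power[OF H])
    let ?S = "ev M ` carrier ?Pw"
    have S: "submodule ?S R M"
      using image_submodule[OF Pw M carrier_submodule[OF Pw], of "ev M"] ev_power_hom[OF M] by simp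
    \<comment> \<open>Writing y as a combination of the generators turns f(y) into the evaluation of
      a tuple of multiples of f.\<close>
    have val: "f y \<in> ?S" if f: "f \<in> carrier ?H" and y: "y \<in> carrier C" for f y
    proof -
      obtain u where u: "u \<in> carrier (F 0)" "y = lincomb R C c u" using y by (rule C_lincomb)
      note uR = free_moduleD(1)[OF u(1)]
      have fc: "f (c l) \<in> carrier M" if "l < n 0" for l by (rule Hom_moduleD(2)[OF f cl[OF that]])
      have "f y = lincomb R M (\<lambda>l. f (c l)) u"
        using hom_C_lincomb[OF M Hom_moduleD(1)[OF f] u(1)] u(2) e_lincomb[OF u(1)] by simp
      also have "\<dots> = (\<Oplus>\<^bsub>M\<^esub>l\<in>{..<n 0}. u l \<odot>\<^bsub>M\<^esub> f (c l))"
        using fc by (intro lincomb_lessThan[OF M u(1)]) auto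
      also have "\<dots> = ev M (\<lambda>l\<in>{..<n 0}. u l \<odot>\<^bsub>?H\<^esub> f)"
        unfolding ev_def using fc uR cl by (intro M.finsum_cong') (auto simp: Hom_module_simps(4))
      finally show ?thesis
        using restrict_power[of "\<lambda>l. u l \<odot>\<^bsub>?H\<^esub> f" "n 0" ?H] H.smult_closed[OF uR f] by auto
    qed
    fix x assume "x \<in> carrier M"
    then have "x \<in> evaluation_map R M ` carrier ?TT" using ev_surj by simp
    then obtain t where t: "t \<in> carrier ?TT" "x = evaluation_map R M t" by blast
    obtain u where u: "u \<in> carrier ?FF" "t = ?rels +>\<^bsub>?FF\<^esub> u" using tensor_rep[OF C H t(1)] .
    have "?lin u \<in> ?S" using val by (intro lincomb_submodule[OF M S u(1)]) auto
    then have "x \<in> ?S" using t(2) u evm by simp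
    then obtain f where "f \<in> carrier ?Pw" "x = ev M f" by blast
    then show "\<exists>f\<in>{..<n 0} \<rightarrow> carrier ?H. ev M f = x"
      by (intro bexI[of _ f]) (auto simp: power_module_simps)
  next
    fix g assume g: "g \<in> {..<n 0} \<rightarrow> carrier ?H" and evg: "ev M g = \<zero>\<^bsub>M\<^esub>"
    have gk: "g k \<in> carrier ?H" if "k < n 0" for k using g that by auto
    \<comment> \<open>The formal sum that stands for the tensor with evaluation
      \<open>ev M g\<close>. As this vanishes, injectivity of the evaluation map puts the formal sum
      among the relations.\<close>
    let ?ut = "\<Oplus>\<^bsub>?FF\<^esub>k\<in>{..<n 0}. basis_vec R (c k, g k)"
    have bk: "basis_vec R (c k, g k) \<in> carrier ?FF" if "k < n 0" for k
      by (rule basis_FF[OF C H cl[OF that] gk[OF that]])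
    then have bk': "(\<lambda>k. basis_vec R (c k, g k)) \<in> {..<n 0} \<rightarrow> carrier ?FF" by simp
    have ut: "?ut \<in> carrier ?FF" using bk' by (rule FF.finsum_closed)
    have "?lin ?ut = (\<Oplus>\<^bsub>M\<^esub>k\<in>{..<n 0}. ?lin (basis_vec R (c k, g k)))"
      by (rule finsum_module_hom[OF FF M bilinear_lincomb_hom[OF C H M \<beta>] bk'])
    also have "\<dots> = ev M g"
      unfolding ev_def using bilinear_lincomb_basis[OF C H M \<beta> cl gk] Hom_moduleD(2)[OF gk cl]
      by (intro M.finsum_cong') auto
    finally have "evaluation_map R M (?rels +>\<^bsub>?FF\<^esub> ?ut) = evaluation_map R M \<zero>\<^bsub>?TT\<^esub>"
      using evm[OF ut] evg module_hom_zero[OF TT M ev_hom] by simp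
    then have "?rels +>\<^bsub>?FF\<^esub> ?ut = \<zero>\<^bsub>?TT\<^esub>"
      using ev_inj module_homD(1)[OF coset_tensor_hom[OF C H] ut]
        abelian_groupE(2)[OF module.axioms(2)[OF TT]] by (blast dest: inj_onD)
    then have ut_rels: "?ut \<in> ?rels"
      using coset_zero_iff[OF FF tensor_relations_submodule[OF C H] ut] by (simp add: tensor_product_def)

    let ?Pw = "power_module ?H (n 0)"
    have Pw: "module R ?Pw" by (rule module_power[OF H])
    interpret Pw: module R ?Pw by (rule Pw)
    let ?D = "\<lambda>z. \<lambda>k\<in>{..<n 0}. mact ?H (B 1) (n 1) z k"
    have D_hom: "?D \<in> module_hom R (power_module ?H (n 1)) ?Pw" by (rule mact_power_hom[OF H B_closed])
    let ?S = "?D ` carrier (power_module ?H (n 1))"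
    have S: "submodule ?S R ?Pw"
      using image_submodule[OF module_power[OF H] Pw carrier_submodule[OF module_power[OF H]], of ?D] D_hom
      by simp
    note SD = submoduleD[OF Pw S]
    \<comment> \<open>\<open>vf v f\<close> is the tensor of v and f under the identification of F 0
      (x) Hom(C, M) with the power of Hom(C, M).\<close>
    define vf where "vf v f = (\<lambda>k\<in>{..<n 0}. v k \<odot>\<^bsub>?H\<^esub> f)" for v f
    have vf_left: "(\<lambda>v. vf v f) \<in> module_hom R (F 0) ?Pw" if "f \<in> carrier ?H" for f
      unfolding vf_def using that
      by (intro power_tuple_hom module_homI)
        (simp_all add: free_moduleD(1) free_module_simps(3,4) H.smult_l_distr H.smult_assoc1)
    have vf_right: "vf v \<in> module_hom R ?H ?Pw" if "v \<in> carrier (F 0)" for v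
      unfolding vf_def[abs_def] using free_moduleD(1)[OF that]
      by (intro power_tuple_hom smult_hom[OF H])
    \<comment> \<open>The kernel of e is the image of d 1, so v = d 1 s and the tuple is the matrix
      applied to the multiples of f by the entries of s.\<close>
    have vf_S: "vf v f \<in> ?S" if v: "v \<in> carrier (F 0)" "e v = \<zero>\<^bsub>C\<^esub>" and f: "f \<in> carrier ?H" for v f
    proof -
      obtain s where s: "s \<in> carrier (F 1)" "v = d 1 s" using e_exact[OF v] by blast
      note sR = free_moduleD(1)[OF s(1)]
      let ?z = "\<lambda>l\<in>{..<n 1}. s l \<odot>\<^bsub>?H\<^esub> f"
      have z: "?z \<in> carrier (power_module ?H (n 1))" using sR f by (intro restrict_power) simp
      have "v k \<odot>\<^bsub>?H\<^esub> f = mact ?H (B 1) (n 1) ?z k" for k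
      proof -
        have "v k \<odot>\<^bsub>?H\<^esub> f = (\<Oplus>\<^bsub>?H\<^esub>l\<in>{..<n 1}. (s l \<otimes> B 1 k l) \<odot>\<^bsub>?H\<^esub> f)"
          unfolding s(2) d_matrix[OF s(1)] using sR B_closed f by (intro finsum_smult_right[OF H]) auto
        also have "\<dots> = mact ?H (B 1) (n 1) ?z k"
          unfolding mact_def using sR B_closed f
          by (intro H.finsum_cong') (auto simp: H.smult_assoc1[symmetric] m_comm)
        finally show ?thesis .
      qed
      then have "vf v f = ?D ?z" by (simp add: vf_def)
      then show ?thesis using z by blast
    qed
    \<comment> \<open>\<open>\<rho>\<close> is a section of e as a map of sets only. Its failure to
      be linear takes values in the kernel of e, hence disappears modulo \<open>?S\<close>.\<close>
    define \<rho> where "\<rho> y = (SOME u. u \<in> carrier (F 0) \<and> e u = y)" for y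
    have \<rho>: "\<rho> y \<in> carrier (F 0)" "e (\<rho> y) = y" if "y \<in> carrier C" for y
    proof -
      from that have "y \<in> e ` carrier (F 0)" by (simp add: e_surj)
      then have "\<exists>u. u \<in> carrier (F 0) \<and> e u = y" by blast
      from someI_ex[OF this] show "\<rho> y \<in> carrier (F 0)" "e (\<rho> y) = y" unfolding \<rho>_def by auto
    qed
    interpret F0: module R "F 0" by (rule module_F)
    interpret C: module R C by (rule C)
    let ?b = "\<lambda>x. vf (\<rho> (fst x)) (snd x)"
    let ?\<phi> = "lincomb R ?Pw ?b"
    have b: "?b \<in> carrier C \<times> carrier ?H \<rightarrow> carrier ?Pw"
      using module_homD(1)[OF vf_right[OF \<rho>(1)]] by auto
    have \<phi>: "?\<phi> \<in> module_hom R ?FF ?Pw" by (rule lincomb_hom[OF Pw b])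
    have \<phi>_basis: "?\<phi> (basis_vec R (y, f)) = vf (\<rho> y) f" if "y \<in> carrier C" "f \<in> carrier ?H" for y f
    proof -
      have "vf (\<rho> y) f \<in> carrier ?Pw" by (rule module_homD(1)[OF vf_right[OF \<rho>(1)[OF that(1)]] that(2)])
      then show ?thesis using lincomb_basis_vec[where \<beta> = ?b and x = "(y, f)", OF Pw] by simp
    qed
    \<comment> \<open>The formal sums sent into \<open>?S\<close> form a submodule, so the relations
      lie in it once their generators do.\<close>
    have pre: "submodule {u \<in> carrier ?FF. ?\<phi> u \<in> ?S} R ?FF"
    proof (rule module_submoduleI[OF FF])
      show "\<zero>\<^bsub>?FF\<^esub> \<in> {u \<in> carrier ?FF. ?\<phi> u \<in> ?S}"
        using module_hom_zero[OF FF Pw \<phi>] SD(2) by (simp only: mem_Collect_eq FF.zero_closed simp_thms)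
      fix u v assume "u \<in> {u \<in> carrier ?FF. ?\<phi> u \<in> ?S}" "v \<in> {u \<in> carrier ?FF. ?\<phi> u \<in> ?S}"
      then show "u \<oplus>\<^bsub>?FF\<^esub> v \<in> {u \<in> carrier ?FF. ?\<phi> u \<in> ?S}"
        using SD(3) by (simp only: mem_Collect_eq FF.a_closed module_homD(2)[OF \<phi>] simp_thms)
    next
      fix r u assume "r \<in> carrier R" "u \<in> {u \<in> carrier ?FF. ?\<phi> u \<in> ?S}"
      then show "r \<odot>\<^bsub>?FF\<^esub> u \<in> {u \<in> carrier ?FF. ?\<phi> u \<in> ?S}"
        using SD(6) by (simp only: mem_Collect_eq FF.smult_closed module_homD(3)[OF \<phi>] simp_thms)
    qed blast
    have mem: "u \<ominus>\<^bsub>?FF\<^esub> v \<in> {u \<in> carrier ?FF. ?\<phi> u \<in> ?S}"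
      if "u \<in> carrier ?FF" "v \<in> carrier ?FF" "?\<phi> u \<ominus>\<^bsub>?Pw\<^esub> ?\<phi> v \<in> ?S" for u v
      using that FF.minus_closed by (simp only: mem_Collect_eq module_hom_diff[OF FF Pw \<phi>] simp_thms)
    have vf_diff: "vf v f \<ominus>\<^bsub>?Pw\<^esub> vf w f \<in> ?S"
      if "v \<in> carrier (F 0)" "w \<in> carrier (F 0)" "e v = e w" "f \<in> carrier ?H" for v w f
      unfolding module_hom_diff[OF module_F Pw vf_left[OF that(4)] that(1,2), symmetric]
      using that module_homD(1)[OF e_hom]
      by (intro vf_S) (simp_all add: module_hom_diff[OF module_F C e_hom] module_minus_self[OF C])
    note bF = basis_FF[OF C H]
    have "?rels \<subseteq> {u \<in> carrier ?FF. ?\<phi> u \<in> ?S}"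
    proof (rule tensor_relations_minimal[OF C H pre])
      fix y y' f assume y: "y \<in> carrier C" "y' \<in> carrier C" and f: "f \<in> carrier ?H"
      have "vf (\<rho> y) f \<oplus>\<^bsub>?Pw\<^esub> vf (\<rho> y') f = vf (\<rho> y \<oplus>\<^bsub>F 0\<^esub> \<rho> y') f"
        using module_homD(2)[OF vf_left[OF f] \<rho>(1)[OF y(1)] \<rho>(1)[OF y(2)]] by simp
      moreover have "vf (\<rho> (y \<oplus>\<^bsub>C\<^esub> y')) f \<ominus>\<^bsub>?Pw\<^esub> vf (\<rho> y \<oplus>\<^bsub>F 0\<^esub> \<rho> y') f \<in> ?S"
        using y f \<rho> module_homD(2)[OF e_hom] by (intro vf_diff) simp_all
      ultimately show "basis_vec R (y \<oplus>\<^bsub>C\<^esub> y', f) \<ominus>\<^bsub>?FF\<^esub> (basis_vec R (y, f) \<oplus>\<^bsub>?FF\<^esub> basis_vec R (y', f))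
        \<in> {u \<in> carrier ?FF. ?\<phi> u \<in> ?S}"
        using y f by (intro mem) (simp_all only: bF FF.a_closed C.a_closed module_homD(2)[OF \<phi>] \<phi>_basis)
    next
      fix y f f' assume y: "y \<in> carrier C" and f: "f \<in> carrier ?H" "f' \<in> carrier ?H"
      have "vf (\<rho> y) f \<oplus>\<^bsub>?Pw\<^esub> vf (\<rho> y) f' = vf (\<rho> y) (f \<oplus>\<^bsub>?H\<^esub> f')"
        using module_homD(2)[OF vf_right[OF \<rho>(1)[OF y]] f] by simp
      moreover have "vf (\<rho> y) (f \<oplus>\<^bsub>?H\<^esub> f') \<ominus>\<^bsub>?Pw\<^esub> vf (\<rho> y) (f \<oplus>\<^bsub>?H\<^esub> f') \<in> ?S"
        using y f \<rho> by (intro vf_diff) simp_all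
      ultimately show "basis_vec R (y, f \<oplus>\<^bsub>?H\<^esub> f') \<ominus>\<^bsub>?FF\<^esub> (basis_vec R (y, f) \<oplus>\<^bsub>?FF\<^esub> basis_vec R (y, f'))
        \<in> {u \<in> carrier ?FF. ?\<phi> u \<in> ?S}"
        using y f by (intro mem) (simp_all only: bF FF.a_closed H.a_closed module_homD(2)[OF \<phi>] \<phi>_basis)
    next
      fix r y f assume r: "r \<in> carrier R" and y: "y \<in> carrier C" and f: "f \<in> carrier ?H"
      have "r \<odot>\<^bsub>?Pw\<^esub> vf (\<rho> y) f = vf (r \<odot>\<^bsub>F 0\<^esub> \<rho> y) f"
        using module_homD(3)[OF vf_left[OF f] r \<rho>(1)[OF y]] by simp
      moreover have "vf (\<rho> (r \<odot>\<^bsub>C\<^esub> y)) f \<ominus>\<^bsub>?Pw\<^esub> vf (r \<odot>\<^bsub>F 0\<^esub> \<rho> y) f \<in> ?S"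
        using r y f \<rho> module_homD(3)[OF e_hom] by (intro vf_diff) simp_all
      ultimately show "basis_vec R (r \<odot>\<^bsub>C\<^esub> y, f) \<ominus>\<^bsub>?FF\<^esub> r \<odot>\<^bsub>?FF\<^esub> basis_vec R (y, f)
        \<in> {u \<in> carrier ?FF. ?\<phi> u \<in> ?S}"
        using r y f by (intro mem) (simp_all only: bF FF.smult_closed C.smult_closed module_homD(3)[OF \<phi>] \<phi>_basis)
      have "r \<odot>\<^bsub>?Pw\<^esub> vf (\<rho> y) f = vf (\<rho> y) (r \<odot>\<^bsub>?H\<^esub> f)"
        using module_homD(3)[OF vf_right[OF \<rho>(1)[OF y]] r f] by simp
      moreover have "vf (\<rho> y) (r \<odot>\<^bsub>?H\<^esub> f) \<ominus>\<^bsub>?Pw\<^esub> vf (\<rho> y) (r \<odot>\<^bsub>?H\<^esub> f) \<in> ?S"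
        using r y f \<rho> by (intro vf_diff) simp_all
      ultimately show "basis_vec R (y, r \<odot>\<^bsub>?H\<^esub> f) \<ominus>\<^bsub>?FF\<^esub> r \<odot>\<^bsub>?FF\<^esub> basis_vec R (y, f)
        \<in> {u \<in> carrier ?FF. ?\<phi> u \<in> ?S}"
        using r y f by (intro mem) (simp_all only: bF FF.smult_closed H.smult_closed module_homD(3)[OF \<phi>] \<phi>_basis)
    qed
    then have \<phi>_ut: "?\<phi> ?ut \<in> ?S" using ut_rels by blast
    let ?e = "\<lambda>k. unit_tuple ?H (n 0) k (g k)"
    \<comment> \<open>\<open>?s k\<close> compares two preimages of c k under e, the chosen one and
      the basis vector, so it lies in \<open>?S\<close>.\<close>
    let ?s = "\<lambda>k. vf (\<rho> (c k)) (g k) \<ominus>\<^bsub>?Pw\<^esub> ?e k"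
    have ek: "?e k \<in> carrier ?Pw" if "k < n 0" for k
      by (rule module_homD(1)[OF unit_tuple_hom[OF H] gk[OF that]])
    have vk: "vf (\<rho> (c k)) (g k) \<in> carrier ?Pw" if "k < n 0" for k
      by (rule module_homD(1)[OF vf_right[OF \<rho>(1)[OF cl[OF that]]] gk[OF that]])
    have sk: "?s k \<in> ?S" if k: "k < n 0" for k
    proof -
      have "?e k = vf (basis_vec R k) (g k)"
        using gk[OF k] by (auto simp: vf_def unit_tuple_def basis_vec_def)
      moreover have "vf (\<rho> (c k)) (g k) \<ominus>\<^bsub>?Pw\<^esub> vf (basis_vec R k) (g k) \<in> ?S"
        using \<rho>[OF cl[OF k]] gk[OF k] basis_F[OF k] by (intro vf_diff) (simp_all add: c_def)
      ultimately show ?thesis by simp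
    qed
    let ?G = "restrict g {..<n 0}"
    have G: "?G \<in> carrier ?Pw" by (rule restrict_power[OF g])
    have sum_s: "(\<Oplus>\<^bsub>?Pw\<^esub>k\<in>{..<n 0}. ?s k) \<in> ?S" using sk by (intro finsum_submodule[OF Pw S]) simp
    have "?\<phi> ?ut = (\<Oplus>\<^bsub>?Pw\<^esub>k\<in>{..<n 0}. ?\<phi> (basis_vec R (c k, g k)))"
      by (rule finsum_module_hom[OF FF Pw \<phi> bk'])
    also have "\<dots> = (\<Oplus>\<^bsub>?Pw\<^esub>k\<in>{..<n 0}. ?s k \<oplus>\<^bsub>?Pw\<^esub> ?e k)"
    proof (intro Pw.finsum_cong' refl)
      show "(\<lambda>k. ?s k \<oplus>\<^bsub>?Pw\<^esub> ?e k) \<in> {..<n 0} \<rightarrow> carrier ?Pw"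
        using ek vk by (intro Pi_I Pw.a_closed Pw.minus_closed) simp_all
      fix k assume "k \<in> {..<n 0}"
      then have k: "k < n 0" by simp
      show "?\<phi> (basis_vec R (c k, g k)) = ?s k \<oplus>\<^bsub>?Pw\<^esub> ?e k"
        unfolding \<phi>_basis[OF cl[OF k] gk[OF k]] using ek[OF k] vk[OF k]
        by (simp only: a_minus_def Pw.a_assoc Pw.l_neg Pw.r_zero Pw.a_inv_closed)
    qed
    also have "\<dots> = (\<Oplus>\<^bsub>?Pw\<^esub>k\<in>{..<n 0}. ?s k) \<oplus>\<^bsub>?Pw\<^esub> (\<Oplus>\<^bsub>?Pw\<^esub>k\<in>{..<n 0}. ?e k)"
      using ek vk by (intro Pw.finsum_addf Pi_I Pw.minus_closed) simp_all
    also have "(\<Oplus>\<^bsub>?Pw\<^esub>k\<in>{..<n 0}. ?e k) = (\<Oplus>\<^bsub>?Pw\<^esub>k\<in>{..<n 0}. unit_tuple ?H (n 0) k (?G k))"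
      using ek by (intro Pw.finsum_cong') auto
    also have "\<dots> = ?G" by (rule power_module_decomp[OF H G, symmetric])
    finally have eq: "?\<phi> ?ut = (\<Oplus>\<^bsub>?Pw\<^esub>k\<in>{..<n 0}. ?s k) \<oplus>\<^bsub>?Pw\<^esub> ?G" .
    have "?G = (\<ominus>\<^bsub>?Pw\<^esub> (\<Oplus>\<^bsub>?Pw\<^esub>k\<in>{..<n 0}. ?s k)) \<oplus>\<^bsub>?Pw\<^esub> ?\<phi> ?ut"
      unfolding eq using SD(1)[OF sum_s] G by (simp only: Pw.r_neg1)
    moreover have "\<dots> \<in> ?S" by (rule SD(3)[OF SD(4)[OF sum_s] \<phi>_ut])
    ultimately obtain z where z: "z \<in> carrier (power_module ?H (n 1))" "?G = ?D z" by auto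
    have "g k = mact ?H (B 1) (n 1) z k" if "k < n 0" for k
      using fun_cong[OF z(2), of k] that by simp
    moreover have "z \<in> {..<n 1} \<rightarrow> carrier ?H" using z(1) by (auto simp: power_module_simps)
    ultimately show "\<exists>h\<in>{..<n 1} \<rightarrow> carrier ?H. \<forall>k<n 0. g k = tor.D ?H (- 1) h k"
      by (intro bexI[of _ z]) simp_all
  qed
qed

end

subsection \<open>Existence of resolutions\<close>

text \<open>Repeatedly covering the kernel of the last map by a finitely generated free module,
  which the Noetherian hypothesis allows. The next map depends on the previous one, so the sequence
  is obtained by dependent choice.\<close>

lemma exists_fg_free_resolution:
  fixes R :: "'r ring" and C :: "('r, 'c) module"
  assumes R: "cring R" "noetherian_ring R" and C: "module R C" "finitely_generated_module R C"
  shows "\<exists>P e. fg_free_resolution R C P e"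
proof -
  interpret R: cring R by fact
  let ?F = "\<lambda>k::nat. free_module R {..<k}"
  have F: "module R (?F k)" for k by (rule module_free[OF R(1)])
  obtain S where S: "finite S" "S \<subseteq> carrier C" "submodule_span R C S = carrier C"
    using C(2) by (auto simp: finitely_generated_module_def)
  obtain n0 :: nat and e where e: "e \<in> module_hom R (?F n0) C" "e ` carrier (?F n0) = carrier C"
  proof (rule finite_generators_cover[OF C(1) carrier_submodule[OF C(1)] S(1,2)])
    show "carrier C \<subseteq> H" if "submodule H R C" "S \<subseteq> H" for H
      using submodule_span_minimal[OF that] S(3) by simp
  qed (use that in blast)
  obtain n1 :: nat and d1 where d1: "d1 \<in> module_hom R (?F n1) (?F n0)"
    "d1 ` carrier (?F n1) = {u \<in> carrier (?F n0). e u = \<zero>\<^bsub>C\<^esub>}"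
    using free_cover_of_kernel[OF R(2) C(1) e(1)] by (elim exE conjE)
  \<comment> \<open>A state is a triple of target rank, source rank and map. The clause for k = 0
    pins the sequence to the cover of the kernel of e; \<open>succ\<close> says that the next image
    is the kernel of the current map.\<close>
  define good where "good k s \<longleftrightarrow> snd (snd s) \<in> module_hom R (?F (fst (snd s))) (?F (fst s)) \<and>
    (k = 0 \<longrightarrow> s = (n0, n1, d1))" for k :: nat and s :: "nat \<times> nat \<times> ((nat \<Rightarrow> 'r) \<Rightarrow> nat \<Rightarrow> 'r)"
  define succ where "succ s s' \<longleftrightarrow> fst s' = fst (snd s) \<and>
    snd (snd s') ` carrier (?F (fst (snd s'))) = {u \<in> carrier (?F (fst (snd s))). snd (snd s) u = \<zero>\<^bsub>?F (fst s)\<^esub>}"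
    for s s' :: "nat \<times> nat \<times> ((nat \<Rightarrow> 'r) \<Rightarrow> nat \<Rightarrow> 'r)"
  have "\<exists>f. \<forall>k. good k (f k) \<and> succ (f k) (f (Suc k))"
  proof (rule dependent_nat_choice)
    show "\<exists>s. good 0 s" using d1(1) by (intro exI[of _ "(n0, n1, d1)"]) (simp add: good_def)
    fix s k assume "good k s"
    then have "snd (snd s) \<in> module_hom R (?F (fst (snd s))) (?F (fst s))" by (simp add: good_def)
    from free_cover_of_kernel[OF R(2) F this] obtain q d'
      where "d' \<in> module_hom R (?F q) (?F (fst (snd s)))"
        "d' ` carrier (?F q) = {u \<in> carrier (?F (fst (snd s))). snd (snd s) u = \<zero>\<^bsub>?F (fst s)\<^esub>}" by blast
    then show "\<exists>s'. good (Suc k) s' \<and> succ s s'"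
      by (intro exI[of _ "(fst (snd s), q, d')"]) (simp add: good_def succ_def)
  qed
  then obtain f where f: "\<And>k. good k (f k)" "\<And>k. succ (f k) (f (Suc k))" by blast
  define N where "N i = (if i < 0 then 0 else fst (f (nat i)))" for i :: int
  \<comment> \<open>The k-th state holds the differential of degree k + 1, hence the shift by one.
    In degrees up to 0 the differential is zero.\<close>
  define P where "P = \<lparr>cobj = (\<lambda>i. ?F (N i)),
    cdiff = (\<lambda>i. if i \<le> 0 then (\<lambda>_ _. \<zero>\<^bsub>R\<^esub>) else snd (snd (f (nat (i - 1)))))\<rparr>"
  have f0: "f 0 = (n0, n1, d1)" using f(1)[of 0] by (simp add: good_def)
  have ob: "cobj P i = ?F (N i)" for i by (simp add: P_def)
  have zero_hom: "(\<lambda>_ _. \<zero>\<^bsub>R\<^esub>) \<in> module_hom R (?F a) (?F b)" for a b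
    by (rule module_homI) (auto simp: free_module_simps)
  have pos: "N i = fst (snd (f (nat (i - 1))))" "N (i - 1) = fst (f (nat (i - 1)))"
    "cdiff P i = snd (snd (f (nat (i - 1))))" if "0 < i" for i
  proof -
    have s: "nat i = Suc (nat (i - 1))" using that by simp
    show "N i = fst (snd (f (nat (i - 1))))"
      using f(2)[of "nat (i - 1)"] that by (simp add: N_def succ_def s)
    show "N (i - 1) = fst (f (nat (i - 1)))" using that by (simp add: N_def)
    show "cdiff P i = snd (snd (f (nat (i - 1))))" using that by (simp add: P_def)
  qed
  have hom: "cdiff P i \<in> module_hom R (cobj P i) (cobj P (i - 1))" for i
  proof (cases "0 < i")
    case True
    then show ?thesis using f(1)[of "nat (i - 1)"] pos[OF True] by (simp add: ob good_def)
  next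
    case False
    then show ?thesis using zero_hom by (simp add: P_def)
  qed
  have bc: "boundaries P i = cycles P i" if "0 < i" for i
  proof -
    have s: "nat i = Suc (nat (i - 1))" using that by simp
    have p: "0 < i + 1" "i + 1 - 1 = i" using that by simp_all
    show ?thesis
      using f(2)[of "nat (i - 1)"] pos[OF that] pos[OF p(1)] by (simp add: ob succ_def s)
  qed
  have chain: "chain_cpx R P"
    unfolding chain_cpx_def
  proof (intro allI conjI ballI)
    fix i
    show "module R (cobj P i)" unfolding ob by (rule F)
    show "cdiff P i \<in> module_hom R (cobj P i) (cobj P (i - 1))" by (rule hom)
    fix x assume x: "x \<in> carrier (cobj P i)"
    show "cdiff P (i - 1) (cdiff P i x) = \<zero>\<^bsub>cobj P (i - 2)\<^esub>"
    proof (cases "0 < i - 1")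
      case True
      have "cdiff P i x \<in> boundaries P (i - 1)" using x by auto
      then show ?thesis unfolding bc[OF True] by simp
    next
      case False
      then show ?thesis unfolding ob by (simp add: P_def free_module_simps(2))
    qed
  qed
  have N01: "N 0 = n0" "N 1 = n1" using f0 f(2)[of 0] by (simp_all add: N_def succ_def)
  have d1': "cdiff P 1 = d1" using f0 by (simp add: P_def)
  have "fg_free_resolution R C P e"
    unfolding fg_free_resolution_def
  proof (intro conjI)
    show "\<exists>n. (\<forall>i<0. n i = 0) \<and> (\<forall>i. cobj P i = free_module R {..<n i})"
      by (intro exI[of _ N]) (simp add: ob N_def)
    show "\<forall>i>0. trivial_module (homology P i)" using bc by (simp add: trivial_homology_iff[OF chain])
  qed (use chain e d1 in \<open>simp_all add: ob N01 d1' a_kernel_eq\<close>)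
  then show ?thesis by blast
qed

lemma presentation_of_resolution:
  assumes R: "cring R" and C: "module R C" and res: "fg_free_resolution R C P e"
  obtains n where "presentation R C n (cdiff P) e" "cobj P = (\<lambda>i. free_module R {..<n i})"
proof -
  interpret R: cring R by fact
  have chain: "chain_cpx R P" and ex: "\<And>i. 0 < i \<Longrightarrow> trivial_module (homology P i)"
    using res by (simp_all add: fg_free_resolution_def)
  obtain n where n: "\<And>i. i < 0 \<Longrightarrow> n i = 0" "\<And>i. cobj P i = free_module R {..<n i}"
    using res unfolding fg_free_resolution_def by blast
  have e: "e \<in> module_hom R (free_module R {..<n 0}) C"
    "e ` carrier (free_module R {..<n 0}) = carrier C"
    "{u \<in> carrier (free_module R {..<n 0}). e u = \<zero>\<^bsub>C\<^esub>} = cdiff P 1 ` carrier (free_module R {..<n 1})"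
    using res by (simp_all add: fg_free_resolution_def n(2) a_kernel_eq)
  have "presentation R C n (cdiff P) e"
  proof (intro presentation.intro presentation_axioms.intro R C)
    fix i u
    show "cdiff P i \<in> module_hom R (free_module R {..<n i}) (free_module R {..<n (i - 1)})"
      using chain_cpxD(2)[OF chain, of i] by (simp add: n(2))
    show "cdiff P i (cdiff P (i + 1) u) = (\<lambda>_. \<zero>\<^bsub>R\<^esub>)" if "u \<in> carrier (free_module R {..<n (i + 1)})"
      using chain_cpxD(3)[OF chain, of u i] that by (simp add: n(2) free_module_simps(2))
    show "u \<in> cdiff P (i + 1) ` carrier (free_module R {..<n (i + 1)})"
      if "0 < i" "u \<in> carrier (free_module R {..<n i})" "cdiff P i u = (\<lambda>_. \<zero>\<^bsub>R\<^esub>)"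
    proof -
      have "u \<in> cycles P i" using that by (simp add: n(2) free_module_simps(2))
      then have "u \<in> boundaries P i" using trivial_homology_iff[OF chain] ex[OF that(1)] by simp
      then show ?thesis by (simp add: n(2))
    qed
    show "e (cdiff P 1 u) = \<zero>\<^bsub>C\<^esub>" if "u \<in> carrier (free_module R {..<n 1})"
      using e(3) that by blast
    show "u \<in> cdiff P 1 ` carrier (free_module R {..<n 1})"
      if "u \<in> carrier (free_module R {..<n 0})" "e u = \<zero>\<^bsub>C\<^esub>"
      using e(3) that by blast
  qed (use n(1) e in simp_all)
  moreover have "cobj P = (\<lambda>i. free_module R {..<n i})" using n(2) by blast
  ultimately show ?thesis by (rule that)
qed

subsection \<open>The complex of homomorphisms\<close>

lemma Hom_cpx_simps:
  "cobj (Hom_cpx R C I) i = Hom_module R C (cobj I i)"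
  "cdiff (Hom_cpx R C I) i f = (\<lambda>a\<in>carrier C. cdiff I i (f a))"
  by (simp_all add: Hom_cpx_def)

lemma chain_Hom_cpx:
  assumes C: "module R C" and I: "chain_cpx R I"
  shows "chain_cpx R (Hom_cpx R C I)"
  unfolding chain_cpx_def
proof (intro allI conjI ballI)
  fix i
  note ID = chain_cpxD[OF I]
  note dD = module_homD[OF ID(2)]
  show "module R (cobj (Hom_cpx R C I) i)" unfolding Hom_cpx_simps by (rule module_Hom[OF C ID(1)])
  show "cdiff (Hom_cpx R C I) i \<in> module_hom R (cobj (Hom_cpx R C I) i) (cobj (Hom_cpx R C I) (i - 1))"
  proof (rule module_homI, unfold Hom_cpx_simps)
    fix f assume f: "f \<in> carrier (Hom_module R C (cobj I i))"
    show "(\<lambda>a\<in>carrier C. cdiff I i (f a)) \<in> carrier (Hom_module R C (cobj I (i - 1)))"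
      using Hom_moduleI[OF module_hom_comp[OF Hom_moduleD(1)[OF f] ID(2)] C] .
    note fv = Hom_moduleD(2)[OF f]
    show "(\<lambda>a\<in>carrier C. cdiff I i ((f \<oplus>\<^bsub>Hom_module R C (cobj I i)\<^esub> g) a))
        = (\<lambda>a\<in>carrier C. cdiff I i (f a)) \<oplus>\<^bsub>Hom_module R C (cobj I (i - 1))\<^esub> (\<lambda>a\<in>carrier C. cdiff I i (g a))"
      if g: "g \<in> carrier (Hom_module R C (cobj I i))" for g
      using fv Hom_moduleD(2)[OF g] dD(2) by (simp add: Hom_module_simps fun_eq_iff)
    show "(\<lambda>a\<in>carrier C. cdiff I i ((r \<odot>\<^bsub>Hom_module R C (cobj I i)\<^esub> f) a))
        = r \<odot>\<^bsub>Hom_module R C (cobj I (i - 1))\<^esub> (\<lambda>a\<in>carrier C. cdiff I i (f a))"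
      if "r \<in> carrier R" for r
      using fv that dD(3) by (simp add: Hom_module_simps fun_eq_iff)
  qed
  fix f assume "f \<in> carrier (cobj (Hom_cpx R C I) i)"
  then have "f a \<in> carrier (cobj I (i - 1 + 1))" if "a \<in> carrier C" for a
    using that Hom_moduleD(2) by (simp add: Hom_cpx_simps)
  from ID(3)[OF this] show "cdiff (Hom_cpx R C I) (i - 1) (cdiff (Hom_cpx R C I) i f) = \<zero>\<^bsub>cobj (Hom_cpx R C I) (i - 2)\<^esub>"
    by (simp add: Hom_cpx_simps Hom_module_simps(2) fun_eq_iff)
qed

lemma Hom_cycles_iff:
  "f \<in> cycles (Hom_cpx R C I) i \<longleftrightarrow>
    f \<in> carrier (Hom_module R C (cobj I i)) \<and> (\<forall>a\<in>carrier C. f a \<in> cycles I i)"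
  using Hom_moduleD(2)[of f R C "cobj I i"]
  by (auto simp: Hom_cpx_simps Hom_module_simps(2) fun_eq_iff)

section \<open>Complexes whose homology consists of powers of a module\<close>

text \<open>Lets the alternative of being zero or a power be treated uniformly, with exponent 0 for
  zero homology.\<close>

lemma trivial_homology_isomorphic_power_0:
  assumes "chain_cpx R X" "module R L" "trivial_module (homology X i)"
  shows "isomorphic_modules R (homology X i) (power_module L 0)"
proof -
  have z: "carrier (power_module L 0) = {\<lambda>k\<in>{..<0}. \<zero>\<^bsub>L\<^esub>}" by (auto simp: power_module_simps)
  have "\<zero>\<^bsub>cobj X i\<^esub> \<in> cycles X i"
    by (rule submoduleD(2)[OF chain_cpxD(1)[OF assms(1)] cycles_submodule[OF assms(1)]])
  then have ne: "cycles X i \<noteq> {}" by blast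
  show ?thesis
    unfolding isomorphic_homology_iff[OF assms(1) module_power[OF assms(2)]]
  proof (intro bexI conjI)
    let ?z = "\<lambda>x. \<lambda>k\<in>{..<0::nat}. \<zero>\<^bsub>L\<^esub>"
    show "?z \<in> module_hom R (cobj X i\<lparr>carrier := cycles X i\<rparr>) (power_module L 0)"
      by (rule module_homI) (auto simp: power_module_simps)
    show "?z ` cycles X i = carrier (power_module L 0)" using ne z by auto
    show "{x \<in> cycles X i. ?z x = \<zero>\<^bsub>power_module L 0\<^esub>} = boundaries X i"
      using assms(3) trivial_homology_iff[OF assms(1)] by (simp add: power_module_simps(2))
  qed
qed

text \<open>For a nonzero \<open>L\<close> the exponent decides whether the homology vanishes; this
  transfers vanishing between two complexes once their exponents agree.\<close>

lemma trivial_homology_power_iff: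
  assumes "chain_cpx R X" "module R L" "\<not> trivial_module L"
    and "isomorphic_modules R (homology X i) (power_module L b)"
  shows "trivial_module (homology X i) \<longleftrightarrow> b = 0"
proof -
  interpret L: module R L by fact
  obtain \<pi> where \<pi>: "\<pi> ` cycles X i = carrier (power_module L b)"
    "{x \<in> cycles X i. \<pi> x = \<zero>\<^bsub>power_module L b\<^esub>} = boundaries X i"
    using assms(4) isomorphic_homology_iff[OF assms(1) module_power[OF assms(2)]] by blast
  have "trivial_module (homology X i) \<longleftrightarrow> (\<forall>x\<in>cycles X i. \<pi> x = \<zero>\<^bsub>power_module L b\<^esub>)"
    unfolding trivial_homology_iff[OF assms(1)] \<pi>(2)[symmetric] by blast
  also have "\<dots> \<longleftrightarrow> (\<forall>v\<in>carrier (power_module L b). v = \<zero>\<^bsub>power_module L b\<^esub>)"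
    unfolding \<pi>(1)[symmetric] by blast
  also have "\<dots> \<longleftrightarrow> b = 0"
  proof
    assume all: "\<forall>v\<in>carrier (power_module L b). v = \<zero>\<^bsub>power_module L b\<^esub>"
    obtain x where x: "x \<in> carrier L" "x \<noteq> \<zero>\<^bsub>L\<^esub>"
      using assms(3) L.zero_closed unfolding trivial_module_def by blast
    have "(\<lambda>k\<in>{..<b}. x) \<in> carrier (power_module L b)" using x by (auto simp: power_module_simps)
    then have "(\<lambda>k\<in>{..<b}. x) = (\<lambda>k\<in>{..<b}. \<zero>\<^bsub>L\<^esub>)" using all by (simp add: power_module_simps(2))
    from fun_cong[OF this, of 0] show "b = 0" using x(2) by (cases "b = 0") auto
  qed (auto simp: power_module_simps)
  finally show ?thesis .
qed

lemma d_restrict: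
  assumes "chain_cpx R X"
  shows "cdiff X (i + 1) \<in> module_hom R (cobj X (i + 1)\<lparr>carrier := carrier (cobj X (i + 1))\<rparr>) (cobj X i)"
  using chain_cpxD(2)[OF assms, of "i + 1"] by simp

lemma cycles_trivial:
  assumes "chain_cpx R X" "trivial_module (cobj X i)"
  shows "cycles X i = {\<zero>\<^bsub>cobj X i\<^esub>}" "boundaries X i = {\<zero>\<^bsub>cobj X i\<^esub>}"
proof -
  note Z = submoduleD(1,2)[OF chain_cpxD(1)[OF assms(1)] cycles_submodule[OF assms(1), of i]]
  note B = submoduleD(1,2)[OF chain_cpxD(1)[OF assms(1)] boundaries_submodule[OF assms(1), of i]]
  have "carrier (cobj X i) = {\<zero>\<^bsub>cobj X i\<^esub>}" using assms(2) by (simp add: trivial_module_def)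
  then show "cycles X i = {\<zero>\<^bsub>cobj X i\<^esub>}" "boundaries X i = {\<zero>\<^bsub>cobj X i\<^esub>}" using Z B by blast+
qed

context matrix_complex
begin

text \<open>Matrices act on a power coordinate by coordinate, so preimages are found for each
  coordinate and put together.\<close>

lemma exact_at_power:
  assumes N: "module R N" and ex: "exact_at N (carrier N) j"
  shows "exact_at (power_module N b) (carrier (power_module N b)) j"
  unfolding exact_at_def
proof (intro ballI impI)
  interpret N: module R N by (rule N)
  let ?P = "power_module N b"
  have P: "module R ?P" by (rule module_power[OF N])
  fix x assume x: "x \<in> {..<m j} \<rightarrow> carrier ?P" and Dx: "\<forall>k<m (j + 1). D ?P j x k = \<zero>\<^bsub>?P\<^esub>"
  have comp: "D ?P i' w l k = D N i' (\<lambda>l. w l k) l"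
    if "w \<in> {..<m i'} \<rightarrow> carrier ?P" "k < b" for w i' l k
    using mact_module_hom[OF P N module_power_proj[OF that(2)] A_closed that(1)] by simp
  have "\<exists>y. y \<in> {..<m (j - 1)} \<rightarrow> carrier N \<and> (\<forall>l<m j. x l k = D N (j - 1) y l)" if k: "k < b" for k
  proof -
    have "(\<lambda>l. x l k) \<in> {..<m j} \<rightarrow> carrier N" using x k by (auto simp: power_module_simps)
    moreover have "D N j (\<lambda>l. x l k) l = \<zero>\<^bsub>N\<^esub>" if "l < m (j + 1)" for l
      using comp[OF x k, of l] Dx that k by (simp add: power_module_simps(2))
    ultimately show ?thesis
      using bspec[OF ex[unfolded exact_at_def], of "\<lambda>l. x l k"] by blast
  qed
  then have "\<forall>k\<in>{..<b}. \<exists>y. y \<in> {..<m (j - 1)} \<rightarrow> carrier N \<and> (\<forall>l<m j. x l k = D N (j - 1) y l)" by simp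
  then obtain y where y: "\<forall>k\<in>{..<b}. y k \<in> {..<m (j - 1)} \<rightarrow> carrier N \<and> (\<forall>l<m j. x l k = D N (j - 1) (y k) l)"
    by (rule bchoice[THEN exE])
  let ?y = "\<lambda>l. \<lambda>k\<in>{..<b}. y k l"
  have "y k l \<in> carrier N" if "k < b" "l < m (j - 1)" for k l
    using bspec[OF y, of k] that by auto
  then have y': "?y \<in> {..<m (j - 1)} \<rightarrow> carrier ?P" by (simp add: power_module_simps Pi_iff)
  have "x l = D ?P (j - 1) ?y l" if l: "l < m j" for l
  proof (rule PiE_ext[of _ "{..<b}" "\<lambda>_. carrier N"])
    show "x l \<in> {..<b} \<rightarrow>\<^sub>E carrier N" using x l by (auto simp: power_module_simps)
    show "D ?P (j - 1) ?y l \<in> {..<b} \<rightarrow>\<^sub>E carrier N"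
      using mact_closed[OF P A_closed y'] by (simp add: power_module_simps(1))
    fix k assume k: "k \<in> {..<b}"
    then have yk: "y k \<in> {..<m (j - 1)} \<rightarrow> carrier N" "x l k = D N (j - 1) (y k) l" using y l by auto
    have "D ?P (j - 1) ?y l k = D N (j - 1) (\<lambda>l. ?y l k) l" using comp[OF y'] k by simp
    also have "\<dots> = D N (j - 1) (y k) l" using k by simp
    finally show "x l k = D ?P (j - 1) ?y l k" using yk(2) by simp
  qed
  then show "\<exists>y\<in>{..<m (j - 1)} \<rightarrow> carrier ?P. \<forall>l<m j. x l = D ?P (j - 1) y l" using y' by blast
qed

end

section \<open>Homology of an injective complex and of its Hom complex\<close>

text \<open>The hypotheses on \<open>C\<close> and \<open>M\<close> in terms of one fixed
  resolution: vanishing of Ext and Tor as exactness on tuples, and the evaluation isomorphism as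
  \<open>ev_exact\<close>.\<close>

locale bass_situation = presentation R C n d e
  for R :: "'r ring" (structure) and C :: "('r, 'c) module" and n d e +
  fixes M :: "('r, 'm) module"
  assumes M: "module R M"
    and hty: "homothety R C \<in> module_iso R (regular_module R) (Hom_module R C C)"
    and ext_C: "0 < i \<Longrightarrow> ext.exact_at C (carrier C) i"
    and ext_M: "0 < i \<Longrightarrow> ext.exact_at M (carrier M) i"
    and tor_M: "0 < i \<Longrightarrow> tor.exact_at (Hom_module R C M) (carrier (Hom_module R C M)) (- i)"
    and ev_M: "ev_exact M"
begin

lemma HM_module: "module R (Hom_module R C M)" by (rule module_Hom[OF C M])

text \<open>If all maps from \<open>C\<close> vanish, so do all evaluations, and these exhaust
  \<open>E\<close>. Applied to \<open>M\<close> it matches the two cases in the definitions of the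
  dimensions; applied to injectives it matches the degrees in which the complexes vanish.\<close>

lemma trivial_Hom_iff:
  assumes E: "module R E" and ev: "ev_exact E"
  shows "trivial_module (Hom_module R C E) \<longleftrightarrow> trivial_module E"
proof
  interpret E: module R E by (rule E)
  have zero: "\<zero>\<^bsub>Hom_module R C E\<^esub> \<in> carrier (Hom_module R C E)"
    by (rule submoduleD(2)[OF module_Hom[OF C E] carrier_submodule[OF module_Hom[OF C E]]])
  {
    assume "trivial_module (Hom_module R C E)"
    then have triv: "f = \<zero>\<^bsub>Hom_module R C E\<^esub>" if "f \<in> carrier (Hom_module R C E)" for f
      using that by (simp add: trivial_module_def)
    have "x = \<zero>\<^bsub>E\<^esub>" if x: "x \<in> carrier E" for x
    proof -
      obtain f where f: "f \<in> {..<n 0} \<rightarrow> carrier (Hom_module R C E)" "ev E f = x"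
        using ev x unfolding ev_exact_def by blast
      have "f l (c l) = \<zero>\<^bsub>E\<^esub>" if "l < n 0" for l
      proof -
        have "f l = \<zero>\<^bsub>Hom_module R C E\<^esub>" "c l \<in> carrier C" using triv f(1) c_closed that by auto
        then show ?thesis by (simp add: Hom_module_simps(2))
      qed
      then have "ev E f = (\<Oplus>\<^bsub>E\<^esub>l\<in>{..<n 0}. \<zero>\<^bsub>E\<^esub>)" unfolding ev_def by (intro E.finsum_cong') auto
      then show ?thesis using f(2) by simp
    qed
    then show "trivial_module E" by (auto simp: trivial_module_def)
  }
  assume "trivial_module E"
  then have "f = \<zero>\<^bsub>Hom_module R C E\<^esub>" if "f \<in> carrier (Hom_module R C E)" for f
  proof (intro Hom_module_eqI[OF that zero])
    fix y assume "y \<in> carrier C"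
    then show "f y = \<zero>\<^bsub>Hom_module R C E\<^esub> y"
      using Hom_moduleD(2)[OF that] \<open>trivial_module E\<close> by (simp add: trivial_module_def Hom_module_simps(2))
  qed
  then show "trivial_module (Hom_module R C E)" using zero unfolding trivial_module_def by blast
qed

context
  fixes I :: "('r, 'i) cpx"
  assumes I: "injective_cpx R I"
begin

abbreviation (input) HI where "HI \<equiv> Hom_cpx R C I"

abbreviation (input) HM where "HM \<equiv> Hom_module R C M"

lemma chain: "chain_cpx R I" using I by (simp add: injective_cpx_def)

lemma I_inj: "injective_module R (cobj I i)" using I by (simp add: injective_cpx_def)

lemma I_module: "module R (cobj I i)" by (rule chain_cpxD(1)[OF chain])

lemma chain_HI: "chain_cpx R HI" by (rule chain_Hom_cpx[OF C chain])

lemma HI_module: "module R (cobj HI i)" by (rule chain_cpxD(1)[OF chain_HI])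

lemma exact_I: "0 < j \<Longrightarrow> ext.exact_at (cobj I i) (carrier (cobj I i)) j"
  by (rule ext_exact_at_injective[OF I_inj])

text \<open>Dimension shifting down the complex, starting from its top degree.\<close>

lemma ext_exact_cycles:
  assumes bdd: "bounded_above_cpx I"
    and iso: "\<And>i. \<exists>b. isomorphic_modules R (homology I i) (power_module M b)"
  shows "0 < j \<Longrightarrow> ext.exact_at (cobj I i) (cycles I i) j"
    and "0 < j \<Longrightarrow> ext.exact_at (cobj I i) (boundaries I i) j"
proof -
  \<comment> \<open>From 0 -> Z_(i+1) -> I_(i+1) -> B_i -> 0: Ext^j(C, B_i) sits between Ext^j of an
    injective and Ext^(j+1) of the cycles one degree up.\<close>
  have image: "ext.exact_at (cobj I i) (boundaries I i) j"
    if ex: "\<And>j. 0 < j \<Longrightarrow> ext.exact_at (cobj I (i + 1)) (cycles I (i + 1)) j" and j: "0 < j" for i j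
  proof (rule ext.exact_at_image[OF I_module I_module carrier_submodule[OF I_module] d_restrict[OF chain]])
    show "ext.exact_at (cobj I (i + 1)) (carrier (cobj I (i + 1))) j" by (rule exact_I[OF j])
    show "ext.exact_at (cobj I (i + 1)) {x \<in> carrier (cobj I (i + 1)). cdiff I (i + 1) x = \<zero>\<^bsub>cobj I i\<^esub>} (j + 1)"
      using ex[of "j + 1"] j by simp
  qed
  obtain t where t: "\<And>i. t < i \<Longrightarrow> trivial_module (cobj I i)"
    using bdd by (auto simp: bounded_above_cpx_def)
  have triv: "ext.exact_at (cobj I i) (cycles I i) j" if "t < i" for i j
    unfolding cycles_trivial(1)[OF chain t[OF that]]
    by (rule ext.exact_at_trivial[OF I_module]) simp_all
  \<comment> \<open>Downward induction; t + 1 is a degree in which \<open>I\<close> is zero, so it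
    can serve as base.\<close>
  have cyc: "\<forall>j>0. ext.exact_at (cobj I i) (cycles I i) j" if "i \<le> t + 1" for i
    using that
  proof (induction i rule: int_le_induct)
    case base
    then show ?case using triv[of "t + 1"] by simp
  next
    case (step i)
    show ?case
    proof (intro allI impI)
      fix j :: int assume j: "0 < j"
      have ex: "ext.exact_at (cobj I (i - 1 + 1)) (cycles I (i - 1 + 1)) j" if "0 < j" for j
        using step.IH that by simp
      obtain b \<pi> where \<pi>: "\<pi> \<in> module_hom R (cobj I (i - 1)\<lparr>carrier := cycles I (i - 1)\<rparr>) (power_module M b)"
        "\<pi> ` cycles I (i - 1) = carrier (power_module M b)"
        "{x \<in> cycles I (i - 1). \<pi> x = \<zero>\<^bsub>power_module M b\<^esub>} = boundaries I (i - 1)"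
        using iso[of "i - 1"] isomorphic_homology_iff[OF chain module_power[OF M]] by blast
      \<comment> \<open>From 0 -> B_(i-1) -> Z_(i-1) -> M^b -> 0, where the boundaries are settled
        by the cycles in degree i.\<close>
      show "ext.exact_at (cobj I (i - 1)) (cycles I (i - 1)) j"
      proof (rule ext.exact_at_middle[OF I_module module_power[OF M] cycles_submodule[OF chain] \<pi>(1)])
        show "ext.exact_at (cobj I (i - 1)) {x \<in> cycles I (i - 1). \<pi> x = \<zero>\<^bsub>power_module M b\<^esub>} j"
          unfolding \<pi>(3) by (rule image[OF ex j])
        show "ext.exact_at (power_module M b) (\<pi> ` cycles I (i - 1)) j"
          unfolding \<pi>(2) by (rule ext.exact_at_power[OF M ext_M[OF j]])
      qed
    qed
  qed
  have all: "ext.exact_at (cobj I i) (cycles I i) j" if "0 < j" for i j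
    using cyc[of i] triv[of i j] that by (cases "i \<le> t + 1") auto
  then show "0 < j \<Longrightarrow> ext.exact_at (cobj I i) (cycles I i) j" .
  show "0 < j \<Longrightarrow> ext.exact_at (cobj I i) (boundaries I i) j" by (rule image[OF all])
qed

text \<open>Ext^1(C, B_i) = 0 makes Hom(C, Z_i) -> Hom(C, M^b) onto, and Ext^1(C, Z_(i+1)) = 0 makes
  Hom(C, I_(i+1)) -> Hom(C, B_i) onto, so that the kernel of the first map consists of boundaries of
  Hom(C, I).\<close>

lemma homology_Hom_cpx:
  assumes bdd: "bounded_above_cpx I"
    and iso: "\<And>i. \<exists>b. isomorphic_modules R (homology I i) (power_module M b)"
    and b: "isomorphic_modules R (homology I i) (power_module M b)"
  shows "isomorphic_modules R (homology HI i) (power_module HM b)"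
proof -
  note ex = ext_exact_cycles[OF bdd iso]
  let ?Mb = "power_module M b" and ?Nb = "power_module HM b"
  have Mb: "module R ?Mb" by (rule module_power[OF M])
  obtain \<pi> where \<pi>: "\<pi> \<in> module_hom R (cobj I i\<lparr>carrier := cycles I i\<rparr>) ?Mb"
    "\<pi> ` cycles I i = carrier ?Mb" "{x \<in> cycles I i. \<pi> x = \<zero>\<^bsub>?Mb\<^esub>} = boundaries I i"
    using b isomorphic_homology_iff[OF chain Mb] by blast
  have \<pi>D: "\<pi> (x \<oplus>\<^bsub>cobj I i\<^esub> y) = \<pi> x \<oplus>\<^bsub>?Mb\<^esub> \<pi> y"
    "r \<in> carrier R \<Longrightarrow> \<pi> (r \<odot>\<^bsub>cobj I i\<^esub> x) = r \<odot>\<^bsub>?Mb\<^esub> \<pi> x"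
    if "x \<in> cycles I i" "y \<in> cycles I i" for x y r
    using module_homD(2,3)[OF \<pi>(1)] that by simp_all
  \<comment> \<open>Composition with \<open>\<pi>\<close>, read through Hom(C, M^b) = Hom(C, M)^b;
    both layers are restricted so that the values are extensional.\<close>
  define \<Psi> where "\<Psi> f = (\<lambda>k\<in>{..<b}. \<lambda>y\<in>carrier C. \<pi> (f y) k)" for f
  have cyc: "f \<in> carrier (Hom_module R C (cobj I i))" "f \<in> module_hom R C (cobj I i)"
    "\<And>y. y \<in> carrier C \<Longrightarrow> f y \<in> cycles I i" if "f \<in> cycles HI i" for f
    using that Hom_moduleD(1) unfolding Hom_cycles_iff by auto
  have \<pi>f: "(\<lambda>y. \<pi> (f y)) \<in> module_hom R C ?Mb" if f: "f \<in> cycles HI i" for f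
  proof -
    have "f \<in> module_hom R C (cobj I i\<lparr>carrier := cycles I i\<rparr>)"
      using module_homD(2,3)[OF cyc(2)[OF f]] cyc(3)[OF f] by (intro module_homI) simp_all
    then show ?thesis by (rule module_hom_comp[OF _ \<pi>(1)])
  qed
  have \<Psi>_in: "\<Psi> f \<in> carrier ?Nb" if f: "f \<in> cycles HI i" for f
    using Hom_moduleI[OF module_hom_comp[OF \<pi>f[OF f] module_power_proj] C]
    by (simp add: \<Psi>_def power_module_simps(1))
  have "\<Psi> \<in> module_hom R (cobj HI i\<lparr>carrier := cycles HI i\<rparr>) ?Nb"
  proof (rule module_homI)
    fix f assume "f \<in> carrier (cobj HI i\<lparr>carrier := cycles HI i\<rparr>)"
    then have f: "f \<in> cycles HI i" by simp
    show "\<Psi> f \<in> carrier ?Nb" by (rule \<Psi>_in[OF f])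
    {
      fix g assume "g \<in> carrier (cobj HI i\<lparr>carrier := cycles HI i\<rparr>)"
      then have g: "g \<in> cycles HI i" by simp
      have "\<pi> (f y \<oplus>\<^bsub>cobj I i\<^esub> g y) k = \<pi> (f y) k \<oplus>\<^bsub>M\<^esub> \<pi> (g y) k"
        if "y \<in> carrier C" "k < b" for y k
        using \<pi>D(1)[OF cyc(3)[OF f that(1)] cyc(3)[OF g that(1)]] that(2)
        by (simp add: power_module_simps(3))
      then show "\<Psi> (f \<oplus>\<^bsub>cobj HI i\<lparr>carrier := cycles HI i\<rparr>\<^esub> g) = \<Psi> f \<oplus>\<^bsub>?Nb\<^esub> \<Psi> g"
        by (auto simp: \<Psi>_def power_module_simps(3) Hom_cpx_simps(1) Hom_module_simps(3) fun_eq_iff)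
    }
    fix r assume r: "r \<in> carrier R"
    have "\<pi> (r \<odot>\<^bsub>cobj I i\<^esub> f y) k = r \<odot>\<^bsub>M\<^esub> \<pi> (f y) k" if "y \<in> carrier C" "k < b" for y k
      using \<pi>D(2)[OF cyc(3)[OF f that(1)] cyc(3)[OF f that(1)] r] that(2) by (simp add: power_module_simps(4))
    then show "\<Psi> (r \<odot>\<^bsub>cobj HI i\<lparr>carrier := cycles HI i\<rparr>\<^esub> f) = r \<odot>\<^bsub>?Nb\<^esub> \<Psi> f"
      by (auto simp: \<Psi>_def power_module_simps(4) Hom_cpx_simps(1) Hom_module_simps(4) fun_eq_iff)
  qed
  moreover have "\<Psi> ` cycles HI i = carrier ?Nb"
  proof (intro equalityI subsetI)
    show "G \<in> carrier ?Nb" if "G \<in> \<Psi> ` cycles HI i" for G using that \<Psi>_in by blast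
    fix G assume G: "G \<in> carrier ?Nb"
    then have Gk: "G k \<in> carrier HM" if "k < b" for k using that by (auto simp: power_module_simps)
    have \<gamma>: "(\<lambda>y. \<lambda>k\<in>{..<b}. G k y) \<in> module_hom R C ?Mb"
      by (rule power_tuple_hom) (rule Hom_moduleD(1)[OF Gk])
    obtain f where f: "f \<in> module_hom R C (cobj I i)" "\<And>y. y \<in> carrier C \<Longrightarrow> f y \<in> cycles I i"
      "\<And>y. y \<in> carrier C \<Longrightarrow> \<pi> (f y) = (\<lambda>k\<in>{..<b}. G k y)"
    proof (rule hom_C_lift[OF I_module Mb cycles_submodule[OF chain] \<pi>(1) _ \<gamma>])
      show "ext.exact_at (cobj I i) {x \<in> cycles I i. \<pi> x = \<zero>\<^bsub>?Mb\<^esub>} 1"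
        unfolding \<pi>(3) by (rule ex(2)) simp
      show "(\<lambda>k\<in>{..<b}. G k y) \<in> \<pi> ` cycles I i" if "y \<in> carrier C" for y
        unfolding \<pi>(2) by (rule module_homD(1)[OF \<gamma> that])
    qed (use that in blast)
    let ?f = "restrict f (carrier C)"
    have "?f \<in> cycles HI i"
      unfolding Hom_cycles_iff using Hom_moduleI[OF f(1) C] f(2) by simp
    moreover have "\<Psi> ?f = G"
    proof
      fix k
      show "\<Psi> ?f k = G k"
      proof (cases "k < b")
        case True
        have "(\<lambda>y\<in>carrier C. \<pi> (f y) k) = (\<lambda>y\<in>carrier C. G k y)"
          using f(3) True by (simp add: fun_eq_iff)
        also have "\<dots> = G k" using Gk[OF True] by (auto simp: Hom_module_simps(1) extensional_restrict)
        finally show ?thesis using True by (simp add: \<Psi>_def cong: restrict_cong)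
      next
        case False
        then have "G k = undefined" using G by (simp add: power_module_simps(1) PiE_def extensional_def)
        then show ?thesis using False by (simp add: \<Psi>_def)
      qed
    qed
    ultimately show "G \<in> \<Psi> ` cycles HI i" by blast
  qed
  moreover have "{f \<in> cycles HI i. \<Psi> f = \<zero>\<^bsub>?Nb\<^esub>} = boundaries HI i"
  proof (intro equalityI subsetI)
    fix f assume "f \<in> {f \<in> cycles HI i. \<Psi> f = \<zero>\<^bsub>?Nb\<^esub>}"
    then have f: "f \<in> cycles HI i" and \<Psi>f: "\<Psi> f = \<zero>\<^bsub>?Nb\<^esub>" by simp_all
    have B: "f y \<in> cdiff I (i + 1) ` carrier (cobj I (i + 1))" if y: "y \<in> carrier C" for y
    proof -
      have "\<pi> (f y) k = \<zero>\<^bsub>M\<^esub>" if "k < b" for k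
        using fun_cong[OF fun_cong[OF \<Psi>f, of k], of y] that y
        by (simp add: \<Psi>_def power_module_simps(2) Hom_module_simps(2))
      moreover have "\<pi> (f y) \<in> carrier ?Mb" by (rule module_homD(1)[OF \<pi>f[OF f] y])
      ultimately have "\<pi> (f y) = \<zero>\<^bsub>?Mb\<^esub>"
        by (auto simp: power_module_simps fun_eq_iff PiE_def extensional_def)
      then show ?thesis using cyc(3)[OF f y] \<pi>(3) by blast
    qed
    obtain h where h: "h \<in> module_hom R C (cobj I (i + 1))"
      "\<And>y. y \<in> carrier C \<Longrightarrow> h y \<in> carrier (cobj I (i + 1))"
      "\<And>y. y \<in> carrier C \<Longrightarrow> cdiff I (i + 1) (h y) = f y"
    proof (rule hom_C_lift[OF I_module I_module carrier_submodule[OF I_module] d_restrict[OF chain] _ cyc(2)[OF f]])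
      show "ext.exact_at (cobj I (i + 1)) {x \<in> carrier (cobj I (i + 1)). cdiff I (i + 1) x = \<zero>\<^bsub>cobj I i\<^esub>} 1"
        using ex(1)[of 1 "i + 1"] by simp
      show "f y \<in> cdiff I (i + 1) ` carrier (cobj I (i + 1))" if "y \<in> carrier C" for y
        by (rule B[OF that])
    qed (rule that)
    have "f = cdiff HI (i + 1) (restrict h (carrier C))"
      using h(3) cyc(1)[OF f] by (auto simp: Hom_cpx_simps Hom_module_simps(1) fun_eq_iff extensional_def)
    then show "f \<in> boundaries HI i"
      using Hom_moduleI[OF h(1) C] by (auto simp: Hom_cpx_simps(1))
  next
    fix f assume f: "f \<in> boundaries HI i"
    then have fc: "f \<in> cycles HI i" using boundaries_in_cycles[OF chain_HI] by blast
    obtain h where h: "h \<in> carrier (Hom_module R C (cobj I (i + 1)))" "f = cdiff HI (i + 1) h"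
      using f by (auto simp: Hom_cpx_simps(1))
    have "\<pi> (f y) = \<zero>\<^bsub>?Mb\<^esub>" if y: "y \<in> carrier C" for y
    proof -
      have "f y \<in> boundaries I i" using h y Hom_moduleD(2)[OF h(1) y] by (simp add: Hom_cpx_simps)
      then show ?thesis using \<pi>(3) by blast
    qed
    then have "\<Psi> f = \<zero>\<^bsub>?Nb\<^esub>"
      by (auto simp: \<Psi>_def power_module_simps(2) Hom_module_simps(2) fun_eq_iff)
    then show "f \<in> {f \<in> cycles HI i. \<Psi> f = \<zero>\<^bsub>?Nb\<^esub>}" using fc by simp
  qed
  ultimately show ?thesis
    unfolding isomorphic_homology_iff[OF chain_HI module_power[OF HM_module]] by blast
qed

lemma ev_I: "ev_exact (cobj I i)"
  by (rule ev_exact_injective[OF I_inj hty])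

lemma tor_HI: "0 < j \<Longrightarrow> tor.exact_at (cobj HI i) (carrier (cobj HI i)) (- j)"
  unfolding Hom_cpx_simps(1) by (rule tor_exact_at_Hom_injective[OF I_inj ext_C])

lemma tor_power_HM:
  "0 < j \<Longrightarrow> tor.exact_at (power_module HM b) (carrier (power_module HM b)) (- j)"
  by (rule tor.exact_at_power[OF HM_module tor_M])

text \<open>Naturality of evaluation, the bridge between the differentials of Hom(C, I) and of
  \<open>I\<close>.\<close>

lemma ev_HI_diff:
  assumes g: "g \<in> {..<n 0} \<rightarrow> carrier (cobj HI i)"
  shows "ev (cobj I (i - 1)) (\<lambda>l. cdiff HI i (g l)) = cdiff I i (ev (cobj I i) g)"
proof -
  interpret I': module R "cobj I (i - 1)" by (rule I_module)
  have gc: "g l (c l) \<in> carrier (cobj I i)" if "l < n 0" for l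
  proof -
    have "g l \<in> carrier (Hom_module R C (cobj I i))" "c l \<in> carrier C"
      using g c_closed that by (auto simp: Hom_cpx_simps(1))
    then show ?thesis by (rule Hom_moduleD(2))
  qed
  have "cdiff I i (ev (cobj I i) g) = (\<Oplus>\<^bsub>cobj I (i - 1)\<^esub>l\<in>{..<n 0}. cdiff I i (g l (c l)))"
    unfolding ev_def using gc
    by (intro finsum_module_hom[OF I_module I_module chain_cpxD(2)[OF chain]]) simp
  also have "\<dots> = ev (cobj I (i - 1)) (\<lambda>l. cdiff HI i (g l))"
    unfolding ev_def
  proof (intro I'.finsum_cong' refl)
    show "(\<lambda>l. cdiff HI i (g l) (c l)) \<in> {..<n 0} \<rightarrow> carrier (cobj I (i - 1))"
      using gc module_homD(1)[OF chain_cpxD(2)[OF chain]] c_closed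
      by (simp add: Hom_cpx_simps(2) Pi_iff)
    show "cdiff I i (g l (c l)) = cdiff HI i (g l) (c l)" if "l \<in> {..<n 0}" for l
      using c_closed that by (simp add: Hom_cpx_simps(2) Pi_iff)
  qed
  finally show ?thesis by simp
qed

text \<open>Dimension shifting up the complex, starting from its bottom degree.\<close>

lemma tor_exact_cycles:
  assumes bdd: "\<And>i. i < t \<Longrightarrow> trivial_module (cobj I i)"
    and iso: "\<And>i. \<exists>b. isomorphic_modules R (homology HI i) (power_module HM b)"
  shows "0 < j \<Longrightarrow> tor.exact_at (cobj HI i) (cycles HI i) (- j)"
    and "0 < j \<Longrightarrow> tor.exact_at (cobj HI i) (boundaries HI i) (- j)"
proof -
  \<comment> \<open>From 0 -> B_i -> Z_i -> Hom(C, M)^b -> 0: Tor_j(C, B_i) sits between Tor_(j+1)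
    of the power and Tor_j of the cycles.\<close>
  have image: "tor.exact_at (cobj HI i) (boundaries HI i) (- j)"
    if ex: "\<And>j. 0 < j \<Longrightarrow> tor.exact_at (cobj HI i) (cycles HI i) (- j)" and j: "0 < j" for i j
  proof -
    obtain b \<rho> where \<rho>: "\<rho> \<in> module_hom R (cobj HI i\<lparr>carrier := cycles HI i\<rparr>) (power_module HM b)"
      "\<rho> ` cycles HI i = carrier (power_module HM b)"
      "{x \<in> cycles HI i. \<rho> x = \<zero>\<^bsub>power_module HM b\<^esub>} = boundaries HI i"
      using iso[of i] isomorphic_homology_iff[OF chain_HI module_power[OF HM_module]] by blast
    have "- j - 1 = - (j + 1)" by simp
    then have pw: "tor.exact_at (power_module HM b) (carrier (power_module HM b)) (- j - 1)"
      using tor_power_HM[of "j + 1" b] j by simp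
    show ?thesis
      unfolding \<rho>(3)[symmetric]
      by (rule tor.exact_at_kernel[OF HI_module module_power[OF HM_module]
            cycles_submodule[OF chain_HI] \<rho>(1) ex[OF j]]) (unfold \<rho>(2), rule pw)
  qed
  have triv: "tor.exact_at (cobj HI i) (cycles HI i) (- j)" if i: "i < t" for i j
  proof -
    have "trivial_module (cobj HI i)"
      unfolding Hom_cpx_simps(1) trivial_Hom_iff[OF I_module ev_I] by (rule bdd[OF i])
    from cycles_trivial(1)[OF chain_HI this] show ?thesis
      by (simp only:) (rule tor.exact_at_trivial[OF HI_module], simp_all)
  qed
  \<comment> \<open>Upward induction from t - 1, a degree in which Hom(C, I) is zero. The step uses
    0 -> Z_(i+1) -> Hom(C, I_(i+1)) -> B_i -> 0 and the vanishing of Tor on Hom(C, I_(i+1)).\<close>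
  have cyc: "\<forall>j>0. tor.exact_at (cobj HI i) (cycles HI i) (- j)" if "t - 1 \<le> i" for i
    using that
  proof (induction i rule: int_ge_induct)
    case base
    then show ?case using triv[of "t - 1"] by simp
  next
    case (step i)
    show ?case
    proof (intro allI impI)
      fix j :: int assume j: "0 < j"
      have ex: "tor.exact_at (cobj HI i) (cycles HI i) (- j)" if "0 < j" for j
        using step.IH that by simp
      have "- j - 1 = - (j + 1)" by simp
      then have B: "tor.exact_at (cobj HI i) (boundaries HI i) (- j - 1)"
        using image[OF ex, of "j + 1"] j by simp
      have "tor.exact_at (cobj HI (i + 1))
          {x \<in> carrier (cobj HI (i + 1)). cdiff HI (i + 1) x = \<zero>\<^bsub>cobj HI i\<^esub>} (- j)"
        by (rule tor.exact_at_kernel[OF HI_module HI_module carrier_submodule[OF HI_module]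
              d_restrict[OF chain_HI] tor_HI[OF j] B])
      then show "tor.exact_at (cobj HI (i + 1)) (cycles HI (i + 1)) (- j)" by simp
    qed
  qed
  have all: "tor.exact_at (cobj HI i) (cycles HI i) (- j)" if "0 < j" for i j
    using cyc[of i] triv[of i j] that by (cases "t - 1 \<le> i") auto
  then show "0 < j \<Longrightarrow> tor.exact_at (cobj HI i) (cycles HI i) (- j)" .
  show "0 < j \<Longrightarrow> tor.exact_at (cobj HI i) (boundaries HI i) (- j)" by (rule image[OF all])
qed

text \<open>The isomorphism \<open>H(Hom(C, I)) \<cong> Hom(C, M)\<^sup>b\<close> induces \<open>H(I) \<cong> M\<^sup>b\<close>: by exactness of
  \<open>C \<otimes> -\<close> a cycle of \<open>I\<close> is the evaluation of a tuple of cycles of \<open>Hom(C, I)\<close>, unique up to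
  the relations between the generators of \<open>C\<close>.\<close>

lemma homology_of_Hom_cpx:
  assumes bdd: "\<And>i. i < t \<Longrightarrow> trivial_module (cobj I i)"
    and iso: "\<And>i. \<exists>b. isomorphic_modules R (homology HI i) (power_module HM b)"
    and b: "isomorphic_modules R (homology HI i) (power_module HM b)"
  shows "isomorphic_modules R (homology I i) (power_module M b)"
proof -
  have ex: "tor.exact_at (cobj HI k) (boundaries HI k) (- 1)" for k
  proof (rule tor_exact_cycles(2)[of t])
    show "trivial_module (cobj I k)" if "k < t" for k using that by (rule bdd)
  qed (use iso in simp_all)
  let ?Mb = "power_module M b" and ?Nb = "power_module HM b"
  let ?I = "cobj I i" and ?J = "cobj HI i" and ?Z = "cycles HI i"
  have Mb: "module R ?Mb" by (rule module_power[OF M])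
  have Nb: "module R ?Nb" by (rule module_power[OF HM_module])
  note Im = I_module and Jm = HI_module
  note cI = chain and cJ = chain_HI
  interpret M: module R M by (rule M)
  have H: "Hom_module R C (cobj I j) = cobj HI j" for j by (simp add: Hom_cpx_simps(1))
  have dJ: "cdiff HI j \<in> module_hom R (cobj HI j) (cobj HI (j - 1))" for j by (rule chain_cpxD(2)[OF cJ])
  obtain \<rho> where \<rho>: "\<rho> \<in> module_hom R (?J\<lparr>carrier := ?Z\<rparr>) ?Nb"
    "\<rho> ` ?Z = carrier ?Nb" "{x \<in> ?Z. \<rho> x = \<zero>\<^bsub>?Nb\<^esub>} = boundaries HI i"
    using b isomorphic_homology_iff[OF cJ Nb] by blast
  note ZJ = cycles_submodule[OF cJ, of i]
  note ZJD = submoduleD[OF Jm ZJ]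
  have Zsub: "g \<in> S \<rightarrow> carrier ?J" if "g \<in> S \<rightarrow> ?Z" for g :: "nat \<Rightarrow> 'c \<Rightarrow> 'i" and S
    using that ZJD(1) unfolding Pi_iff by blast
  have \<rho>_in: "\<rho> f \<in> carrier ?Nb" if "f \<in> ?Z" for f using module_homD(1)[OF \<rho>(1), of f] that by simp
  have \<rho>_k: "(\<lambda>l. \<rho> (g l) k) \<in> {..<q} \<rightarrow> carrier HM" if "g \<in> {..<q} \<rightarrow> ?Z" "k < b" for g q k
  proof
    fix l assume "l \<in> {..<q}"
    then have "\<rho> (g l) \<in> carrier ?Nb" using \<rho>_in that(1) unfolding Pi_iff by blast
    then show "\<rho> (g l) k \<in> carrier HM" using that(2) by (auto simp: power_module_simps)
  qed
  have ev_in_cycles: "ev ?I g \<in> cycles I i" if g: "g \<in> {..<n 0} \<rightarrow> ?Z" for g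
  proof -
    have "cdiff I i (ev ?I g) = ev (cobj I (i - 1)) (\<lambda>l. cdiff HI i (g l))"
      by (rule ev_HI_diff[OF Zsub[OF g], symmetric])
    also have "\<dots> = \<zero>\<^bsub>cobj I (i - 1)\<^esub>"
    proof -
      interpret I': module R "cobj I (i - 1)" by (rule Im)
      have "cdiff HI i (g l) (c l) = \<zero>\<^bsub>cobj I (i - 1)\<^esub>" if "l < n 0" for l
      proof -
        have "g l \<in> ?Z" "c l \<in> carrier C" using g c_closed that unfolding Pi_iff by blast+
        then show ?thesis unfolding Hom_cycles_iff by (simp add: Hom_cpx_simps(2))
      qed
      then have "ev (cobj I (i - 1)) (\<lambda>l. cdiff HI i (g l))
          = (\<Oplus>\<^bsub>cobj I (i - 1)\<^esub>l\<in>{..<n 0}. \<zero>\<^bsub>cobj I (i - 1)\<^esub>)"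
        unfolding ev_def by (intro I'.finsum_cong') auto
      then show ?thesis by simp
    qed
    finally show ?thesis using ev_closed[OF Im] Zsub[OF g] H by simp
  qed
  \<comment> \<open>Evaluation is onto, but the tuple g it provides need not consist of cycles. Its
    boundary evaluates to dz = 0, so it is a relation over Hom(C, I_(i-1)); the coefficients of this
    relation are moved into the cycles, then into the boundaries, lifted along the differential, and
    the resulting relation is subtracted from g.\<close>
  have lift_cycle: "\<exists>g\<in>{..<n 0} \<rightarrow> ?Z. ev ?I g = z" if z: "z \<in> cycles I i" for z
  proof -
    let ?J' = "cobj HI (i - 1)"
    obtain g where g: "g \<in> {..<n 0} \<rightarrow> carrier ?J" "ev ?I g = z"
      using ev_I[of i] z unfolding ev_exact_def H by blast
    let ?x = "\<lambda>l. cdiff HI i (g l)"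
    have xB: "?x \<in> {..<n 0} \<rightarrow> boundaries HI (i - 1)" using g(1) by auto
    then have xZ: "?x \<in> {..<n 0} \<rightarrow> cycles HI (i - 1)"
      using boundaries_in_cycles[OF cJ, of "i - 1"] unfolding Pi_iff by blast
    then have xJ: "?x \<in> {..<n 0} \<rightarrow> carrier ?J'" unfolding Pi_iff by blast
    have "ev (cobj I (i - 1)) ?x = \<zero>\<^bsub>cobj I (i - 1)\<^esub>" using ev_HI_diff[OF g(1)] g(2) z by simp
    then obtain h where h: "h \<in> {..<n 1} \<rightarrow> carrier ?J'" "\<And>k. k < n 0 \<Longrightarrow> ?x k = tor.D ?J' (- 1) h k"
      using ev_I[of "i - 1"] xJ unfolding ev_exact_def H by blast
    \<comment> \<open>Tor_1(C, B_(i-2)) = 0: the coefficients of the relation can be taken among the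
      cycles.\<close>
    have B2: "tor.exact_at (cobj HI (i - 1 - 1)) (cdiff HI (i - 1) ` carrier ?J') (- 1)"
      using ex[of "i - 1 - 1"] by simp
    have dJ': "cdiff HI (i - 1) \<in> module_hom R (?J'\<lparr>carrier := carrier ?J'\<rparr>) (cobj HI (i - 1 - 1))"
      using dJ[of "i - 1"] by simp
    obtain h1 where h1: "h1 \<in> {..<n (- (- 1))} \<rightarrow> cycles HI (i - 1)"
      "\<And>k. k < n (- (- 1 + 1)) \<Longrightarrow> ?x k = tor.D ?J' (- 1) h1 k"
    proof (rule tor.boundary_in_kernel[OF Jm Jm carrier_submodule[OF Jm] dJ' B2])
      show "?x \<in> {..<n (- (- 1 + 1))} \<rightarrow> cycles HI (i - 1)" using xZ by simp
      show "h \<in> {..<n (- (- 1))} \<rightarrow> carrier ?J'" using h(1) by simp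
      show "?x k = tor.D ?J' (- 1) h k" if "k < n (- (- 1 + 1))" for k using h(2) that by simp
    qed (rule that)
    obtain b' \<rho>' where \<rho>': "\<rho>' \<in> module_hom R (?J'\<lparr>carrier := cycles HI (i - 1)\<rparr>) (power_module HM b')"
      "\<rho>' ` cycles HI (i - 1) = carrier (power_module HM b')"
      "{x \<in> cycles HI (i - 1). \<rho>' x = \<zero>\<^bsub>power_module HM b'\<^esub>} = boundaries HI (i - 1)"
      using iso[of "i - 1"] isomorphic_homology_iff[OF cJ module_power[OF HM_module]] by blast
    \<comment> \<open>Tor_1 of the homology in degree i - 1 vanishes: the coefficients can even be
      taken among the boundaries.\<close>
    have P1: "tor.exact_at (power_module HM b') (\<rho>' ` cycles HI (i - 1)) (- 1)"
      unfolding \<rho>'(2) by (rule tor_power_HM) simp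
    obtain h2 where h2: "h2 \<in> {..<n (- (- 1))} \<rightarrow> boundaries HI (i - 1)"
      "\<And>k. k < n (- (- 1 + 1)) \<Longrightarrow> ?x k = tor.D ?J' (- 1) h2 k"
    proof (rule tor.boundary_in_kernel[OF Jm module_power[OF HM_module] cycles_submodule[OF cJ] \<rho>'(1) P1,
          unfolded \<rho>'(3)])
      show "?x \<in> {..<n (- (- 1 + 1))} \<rightarrow> boundaries HI (i - 1)" using xB by simp
      show "h1 \<in> {..<n (- (- 1))} \<rightarrow> cycles HI (i - 1)" by (rule h1(1))
      show "?x k = tor.D ?J' (- 1) h1 k" if "k < n (- (- 1 + 1))" for k by (rule h1(2)[OF that])
    qed (rule that)
    have "h2 \<in> {..<n 1} \<rightarrow> cdiff HI i ` carrier ?J" using h2(1) by simp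
    then obtain h3 where h3: "h3 \<in> {..<n 1} \<rightarrow> carrier ?J" "\<And>k. k < n 1 \<Longrightarrow> cdiff HI i (h3 k) = h2 k"
      using tor.tuple_lift[OF Jm Jm carrier_submodule[OF Jm], of "cdiff HI i" i "i - 1" h2 "n 1"] dJ[of i]
      by auto
    have D3: "tor.D ?J (- 1) h3 k \<in> carrier ?J" for k
      using h3(1) by (intro mact_closed[OF Jm B_closed]) simp
    have dD3: "cdiff HI i (tor.D ?J (- 1) h3 k) = ?x k" if "k < n 0" for k
    proof -
      have h3': "h3 \<in> {..<n (- (- 1))} \<rightarrow> carrier ?J" using h3(1) by simp
      have "cdiff HI i (tor.D ?J (- 1) h3 k) = tor.D ?J' (- 1) (\<lambda>l. cdiff HI i (h3 l)) k"
        by (rule mact_module_hom[OF Jm Jm dJ B_closed h3'])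
      also have "\<dots> = tor.D ?J' (- 1) h2 k"
      proof (rule mact_cong[OF Jm B_closed])
        have "boundaries HI (i - 1) \<subseteq> carrier ?J'" using boundaries_in_cycles[OF cJ, of "i - 1"] by blast
        then show "h2 \<in> {..<n (- (- 1))} \<rightarrow> carrier ?J'" using h2(1) unfolding Pi_iff by blast
      qed (use h3(2) in simp)
      finally show ?thesis using h2(2) that by simp
    qed
    \<comment> \<open>The correction term is a relation, so it evaluates to zero and the corrected
      tuple still evaluates to z.\<close>
    let ?g = "\<lambda>l. g l \<ominus>\<^bsub>?J\<^esub> tor.D ?J (- 1) h3 l"
    have gJ: "g l \<in> carrier ?J" if "l < n 0" for l using g(1) that by auto
    interpret J: module R ?J by (rule Jm)
    have "?g l \<in> ?Z" if l: "l < n 0" for l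
    proof -
      have "cdiff HI i (?g l) = ?x l \<ominus>\<^bsub>?J'\<^esub> ?x l"
        unfolding module_hom_diff[OF Jm Jm dJ gJ[OF l] D3] dD3[OF l] ..
      also have "\<dots> = \<zero>\<^bsub>?J'\<^esub>"
        using xJ l by (intro module_minus_self[OF Jm]) auto
      finally show ?thesis using J.minus_closed[OF gJ[OF l] D3] by simp
    qed
    then have gZ: "?g \<in> {..<n 0} \<rightarrow> ?Z" by simp
    have "ev ?I ?g = ev ?I g \<ominus>\<^bsub>?I\<^esub> ev ?I (tor.D ?J (- 1) h3)"
      using ev_diff[OF Im, of g i "tor.D ?J (- 1) h3"] g(1) D3 unfolding H by simp
    also have "ev ?I (tor.D ?J (- 1) h3) = \<zero>\<^bsub>?I\<^esub>"
      using ev_D[OF Im, of h3 i] h3(1) unfolding H by simp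
    also have "ev ?I g \<ominus>\<^bsub>?I\<^esub> \<zero>\<^bsub>?I\<^esub> = z"
      unfolding g(2) using z by (intro module_minus_zero[OF Im]) simp
    finally show ?thesis using gZ by blast
  qed
  text \<open>The map induced by \<open>\<rho>\<close> on \<open>C \<otimes> Z(Hom(C, I))\<close>.\<close>
  let ?A = "power_module (?J\<lparr>carrier := ?Z\<rparr>) (n 0)"
  define \<phi> where "\<phi> g = (\<lambda>k\<in>{..<b}. ev M (\<lambda>l. \<rho> (g l) k))" for g
  have Zm: "module R (?J\<lparr>carrier := ?Z\<rparr>)" by (rule module_restrict[OF Jm ZJ])
  have A: "module R ?A" by (rule module_power[OF Zm])
  have A_tuple: "g \<in> {..<n 0} \<rightarrow> ?Z" if "g \<in> carrier ?A" for g using that by (simp add: power_module_simps PiE_def)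
  have \<phi>_hom: "\<phi> \<in> module_hom R ?A ?Mb"
    unfolding \<phi>_def[abs_def] ev_def
  proof (intro power_tuple_hom power_sum_hom[OF Zm M])
    fix k l assume k: "k < b" and l: "l < n 0"
    then have "c l \<in> carrier C" using c_closed by auto
    then show "(\<lambda>f. \<rho> f k (c l)) \<in> module_hom R (?J\<lparr>carrier := ?Z\<rparr>) M"
      by (intro module_hom_comp[OF module_hom_comp[OF \<rho>(1) module_power_proj[OF k]] module_Hom_eval])
  qed
  have ZIm: "module R (?I\<lparr>carrier := cycles I i\<rparr>)"
    by (rule module_restrict[OF Im cycles_submodule[OF cI]])
  have p_hom: "ev ?I \<in> module_hom R ?A (?I\<lparr>carrier := cycles I i\<rparr>)"
  proof -
    have "(\<lambda>g. \<Oplus>\<^bsub>?I\<^esub>l\<in>{..<n 0}. g l (c l)) \<in> module_hom R ?A ?I"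
    proof (rule power_sum_hom[OF Zm Im])
      fix l assume "l < n 0"
      then have "c l \<in> carrier C" using c_closed by auto
      then have "(\<lambda>f. f (c l)) \<in> module_hom R ?J ?I" unfolding H[symmetric] by (rule module_Hom_eval)
      then show "(\<lambda>f. f (c l)) \<in> module_hom R (?J\<lparr>carrier := ?Z\<rparr>) ?I" by (rule module_hom_restrict[OF Jm ZJ])
    qed
    then have "ev ?I \<in> module_hom R ?A ?I" by (simp only: ev_def[abs_def])
    from module_homD(2,3)[OF this] ev_in_cycles[OF A_tuple] show ?thesis
      by (intro module_homI) simp_all
  qed
  have A_restrict: "restrict g {..<n 0} \<in> carrier ?A" if "g \<in> {..<n 0} \<rightarrow> ?Z" for g
    using that by (simp add: power_module_simps(1))
  have ev_restrict: "ev ?I (restrict g {..<n 0}) = ev ?I g" if "g \<in> {..<n 0} \<rightarrow> ?Z" for g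
    using Zsub[OF that] unfolding H[symmetric] by (intro ev_cong[OF Im]) simp_all
  have \<phi>_restrict: "\<phi> (restrict g {..<n 0}) = \<phi> g" if "g \<in> {..<n 0} \<rightarrow> ?Z" for g
    unfolding \<phi>_def
  proof (rule restrict_ext)
    fix k assume "k \<in> {..<b}"
    then show "ev M (\<lambda>l. \<rho> (restrict g {..<n 0} l) k) = ev M (\<lambda>l. \<rho> (g l) k)"
      using \<rho>_k[OF that] by (intro ev_cong[OF M]) simp_all
  qed
  have p_surj: "ev ?I ` carrier ?A = carrier (?I\<lparr>carrier := cycles I i\<rparr>)"
  proof (intro equalityI subsetI)
    show "z \<in> carrier (?I\<lparr>carrier := cycles I i\<rparr>)" if "z \<in> ev ?I ` carrier ?A" for z
      using that module_homD(1)[OF p_hom] by blast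
    fix z assume "z \<in> carrier (?I\<lparr>carrier := cycles I i\<rparr>)"
    then have "z \<in> cycles I i" by simp
    then obtain g where g: "g \<in> {..<n 0} \<rightarrow> ?Z" "ev ?I g = z" using lift_cycle by blast
    show "z \<in> ev ?I ` carrier ?A"
      using imageI[OF A_restrict[OF g(1)], of "ev ?I"] by (simp only: ev_restrict[OF g(1)] g(2))
  qed
  have \<rho>_D: "\<rho> (tor.D ?J (- 1) h l) k = tor.D HM (- 1) (\<lambda>l. \<rho> (h l) k) l"
    if h: "h \<in> {..<n 1} \<rightarrow> ?Z" and k: "k < b" for h l k
  proof -
    have h': "h \<in> {..<n (- (- 1))} \<rightarrow> ?Z" using h by simp
    have "(\<lambda>f. \<rho> f k) \<in> module_hom R (?J\<lparr>carrier := ?Z\<rparr>) HM"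
      by (rule module_hom_comp[OF \<rho>(1) module_power_proj[OF k]])
    from mact_restricted_hom[OF Jm HM_module ZJ this B_closed h'] show ?thesis by simp
  qed
  \<comment> \<open>Well-definedness of the induced map. Since Tor_1(C, B_(i-1)) = 0, a tuple of
    cycles with zero evaluation is a relation with cycles as coefficients; \<open>\<rho>\<close> can
    be applied to these, and the result is a relation over Hom(C, M), which evaluation
    kills.\<close>
  have ker: "\<phi> g = \<zero>\<^bsub>?Mb\<^esub>" if g: "g \<in> carrier ?A" and evg: "ev ?I g = \<zero>\<^bsub>?I\<lparr>carrier := cycles I i\<rparr>\<^esub>" for g
  proof -
    note gZ = A_tuple[OF g]
    have "ev ?I g = \<zero>\<^bsub>?I\<^esub>" using evg by simp
    then obtain h where h: "h \<in> {..<n 1} \<rightarrow> carrier ?J" "\<And>k. k < n 0 \<Longrightarrow> g k = tor.D ?J (- 1) h k"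
      using ev_I[of i] Zsub[OF gZ] unfolding ev_exact_def H by blast
    have B1: "tor.exact_at (cobj HI (i - 1)) (cdiff HI i ` carrier ?J) (- 1)"
      using ex[of "i - 1"] by simp
    have dJi: "cdiff HI i \<in> module_hom R (?J\<lparr>carrier := carrier ?J\<rparr>) (cobj HI (i - 1))"
      using dJ[of i] by simp
    obtain h1 where h1: "h1 \<in> {..<n (- (- 1))} \<rightarrow> ?Z"
      "\<And>k. k < n (- (- 1 + 1)) \<Longrightarrow> g k = tor.D ?J (- 1) h1 k"
    proof (rule tor.boundary_in_kernel[OF Jm Jm carrier_submodule[OF Jm] dJi B1])
      show "g \<in> {..<n (- (- 1 + 1))} \<rightarrow> ?Z" using gZ by simp
      show "h \<in> {..<n (- (- 1))} \<rightarrow> carrier ?J" using h(1) by simp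
      show "g k = tor.D ?J (- 1) h k" if "k < n (- (- 1 + 1))" for k using h(2) that by simp
    qed (rule that)
    have h1': "h1 \<in> {..<n 1} \<rightarrow> ?Z" using h1(1) by simp
    have "ev M (\<lambda>l. \<rho> (g l) k) = \<zero>\<^bsub>M\<^esub>" if k: "k < b" for k
    proof -
      let ?h = "\<lambda>l. \<rho> (h1 l) k"
      have hk: "?h \<in> {..<n 1} \<rightarrow> carrier HM" by (rule \<rho>_k[OF h1' k])
      then have "tor.D HM (- 1) ?h l \<in> carrier HM" for l by (intro mact_closed[OF HM_module B_closed]) simp
      then have "ev M (\<lambda>l. \<rho> (g l) k) = ev M (tor.D HM (- 1) ?h)"
        using h1(2) \<rho>_D[OF h1' k] by (intro ev_cong[OF M]) simp_all
      then show ?thesis using ev_D[OF M hk] by simp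
    qed
    then show ?thesis by (simp add: \<phi>_def power_module_simps(2) cong: restrict_cong)
  qed
  obtain \<pi> where \<pi>: "\<pi> \<in> module_hom R (?I\<lparr>carrier := cycles I i\<rparr>) ?Mb"
    "\<And>g. g \<in> carrier ?A \<Longrightarrow> \<pi> (ev ?I g) = \<phi> g"
    by (rule hom_factor[OF A ZIm Mb p_hom \<phi>_hom p_surj ker]) (assumption, assumption, rule that)
  have \<pi>': "\<pi> (ev ?I g) = \<phi> g" if "g \<in> {..<n 0} \<rightarrow> ?Z" for g
    using \<pi>(2)[OF A_restrict[OF that]] ev_restrict[OF that] \<phi>_restrict[OF that] by simp
  have \<rho>_lift: "\<exists>y\<in>{..<q} \<rightarrow> ?Z. \<forall>l<q. \<rho> (y l) = w l" if "w \<in> {..<q} \<rightarrow> carrier ?Nb" for w and q :: nat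
  proof -
    have "w \<in> {..<q} \<rightarrow> \<rho> ` ?Z" unfolding \<rho>(2) by (rule that)
    then obtain y where "y \<in> {..<q} \<rightarrow> ?Z" "\<And>l. l < q \<Longrightarrow> \<rho> (y l) = w l"
      by (rule tor.tuple_lift[OF Jm Nb ZJ \<rho>(1)]) (rule that)
    then show ?thesis by blast
  qed
  have "\<pi> ` cycles I i = carrier ?Mb"
  proof (intro equalityI subsetI)
    show "v \<in> carrier ?Mb" if "v \<in> \<pi> ` cycles I i" for v
      using that module_homD(1)[OF \<pi>(1)] by auto
    fix v assume v: "v \<in> carrier ?Mb"
    \<comment> \<open>Each coordinate of v is an evaluation over \<open>M\<close>; the tuples for
      all coordinates are regrouped by generator of \<open>C\<close> and lifted through
      \<open>\<rho>\<close>.\<close>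
    have "\<exists>G. G \<in> {..<n 0} \<rightarrow> carrier HM \<and> ev M G = v k" if "k < b" for k
    proof -
      have "v k \<in> carrier M" using v that by (auto simp: power_module_simps)
      then show ?thesis using ev_M unfolding ev_exact_def by blast
    qed
    then have "\<forall>k\<in>{..<b}. \<exists>G. G \<in> {..<n 0} \<rightarrow> carrier HM \<and> ev M G = v k" by simp
    then obtain G where G: "\<forall>k\<in>{..<b}. G k \<in> {..<n 0} \<rightarrow> carrier HM \<and> ev M (G k) = v k"
      by (rule bchoice[THEN exE])
    have Gk: "G k \<in> {..<n 0} \<rightarrow> carrier HM" "ev M (G k) = v k" if "k < b" for k
      using bspec[OF G, of k] that by auto
    have "(\<lambda>l. \<lambda>k\<in>{..<b}. G k l) \<in> {..<n 0} \<rightarrow> carrier ?Nb"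
      using Gk(1) by (simp add: power_module_simps(1) Pi_iff)
    from \<rho>_lift[OF this] obtain g where g: "g \<in> {..<n 0} \<rightarrow> ?Z" "\<forall>l<n 0. \<rho> (g l) = (\<lambda>k\<in>{..<b}. G k l)" by blast
    have "\<phi> g = v"
    proof
      fix k
      show "\<phi> g k = v k"
      proof (cases "k < b")
        case True
        have "ev M (\<lambda>l. \<rho> (g l) k) = ev M (G k)"
          using g(2) True by (intro ev_cong[OF M Gk(1)]) simp_all
        then show ?thesis using True Gk(2) by (simp add: \<phi>_def)
      next
        case False
        then have "v k = undefined" using v by (simp add: power_module_simps(1) PiE_def extensional_def)
        then show ?thesis using False by (simp add: \<phi>_def)
      qed
    qed
    then have "v = \<pi> (ev ?I g)" using \<pi>'[OF g(1)] by simp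
    then show "v \<in> \<pi> ` cycles I i" using ev_in_cycles[OF g(1)] by blast
  qed
  moreover have "{z \<in> cycles I i. \<pi> z = \<zero>\<^bsub>?Mb\<^esub>} = boundaries I i"
  proof (intro equalityI subsetI)
    fix z assume "z \<in> {z \<in> cycles I i. \<pi> z = \<zero>\<^bsub>?Mb\<^esub>}"
    then have z: "z \<in> cycles I i" and \<pi>z: "\<pi> z = \<zero>\<^bsub>?Mb\<^esub>" by blast+
    obtain g where g: "g \<in> {..<n 0} \<rightarrow> ?Z" "ev ?I g = z" using lift_cycle[OF z] by blast
    have \<phi>g: "\<phi> g = \<zero>\<^bsub>?Mb\<^esub>" using \<pi>'[OF g(1)] g(2) \<pi>z by simp
    have evk: "ev M (\<lambda>l. \<rho> (g l) k) = \<zero>\<^bsub>M\<^esub>" if "k < b" for k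
      using fun_cong[OF \<phi>g, of k] that by (simp add: \<phi>_def power_module_simps(2))
    \<comment> \<open>Exactness of the evaluation over \<open>M\<close> gives a relation for each
      coordinate. Lifted to a relation with cycles y as coefficients, it can be subtracted from g
      without changing the evaluation, and what is left is sent to zero by \<open>\<rho>\<close>, so
      consists of boundaries.\<close>
    have "\<exists>h. h \<in> {..<n 1} \<rightarrow> carrier HM \<and> (\<forall>l<n 0. \<rho> (g l) k = tor.D HM (- 1) h l)" if k: "k < b" for k
      using ev_M \<rho>_k[OF g(1) k] evk[OF k] unfolding ev_exact_def by blast
    then have "\<forall>k\<in>{..<b}. \<exists>h. h \<in> {..<n 1} \<rightarrow> carrier HM \<and> (\<forall>l<n 0. \<rho> (g l) k = tor.D HM (- 1) h l)" by simp
    then obtain h where "\<forall>k\<in>{..<b}. h k \<in> {..<n 1} \<rightarrow> carrier HM \<and> (\<forall>l<n 0. \<rho> (g l) k = tor.D HM (- 1) (h k) l)"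
      by (rule bchoice[THEN exE])
    then have h: "h k \<in> {..<n 1} \<rightarrow> carrier HM" "\<forall>l<n 0. \<rho> (g l) k = tor.D HM (- 1) (h k) l" if "k < b" for k
      using that by auto
    have "(\<lambda>l. \<lambda>k\<in>{..<b}. h k l) \<in> {..<n 1} \<rightarrow> carrier ?Nb"
      using h(1) by (simp add: power_module_simps(1) Pi_iff)
    from \<rho>_lift[OF this] obtain y where y: "y \<in> {..<n 1} \<rightarrow> ?Z" "\<forall>l<n 1. \<rho> (y l) = (\<lambda>k\<in>{..<b}. h k l)" by blast
    have y': "y \<in> {..<n (- (- 1))} \<rightarrow> ?Z" using y(1) by simp
    have Dy: "tor.D ?J (- 1) y l \<in> ?Z" for l by (rule mact_submodule[OF Jm ZJ B_closed y'])
    have gl: "g l \<in> ?Z" if "l < n 0" for l using g(1) that unfolding Pi_iff by blast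
    let ?g = "\<lambda>l. g l \<ominus>\<^bsub>?J\<^esub> tor.D ?J (- 1) y l"
    have "?g l \<in> boundaries HI i" if l: "l < n 0" for l
    proof -
      have "\<rho> (g l) k = \<rho> (tor.D ?J (- 1) y l) k" if k: "k < b" for k
      proof -
        have "\<rho> (tor.D ?J (- 1) y l) k = tor.D HM (- 1) (\<lambda>l. \<rho> (y l) k) l" by (rule \<rho>_D[OF y(1) k])
        also have "\<dots> = tor.D HM (- 1) (h k) l"
          using h(1)[OF k] y(2) k by (intro mact_cong[OF HM_module B_closed]) simp_all
        finally show ?thesis using h(2)[OF k] l by simp
      qed
      then have "\<rho> (g l) = \<rho> (tor.D ?J (- 1) y l)"
        using \<rho>_in[OF gl[OF l]] \<rho>_in[OF Dy] unfolding power_module_simps(1)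
        by (intro PiE_ext[of "\<rho> (g l)" "{..<b}" "\<lambda>_. carrier HM"]) simp_all
      then have "\<rho> (?g l) = \<zero>\<^bsub>?Nb\<^esub>"
        unfolding restricted_hom_diff[OF Jm Nb ZJ \<rho>(1) gl[OF l] Dy]
        using module_minus_self[OF Nb \<rho>_in[OF Dy]] by simp
      then show ?thesis using ZJD(5)[OF gl[OF l] Dy] \<rho>(3) by blast
    qed
    then have "?g \<in> {..<n 0} \<rightarrow> cdiff HI (i + 1) ` carrier (cobj HI (i + 1))" by blast
    then obtain x where x: "x \<in> {..<n 0} \<rightarrow> carrier (cobj HI (i + 1))"
      "\<And>l. l < n 0 \<Longrightarrow> cdiff HI (i + 1) (x l) = ?g l"
      by (rule tor.tuple_lift[OF Jm Jm carrier_submodule[OF Jm] d_restrict[OF cJ]]) (rule that)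
    have gJ: "?g \<in> {..<n 0} \<rightarrow> carrier ?J" using ZJD(1)[OF ZJD(5)[OF gl Dy]] by blast
    have yJ: "y \<in> {..<n 1} \<rightarrow> carrier ?J" by (rule Zsub[OF y(1)])
    have "ev ?I ?g = ev ?I g \<ominus>\<^bsub>?I\<^esub> ev ?I (tor.D ?J (- 1) y)"
      using ev_diff[OF Im, of g i "tor.D ?J (- 1) y"] Zsub[OF g(1)] ZJD(1)[OF Dy] unfolding H by blast
    also have "ev ?I (tor.D ?J (- 1) y) = \<zero>\<^bsub>?I\<^esub>"
      using ev_D[OF Im, of y i] yJ unfolding H by blast
    also have "ev ?I g \<ominus>\<^bsub>?I\<^esub> \<zero>\<^bsub>?I\<^esub> = z"
      unfolding g(2) using z by (intro module_minus_zero[OF Im]) simp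
    finally have "z = ev ?I ?g" by simp
    also have "\<dots> = ev ?I (\<lambda>l. cdiff HI (i + 1) (x l))"
      using gJ x(2) unfolding H[symmetric] by (intro ev_cong[OF Im, symmetric]) simp_all
    also have "\<dots> = cdiff I (i + 1) (ev (cobj I (i + 1)) x)"
      using ev_HI_diff[OF x(1)] by simp
    finally show "z \<in> boundaries I i"
      using ev_closed[OF Im, of x "i + 1"] x(1) unfolding H by blast
  next
    fix z assume z: "z \<in> boundaries I i"
    then have zZ: "z \<in> cycles I i" using boundaries_in_cycles[OF cI] by blast
    obtain x where x: "x \<in> carrier (cobj I (i + 1))" "z = cdiff I (i + 1) x" using z by blast
    \<comment> \<open>A preimage of z is itself an evaluation, so z is the evaluation of a tuple of
      boundaries of Hom(C, I), on which \<open>\<rho>\<close> vanishes.\<close>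
    obtain g where g: "g \<in> {..<n 0} \<rightarrow> carrier (cobj HI (i + 1))" "ev (cobj I (i + 1)) g = x"
      using ev_I[of "i + 1"] x(1) unfolding ev_exact_def H by blast
    let ?g = "\<lambda>l. cdiff HI (i + 1) (g l)"
    have gB: "?g l \<in> {f \<in> ?Z. \<rho> f = \<zero>\<^bsub>?Nb\<^esub>}" if "l < n 0" for l
      unfolding \<rho>(3) using g(1) that by auto
    then have gZ: "?g \<in> {..<n 0} \<rightarrow> ?Z" by blast
    have "z = ev ?I ?g" using ev_HI_diff[OF g(1)] g(2) x(2) by simp
    moreover have "\<phi> ?g = \<zero>\<^bsub>?Mb\<^esub>"
    proof -
      have "ev M (\<lambda>l. \<rho> (?g l) k) = \<zero>\<^bsub>M\<^esub>" if k: "k < b" for k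
      proof -
        have "\<rho> (?g l) k (c l) = \<zero>\<^bsub>M\<^esub>" if l: "l < n 0" for l
        proof -
          have "c l \<in> carrier C" using c_closed l by auto
          moreover have "\<rho> (?g l) = \<zero>\<^bsub>?Nb\<^esub>" using gB[OF l] by blast
          ultimately show ?thesis using k by (simp add: power_module_simps(2) Hom_module_simps(2))
        qed
        then have "ev M (\<lambda>l. \<rho> (?g l) k) = (\<Oplus>\<^bsub>M\<^esub>l\<in>{..<n 0}. \<zero>\<^bsub>M\<^esub>)"
          unfolding ev_def by (intro M.finsum_cong') auto
        then show ?thesis by simp
      qed
      then show ?thesis by (simp add: \<phi>_def power_module_simps(2) cong: restrict_cong)
    qed
    ultimately have "\<pi> z = \<zero>\<^bsub>?Mb\<^esub>" using \<pi>'[OF gZ] by simp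
    then show "z \<in> {z \<in> cycles I i. \<pi> z = \<zero>\<^bsub>?Mb\<^esub>}" using zZ by blast
  qed
  ultimately show ?thesis unfolding isomorphic_homology_iff[OF cI Mb] using \<pi>(1) by blast
qed

end

end

section \<open>Comparison of resolutions and dimensions\<close>

lemma fg_resolution_of_chosen:
  assumes "cring R" "noetherian_ring R" "module R C" "finitely_generated_module R C"
  obtains e where "fg_free_resolution R C (chosen_resolution R C) e"
proof -
  have "\<exists>e. fg_free_resolution R C (chosen_resolution R C) e"
    unfolding chosen_resolution_def
    using someI_ex[OF exists_fg_free_resolution[OF assms]] .
  then show ?thesis using that by blast
qed

text \<open>\<open>Ext\<close> and \<open>Tor\<close> are defined by
  \<open>chosen_resolution\<close>, and the matrices are taken from that very resolution, so no
  comparison of resolutions arises.\<close>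

lemma bass_situation_exists:
  fixes R :: "'r ring" and C :: "('r, 'c) module" and M :: "('r, 'm) module"
  assumes R: "cring R" "noetherian_ring R" and C: "semidualizing R C" and M: "M \<in> Bass_class R C"
  obtains n d e where "bass_situation R C n d e M"
proof -
  have mC: "module R C" and fgC: "finitely_generated_module R C"
    and hty: "homothety R C \<in> module_iso R (regular_module R) (Hom_module R C C)"
    and extC: "\<And>i. 0 < i \<Longrightarrow> trivial_module (Ext R i C C)"
    using C by (simp_all add: semidualizing_def)
  have mM: "module R M"
    and ev: "evaluation_map R M \<in> module_iso R (tensor_product R C (Hom_module R C M)) M"
    and extM: "\<And>i. 0 < i \<Longrightarrow> trivial_module (Ext R i C M)"
    and torM: "\<And>i. 0 < i \<Longrightarrow> trivial_module (Tor R i C (Hom_module R C M))"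
    using M by (simp_all add: Bass_class_def)
  let ?P = "chosen_resolution R C"
  obtain e where res: "fg_free_resolution R C ?P e" by (rule fg_resolution_of_chosen[OF R mC fgC])
  obtain n where pres: "presentation R C n (cdiff ?P) e" and P: "cobj ?P = (\<lambda>i. free_module R {..<n i})"
    by (rule presentation_of_resolution[OF R(1) mC res])
  interpret presentation R C n "cdiff ?P" e by (rule pres)
  have pos: "int (nat i) = i \<and> 0 < nat i" if "0 < i" for i using that by simp
  have "bass_situation R C n (cdiff ?P) e M"
  proof (intro bass_situation.intro bass_situation_axioms.intro pres mM hty ev_exact_of_evaluation ev)
    fix i :: int assume i: "0 < i"
    show "ext.exact_at C (carrier C) i"
      using extC[of "nat i"] pos[OF i] by (intro ext_exact_at_of_trivial[OF P refl mC i]) (simp add: Ext_def)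
    show "ext.exact_at M (carrier M) i"
      using extM[of "nat i"] pos[OF i] by (intro ext_exact_at_of_trivial[OF P refl mM i]) (simp add: Ext_def)
    show "tor.exact_at (Hom_module R C M) (carrier (Hom_module R C M)) (- i)"
      using torM[of "nat i"] pos[OF i]
      by (intro tor_exact_at_of_trivial[OF P refl module_Hom[OF mC mM]]) (simp add: Tor_def)
  qed
  then show ?thesis by (rule that)
qed

lemma bounded_cpxD:
  assumes "bounded_cpx X"
  shows "bounded_above_cpx X" "\<exists>t. \<forall>i<t. trivial_module (cobj X i)"
  using assms unfolding bounded_cpx_def bounded_above_cpx_def by blast+

lemma le_cpx_sup: "\<not> trivial_module (cobj X i) \<Longrightarrow> ereal (of_int i) \<le> cpx_sup X"
  unfolding cpx_sup_def by (rule SUP_upper) simp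

context bass_situation
begin

text \<open>The exponents of the homology of \<open>I\<close> and of Hom(C, I) agree. Nontriviality
  of \<open>M\<close> matters: a nonzero bounded acyclic complex of injectives is a quasi-injective
  resolution of the zero module, as powers of 0 with nonzero exponent are zero, while the zero
  module has no \<open>C\<close>-quasi-injective resolution, since the homology of Hom(C, I) would
  have to vanish and not to vanish.\<close>

lemma quasi_injective_iff:
  fixes I :: "('r, 'i) cpx"
  assumes nt: "\<not> trivial_module M"
  shows "bounded_cpx I \<and> quasi_injective_resolution R M I \<longleftrightarrow>
    C_quasi_injective_resolution R C (Hom_module R C M) I"
    (is "?qi \<longleftrightarrow> ?Cqi")
proof
  let ?HI = "Hom_cpx R C I"
  have ntH: "\<not> trivial_module (Hom_module R C M)" using nt trivial_Hom_iff[OF M ev_M] by simp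
  {
    assume ?qi
    then have bdd: "bounded_cpx I" and I: "injective_cpx R I" by (simp_all add: quasi_injective_resolution_def)
    from \<open>?qi\<close> obtain b where b: "\<And>i. ereal (of_int i) \<le> cpx_sup I \<Longrightarrow>
        isomorphic_modules R (homology I i) (power_module M (b i))"
      and nz: "\<exists>i. ereal (of_int i) \<le> cpx_sup I \<and> b i \<noteq> 0"
      unfolding quasi_injective_resolution_def by blast
    note cI = chain[OF I]
    \<comment> \<open>Above the supremum the definition says nothing about homology, but there
      \<open>I\<close> is zero, which counts as exponent 0.\<close>
    have iso: "\<exists>b. isomorphic_modules R (homology I i) (power_module M b)" for i
    proof (cases "ereal (of_int i) \<le> cpx_sup I")
      case False
      then have "trivial_module (cobj I i)" using le_cpx_sup by blast
      then have "trivial_module (homology I i)"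
        unfolding trivial_homology_iff[OF cI] by (simp only: cycles_trivial[OF cI])
      then show ?thesis using trivial_homology_isomorphic_power_0[OF cI M] by blast
    qed (use b in blast)
    note HI = homology_Hom_cpx[OF I bounded_cpxD(1)[OF bdd] iso]
    obtain i where i: "ereal (of_int i) \<le> cpx_sup I" "b i \<noteq> 0" using nz by blast
    have "\<not> trivial_module (homology ?HI i)"
      using trivial_homology_power_iff[OF chain_HI[OF I] HM_module ntH HI[OF b[OF i(1)]]] i(2) by simp
    then have "\<not> acyclic_cpx ?HI" by (auto simp: acyclic_cpx_def)
    moreover have "\<exists>b. isomorphic_modules R (homology ?HI i) (power_module (Hom_module R C M) b)" for i
      using iso[of i] HI by blast
    ultimately show ?Cqi using I bdd by (simp add: C_quasi_injective_resolution_def)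
  }
  assume ?Cqi
  then have bdd: "bounded_cpx I" and I: "injective_cpx R I" and na: "\<not> acyclic_cpx ?HI"
    and hom: "\<And>i. trivial_module (homology ?HI i) \<or>
       (\<exists>b. isomorphic_modules R (homology ?HI i) (power_module (Hom_module R C M) b))"
    by (simp_all add: C_quasi_injective_resolution_def)
  note cI = chain[OF I] and cH = chain_HI[OF I]
  have iso: "\<exists>b. isomorphic_modules R (homology ?HI i) (power_module (Hom_module R C M) b)" for i
    using hom[of i] trivial_homology_isomorphic_power_0[OF cH HM_module] by blast
  then obtain b where b: "\<And>i. isomorphic_modules R (homology ?HI i) (power_module (Hom_module R C M) (b i))"
    by metis
  obtain t where t: "\<And>i. i < t \<Longrightarrow> trivial_module (cobj I i)" using bounded_cpxD(2)[OF bdd] by blast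
  have H: "isomorphic_modules R (homology I i) (power_module M (b i))" for i
    using t iso b by (rule homology_of_Hom_cpx[OF I])
  obtain i where i: "\<not> trivial_module (homology ?HI i)" using na by (auto simp: acyclic_cpx_def)
  have "b i \<noteq> 0"
    using trivial_homology_power_iff[OF cH HM_module ntH b] i by simp
  \<comment> \<open>The witness degree must not exceed the supremum of \<open>I\<close>; a nonzero
    exponent makes H_i(I) nonzero, hence I_i as well.\<close>
  moreover have "\<not> trivial_module (cobj I i)"
  proof
    assume "trivial_module (cobj I i)"
    then have "trivial_module (homology I i)"
      unfolding trivial_homology_iff[OF cI] by (simp only: cycles_trivial[OF cI])
    then show False using trivial_homology_power_iff[OF cI M nt H] \<open>b i \<noteq> 0\<close> by simp
  qed
  ultimately show ?qi
    using I bdd bounded_cpxD(1)[OF bdd] H le_cpx_sup unfolding quasi_injective_resolution_def by blast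
qed

text \<open>Equal exponents give homology in the same degrees, and Hom(C, -) sends exactly the zero
  terms of \<open>I\<close> to zero.\<close>

lemma Hom_cpx_bounds:
  fixes I :: "('r, 'i) cpx"
  assumes nt: "\<not> trivial_module M" and I: "C_quasi_injective_resolution R C (Hom_module R C M) I"
  shows "cpx_hinf (Hom_cpx R C I) = cpx_hinf I" "cpx_inf (Hom_cpx R C I) = cpx_inf I"
proof -
  let ?HI = "Hom_cpx R C I"
  have ntH: "\<not> trivial_module (Hom_module R C M)" using nt trivial_Hom_iff[OF M ev_M] by simp
  have bdd: "bounded_cpx I" and inj: "injective_cpx R I"
    and hom: "\<And>i. trivial_module (homology ?HI i) \<or>
       (\<exists>b. isomorphic_modules R (homology ?HI i) (power_module (Hom_module R C M) b))"
    using I by (simp_all add: C_quasi_injective_resolution_def)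
  note cI = chain[OF inj] and cH = chain_HI[OF inj]
  have iso: "\<exists>b. isomorphic_modules R (homology ?HI i) (power_module (Hom_module R C M) b)" for i
    using hom[of i] trivial_homology_isomorphic_power_0[OF cH HM_module] by blast
  obtain t where t: "\<And>i. i < t \<Longrightarrow> trivial_module (cobj I i)" using bounded_cpxD(2)[OF bdd] by blast
  have "trivial_module (homology ?HI i) \<longleftrightarrow> trivial_module (homology I i)" for i
  proof -
    obtain b where b: "isomorphic_modules R (homology ?HI i) (power_module (Hom_module R C M) b)"
      using iso by blast
    have "isomorphic_modules R (homology I i) (power_module M b)"
      using t iso b by (rule homology_of_Hom_cpx[OF inj])
    then show ?thesis
      using trivial_homology_power_iff[OF cI M nt] trivial_homology_power_iff[OF cH HM_module ntH b] by simp
  qed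
  then show "cpx_hinf ?HI = cpx_hinf I" by (simp add: cpx_hinf_def)
  have "trivial_module (cobj ?HI i) \<longleftrightarrow> trivial_module (cobj I i)" for i
    unfolding Hom_cpx_simps(1) by (rule trivial_Hom_iff[OF I_module[OF inj] ev_I[OF inj]])
  then show "cpx_inf ?HI = cpx_inf I" by (simp add: cpx_inf_def)
qed

lemma C_qid_eq_qid: "C_qid TYPE('i) R C (Hom_module R C M) = qid TYPE('i) R M"
proof (cases "trivial_module M")
  case True
  then show ?thesis using trivial_Hom_iff[OF M ev_M] by (simp add: C_qid_def qid_def)
next
  case False
  then have ntH: "\<not> trivial_module (Hom_module R C M)" using trivial_Hom_iff[OF M ev_M] by simp
  have "(INF I\<in>{I :: ('r, 'i) cpx. C_quasi_injective_resolution R C (Hom_module R C M) I}.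
        cpx_hinf (Hom_cpx R C I) - cpx_inf (Hom_cpx R C I))
      = (INF I\<in>{I :: ('r, 'i) cpx. bounded_cpx I \<and> quasi_injective_resolution R M I}. cpx_hinf I - cpx_inf I)"
    unfolding quasi_injective_iff[OF False]
    by (intro INF_cong refl) (simp add: Hom_cpx_bounds[OF False])
  then show ?thesis using False ntH by (simp add: C_qid_def qid_def)
qed

end

text \<open>No complex is ever replaced by another one: the same \<open>I\<close> serves both sides,
  so the equality of dimensions holds for each element type \<open>'i\<close> by itself, and the
  equivalence of finiteness is read off from it.\<close>

theorem theorem4p17:
  fixes R :: "'r ring"
    and C :: "('r, 'c) module"
    and M :: "('r, 'm) module"
  assumes "cring R" and "noetherian_ring R"
    and "semidualizing R C"
    and "M \<in> Bass_class R C"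
  shows "(C_qid TYPE('i) R C (Hom_module R C M) < \<infinity> \<longleftrightarrow> qid TYPE('i) R M < \<infinity>) \<and>
    C_qid TYPE('i) R C (Hom_module R C M) = qid TYPE('i) R M \<and>
    (\<not> trivial_module M \<longrightarrow>
      (\<forall>I :: ('r, 'i) cpx. (bounded_cpx I \<and> quasi_injective_resolution R M I) \<longleftrightarrow>
        C_quasi_injective_resolution R C (Hom_module R C M) I))"
proof -
  obtain n d e where "bass_situation R C n d e M" by (rule bass_situation_exists[OF assms])
  then interpret bass_situation R C n d e M .
  show ?thesis using C_qid_eq_qid quasi_injective_iff by metis
qed

end
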